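(* The category $\mathsf{KH}_{\leq}$ of compact ordered spaces and continuous monotone maps is dually equivalent to an $\aleph_1$-ary variety of algebras.
   Context: A compact ordered space is a pair $(X,\leq)$ where $X$ is a compact space and $\leq$ is a partial order on $X$ which is closed in the product topology of $X\times X$ (it follows that $X$ is Hausdorff). An $\aleph_1$-ary variety of algebras is a variety of algebras (an equationally defined class of algebras, regarded as a category with all homomorphisms) in a language consisting of function symbols of at most countably infinite arity. Two categories are dually equivalent if one is equivalent to the opposite of the other. *)

theory Defs
  imports "HOL-Analysis.Analysis" "HOL-Library.Equipollence" "HOL-Library.Extended_Nat"
begin

section \<open>Categories and dual equivalence\<close>

text \<open>Hom-sets are indexed by pairs of objects and need not be disjoint; accordingly identities
  and composition carry their objects as arguments, and for \<open>f : A \<rightarrow> B\<close> and \<open>g : B \<rightarrow> C\<close> the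
  composite of \<open>g\<close> after \<open>f\<close> is \<open>Comp \<C> A B C g f\<close>.\<close>

record ('o, 'm) category =
  Ob :: "'o set"
  Hom :: "'o \<Rightarrow> 'o \<Rightarrow> 'm set"
  Id :: "'o \<Rightarrow> 'm"
  Comp :: "'o \<Rightarrow> 'o \<Rightarrow> 'o \<Rightarrow> 'm \<Rightarrow> 'm \<Rightarrow> 'm"

definition is_category :: "('o, 'm) category \<Rightarrow> bool" where
  "is_category \<C> \<longleftrightarrow>
     (\<forall>A \<in> Ob \<C>. Id \<C> A \<in> Hom \<C> A A) \<and>
     (\<forall>A \<in> Ob \<C>. \<forall>B \<in> Ob \<C>. \<forall>C \<in> Ob \<C>. \<forall>f \<in> Hom \<C> A B. \<forall>g \<in> Hom \<C> B C.
        Comp \<C> A B C g f \<in> Hom \<C> A C) \<and>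
     (\<forall>A \<in> Ob \<C>. \<forall>B \<in> Ob \<C>. \<forall>f \<in> Hom \<C> A B.
        Comp \<C> A A B f (Id \<C> A) = f \<and> Comp \<C> A B B (Id \<C> B) f = f) \<and>
     (\<forall>A \<in> Ob \<C>. \<forall>B \<in> Ob \<C>. \<forall>C \<in> Ob \<C>. \<forall>D \<in> Ob \<C>.
        \<forall>f \<in> Hom \<C> A B. \<forall>g \<in> Hom \<C> B C. \<forall>h \<in> Hom \<C> C D.
        Comp \<C> A C D h (Comp \<C> A B C g f) = Comp \<C> A B D (Comp \<C> B C D h g) f)"

definition opposite :: "('o, 'm) category \<Rightarrow> ('o, 'm) category" where
  "opposite \<C> =
     \<lparr>Ob = Ob \<C>, Hom = (\<lambda>A B. Hom \<C> B A), Id = Id \<C>, Comp = (\<lambda>A B C g f. Comp \<C> C B A f g)\<rparr>"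

definition is_functor ::
  "('o, 'm) category \<Rightarrow> ('p, 'n) category \<Rightarrow> ('o \<Rightarrow> 'p) \<Rightarrow> ('o \<Rightarrow> 'o \<Rightarrow> 'm \<Rightarrow> 'n) \<Rightarrow> bool" where
  "is_functor \<C> \<D> Fo Fm \<longleftrightarrow>
     (\<forall>A \<in> Ob \<C>. Fo A \<in> Ob \<D>) \<and>
     (\<forall>A \<in> Ob \<C>. \<forall>B \<in> Ob \<C>. \<forall>f \<in> Hom \<C> A B. Fm A B f \<in> Hom \<D> (Fo A) (Fo B)) \<and>
     (\<forall>A \<in> Ob \<C>. Fm A A (Id \<C> A) = Id \<D> (Fo A)) \<and>
     (\<forall>A \<in> Ob \<C>. \<forall>B \<in> Ob \<C>. \<forall>C \<in> Ob \<C>. \<forall>f \<in> Hom \<C> A B. \<forall>g \<in> Hom \<C> B C.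
        Fm A C (Comp \<C> A B C g f) = Comp \<D> (Fo A) (Fo B) (Fo C) (Fm B C g) (Fm A B f))"

definition is_iso :: "('o, 'm) category \<Rightarrow> 'o \<Rightarrow> 'o \<Rightarrow> 'm \<Rightarrow> bool" where
  "is_iso \<C> A B f \<longleftrightarrow> f \<in> Hom \<C> A B \<and>
     (\<exists>g \<in> Hom \<C> B A. Comp \<C> A B A g f = Id \<C> A \<and> Comp \<C> B A B f g = Id \<C> B)"

definition is_natural_iso ::
  "('o, 'm) category \<Rightarrow> ('p, 'n) category \<Rightarrow> ('o \<Rightarrow> 'p) \<Rightarrow> ('o \<Rightarrow> 'o \<Rightarrow> 'm \<Rightarrow> 'n) \<Rightarrow>
     ('o \<Rightarrow> 'p) \<Rightarrow> ('o \<Rightarrow> 'o \<Rightarrow> 'm \<Rightarrow> 'n) \<Rightarrow> ('o \<Rightarrow> 'n) \<Rightarrow> bool" where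
  "is_natural_iso \<C> \<D> Fo Fm Go Gm \<eta> \<longleftrightarrow>
     (\<forall>A \<in> Ob \<C>. is_iso \<D> (Fo A) (Go A) (\<eta> A)) \<and>
     (\<forall>A \<in> Ob \<C>. \<forall>B \<in> Ob \<C>. \<forall>f \<in> Hom \<C> A B.
        Comp \<D> (Fo A) (Go A) (Go B) (Gm A B f) (\<eta> A) =
        Comp \<D> (Fo A) (Fo B) (Go B) (\<eta> B) (Fm A B f))"

definition equivalent_categories :: "('o, 'm) category \<Rightarrow> ('p, 'n) category \<Rightarrow> bool" where
  "equivalent_categories \<C> \<D> \<longleftrightarrow> is_category \<C> \<and> is_category \<D> \<and>
     (\<exists>Fo Fm Go Gm \<eta> \<epsilon>. is_functor \<C> \<D> Fo Fm \<and> is_functor \<D> \<C> Go Gm \<and>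
        is_natural_iso \<C> \<C> (\<lambda>A. A) (\<lambda>A B f. f)
          (\<lambda>A. Go (Fo A)) (\<lambda>A B f. Gm (Fo A) (Fo B) (Fm A B f)) \<eta> \<and>
        is_natural_iso \<D> \<D> (\<lambda>X. Fo (Go X)) (\<lambda>X Y f. Fm (Go X) (Go Y) (Gm X Y f))
          (\<lambda>X. X) (\<lambda>X Y f. f) \<epsilon>)"

definition dually_equivalent :: "('o, 'm) category \<Rightarrow> ('p, 'n) category \<Rightarrow> bool" where
  "dually_equivalent \<C> \<D> \<longleftrightarrow> equivalent_categories \<C> (opposite \<D>)"


section \<open>Size\<close>

text \<open>A type \<open>'u\<close> serves as the ambient universe, and its small subsets serve as the underlying
  sets of spaces and algebras. The universe has to be uncountable and closed under power sets of
  small sets, i.e. \<open>|'u|\<close> is an uncountable strong limit cardinal. Every uncountable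
  Grothendieck universe is of this kind (regularity of the cardinal is not imposed); its small
  sets are, up to bijection, its elements.\<close>

definition small :: "'u set \<Rightarrow> bool" where
  "small A \<longleftrightarrow> A \<prec> (UNIV :: 'u set)"

definition is_universe :: "'u itself \<Rightarrow> bool" where
  "is_universe (_ :: 'u itself) \<longleftrightarrow>
     (UNIV :: nat set) \<prec> (UNIV :: 'u set) \<and>
     (\<forall>A :: 'u set. small A \<longrightarrow> Pow A \<prec> (UNIV :: 'u set))"


section \<open>Compact ordered spaces\<close>

record 'u ordered_space =
  space_top :: "'u topology"
  space_le :: "'u rel"

definition compact_ordered_space :: "'u ordered_space \<Rightarrow> bool" where
  "compact_ordered_space X \<longleftrightarrow>
     compact_space (space_top X) \<and>
     partial_order_on (topspace (space_top X)) (space_le X) \<and>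
     closedin (prod_topology (space_top X) (space_top X)) (space_le X)"

text \<open>A morphism is represented by a function that is undefined outside its domain, so that
  equality of morphisms is equality on the underlying set of the domain. The same convention is
  used for algebras below.\<close>

definition continuous_monotone_maps ::
  "'u ordered_space \<Rightarrow> 'u ordered_space \<Rightarrow> ('u \<Rightarrow> 'u) set" where
  "continuous_monotone_maps X Y =
     {f \<in> extensional (topspace (space_top X)).
        continuous_map (space_top X) (space_top Y) f \<and>
        (\<forall>(x, y) \<in> space_le X. (f x, f y) \<in> space_le Y)}"

definition KH_le :: "('u ordered_space, 'u \<Rightarrow> 'u) category" where
  "KH_le =
     \<lparr>Ob = {X. compact_ordered_space X \<and> small (topspace (space_top X))},
      Hom = continuous_monotone_maps,
      Id = (\<lambda>X. \<lambda>x \<in> topspace (space_top X). x),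
      Comp = (\<lambda>X Y Z g f. compose (topspace (space_top X)) g f)\<rparr>"


section \<open>Varieties of algebras with operations of at most countable arity\<close>

text \<open>An arity is an element of \<open>enat\<close>: the arguments of a symbol of finite arity \<open>n\<close> are indexed
  by \<open>{0, \<dots>, n - 1}\<close>, those of a symbol of arity \<open>\<infinity>\<close> by all natural numbers.\<close>

record 'u signature =
  symbols :: "'u set"
  arity :: "'u \<Rightarrow> enat"

definition positions :: "'u signature \<Rightarrow> 'u \<Rightarrow> nat set" where
  "positions S f = {i. enat i < arity S f}"

text \<open>Each term over symbols of at most countable arity contains at most countably many variables,
  so a countable stock of variables suffices for all equations. In \<open>App f ts\<close>, only the values of
  \<open>ts\<close> at the positions of \<open>f\<close> are relevant.\<close>

datatype 'u trm = Var nat | App 'u "nat \<Rightarrow> 'u trm"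

inductive_set terms :: "'u signature \<Rightarrow> 'u trm set" for S where
  Var: "Var n \<in> terms S"
| App: "f \<in> symbols S \<Longrightarrow> (\<And>i. i \<in> positions S f \<Longrightarrow> ts i \<in> terms S) \<Longrightarrow> App f ts \<in> terms S"

record 'u algebra =
  alg_carrier :: "'u set"
  interp :: "'u \<Rightarrow> (nat \<Rightarrow> 'u) \<Rightarrow> 'u"

definition tuples :: "'u signature \<Rightarrow> 'u algebra \<Rightarrow> 'u \<Rightarrow> (nat \<Rightarrow> 'u) set" where
  "tuples S A f = (positions S f \<rightarrow>\<^sub>E alg_carrier A)"

definition is_algebra :: "'u signature \<Rightarrow> 'u algebra \<Rightarrow> bool" where
  "is_algebra S A \<longleftrightarrow> interp A \<in> (\<Pi>\<^sub>E f \<in> symbols S. tuples S A f \<rightarrow>\<^sub>E alg_carrier A)"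

primrec eval :: "'u signature \<Rightarrow> 'u algebra \<Rightarrow> (nat \<Rightarrow> 'u) \<Rightarrow> 'u trm \<Rightarrow> 'u" where
  "eval S A v (Var n) = v n"
| "eval S A v (App f ts) = interp A f (\<lambda>i \<in> positions S f. eval S A v (ts i))"

definition satisfies :: "'u signature \<Rightarrow> 'u algebra \<Rightarrow> 'u trm \<times> 'u trm \<Rightarrow> bool" where
  "satisfies S A e \<longleftrightarrow> (\<forall>v \<in> UNIV \<rightarrow> alg_carrier A. eval S A v (fst e) = eval S A v (snd e))"

definition homomorphisms ::
  "'u signature \<Rightarrow> 'u algebra \<Rightarrow> 'u algebra \<Rightarrow> ('u \<Rightarrow> 'u) set" where
  "homomorphisms S A B =
     {h \<in> alg_carrier A \<rightarrow>\<^sub>E alg_carrier B. \<forall>f \<in> symbols S. \<forall>x \<in> tuples S A f.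
        h (interp A f x) = interp B f (\<lambda>i \<in> positions S f. h (x i))}"

definition model_category ::
  "'u signature \<Rightarrow> ('u trm \<times> 'u trm) set \<Rightarrow> ('u algebra, 'u \<Rightarrow> 'u) category" where
  "model_category S E =
     \<lparr>Ob = {A. is_algebra S A \<and> small (alg_carrier A) \<and> (\<forall>e \<in> E. satisfies S A e)},
      Hom = homomorphisms S,
      Id = (\<lambda>A. \<lambda>a \<in> alg_carrier A. a),
      Comp = (\<lambda>A B C g f. compose (alg_carrier A) g f)\<rparr>"

definition aleph1_ary_variety :: "('u algebra, 'u \<Rightarrow> 'u) category \<Rightarrow> bool" where
  "aleph1_ary_variety \<V> \<longleftrightarrow>
     (\<exists>S E. small (symbols S) \<and> E \<subseteq> terms S \<times> terms S \<and> \<V> = model_category S E)"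


section \<open>The structures above are categories\<close>

lemma is_category_opposite: "is_category \<C> \<Longrightarrow> is_category (opposite \<C>)"
  unfolding is_category_def opposite_def by simp

lemma is_category_concrete:
  assumes maps: "\<And>A B. H A B \<subseteq> U A \<rightarrow>\<^sub>E U B"
    and ident: "\<And>A. A \<in> O' \<Longrightarrow> (\<lambda>x \<in> U A. x) \<in> H A A"
    and comp: "\<And>A B C f g. A \<in> O' \<Longrightarrow> f \<in> H A B \<Longrightarrow> g \<in> H B C \<Longrightarrow> compose (U A) g f \<in> H A C"
  shows "is_category \<lparr>Ob = O', Hom = H, Id = (\<lambda>A. \<lambda>x \<in> U A. x),
    Comp = (\<lambda>A B C g f. compose (U A) g f)\<rparr>"
proof -
  have mem: "f \<in> U A \<rightarrow> U B" and ext: "f \<in> extensional (U A)" if "f \<in> H A B" for f A B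
    using subsetD[OF maps that] by (auto simp: PiE_def)
  show ?thesis
    unfolding is_category_def category.simps
    by (intro conjI ballI; (rule ident comp compose_Id[OF mem ext] Id_compose[OF mem ext]
          compose_assoc[OF mem]; assumption))
qed

lemma is_category_KH_le: "is_category KH_le"
proof -
  have comp: "compose (topspace (space_top X)) g f \<in> continuous_monotone_maps X Z"
    if "compact_ordered_space X" "f \<in> continuous_monotone_maps X Y"
      "g \<in> continuous_monotone_maps Y Z" for X Y Z :: "'a ordered_space" and f g
  proof -
    have "continuous_map (space_top X) (space_top Z) (g \<circ> f)"
      using that by (auto simp: continuous_monotone_maps_def intro: continuous_map_compose)
    then have "continuous_map (space_top X) (space_top Z) (compose (topspace (space_top X)) g f)"
      by (rule continuous_map_eq) (simp add: compose_def)
    moreover have "(compose (topspace (space_top X)) g f x, compose (topspace (space_top X)) g f y)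
        \<in> space_le Z" if xy: "(x, y) \<in> space_le X" for x y
    proof -
      have "x \<in> topspace (space_top X)" "y \<in> topspace (space_top X)"
        using xy \<open>compact_ordered_space X\<close> by (auto simp: compact_ordered_space_def dest!: partial_order_onD(4))
      then show ?thesis
        using that \<open>f \<in> _\<close> \<open>g \<in> _\<close> by (fastforce simp: continuous_monotone_maps_def compose_def)
    qed
    ultimately show ?thesis
      by (auto simp: continuous_monotone_maps_def)
  qed
  have ident: "(\<lambda>x \<in> topspace (space_top X). x) \<in> continuous_monotone_maps X X"
    if "compact_ordered_space X" for X :: "'a ordered_space"
  proof -
    have "continuous_map (space_top X) (space_top X) (\<lambda>x \<in> topspace (space_top X). x)"
      by (rule continuous_map_eq[OF continuous_map_id]) simp
    then show ?thesis
      using that by (auto simp: continuous_monotone_maps_def compact_ordered_space_def dest!: partial_order_onD(4))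
  qed
  have maps: "f \<in> topspace (space_top X) \<rightarrow>\<^sub>E topspace (space_top Y)"
    if "f \<in> continuous_monotone_maps X Y" for X Y :: "'a ordered_space" and f
    using that by (auto simp: continuous_monotone_maps_def continuous_map_def PiE_def)
  show ?thesis
    unfolding KH_le_def
    by (rule is_category_concrete) (use maps ident comp in auto)
qed

lemma is_category_model_category: "is_category (model_category S E)"
proof -
  have hom: "f \<in> alg_carrier A \<rightarrow>\<^sub>E alg_carrier B" if "f \<in> homomorphisms S A B" for A B f
    using that by (simp add: homomorphisms_def)
  have interp: "interp A f x \<in> alg_carrier A"
    if "is_algebra S A" "f \<in> symbols S" "x \<in> tuples S A f" for A f x
    using that by (auto simp: is_algebra_def dest!: PiE_mem)
  have ident: "(\<lambda>a \<in> alg_carrier A. a) \<in> homomorphisms S A A" if "is_algebra S A" for A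
  proof -
    have "(\<lambda>i \<in> positions S f. (\<lambda>a \<in> alg_carrier A. a) (x i)) = x" if "x \<in> tuples S A f" for f x
      using that by (auto simp: tuples_def fun_eq_iff PiE_iff extensional_def restrict_def)
    then show ?thesis
      using interp[OF that] by (auto simp: homomorphisms_def)
  qed
  have comp: "compose (alg_carrier A) g f \<in> homomorphisms S A C"
    if A: "is_algebra S A" and f: "f \<in> homomorphisms S A B" and g: "g \<in> homomorphisms S B C"
    for A B C f g
  proof -
    have "compose (alg_carrier A) g f (interp A s x) =
        interp C s (\<lambda>i \<in> positions S s. compose (alg_carrier A) g f (x i))"
      if s: "s \<in> symbols S" and x: "x \<in> tuples S A s" for s x
    proof -
      let ?y = "\<lambda>i \<in> positions S s. f (x i)"
      have xi: "x i \<in> alg_carrier A" if "i \<in> positions S s" for i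
        using x that by (auto simp: tuples_def)
      then have "?y \<in> tuples S B s"
        using hom[OF f] by (auto simp: tuples_def)
      then have "g (interp B s ?y) = interp C s (\<lambda>i \<in> positions S s. g (?y i))"
        using g s by (simp add: homomorphisms_def)
      also have "(\<lambda>i \<in> positions S s. g (?y i)) =
          (\<lambda>i \<in> positions S s. compose (alg_carrier A) g f (x i))"
        by (rule restrict_ext) (simp add: xi compose_def)
      finally have "g (interp B s ?y) =
          interp C s (\<lambda>i \<in> positions S s. compose (alg_carrier A) g f (x i))" .
      moreover have "f (interp A s x) = interp B s ?y"
        using f s x by (simp add: homomorphisms_def)
      ultimately show ?thesis
        using interp[OF A s x] by (simp add: compose_eq)
    qed
    then show ?thesis
      using hom[OF f] hom[OF g] by (auto simp: homomorphisms_def compose_def)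
  qed
  show ?thesis
    unfolding model_category_def
    by (rule is_category_concrete) (use hom ident comp in auto)
qed

end

theory Submission
  imports Defs
begin

text \<open>
  The unit interval is both a compact ordered space and an algebra whose operations are the
  continuous monotone maps \<open>[0,1]\<^sup>\<omega> \<rightarrow> [0,1]\<close>; the set of these operations is called the clone
  below. The variety consists of all algebras that satisfy every equation between clone terms that
  is valid in \<open>[0,1]\<close>. A space \<open>X\<close> is sent to the algebra of continuous monotone functions
  \<open>X \<rightarrow> [0,1]\<close> and a map to precomposition with it. This contravariant functor is shown to be
  faithful, full and essentially surjective.

  Faithfulness is Nachbin's theorem that such functions separate \<open>x\<close> from \<open>y\<close> whenever
  \<open>x \<le> y\<close> fails. Fullness holds because every homomorphism from the function algebra to \<open>[0,1]\<close>
  is the evaluation at a point: otherwise compactness produces functions \<open>f \<le> g\<close> which the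
  homomorphism sends to \<open>1\<close> and \<open>0\<close> (lemma \<open>functional_is_evaluation\<close>, based on
  \<open>ordered_pair_from_cover\<close>).

  For essential surjectivity, an algebra \<open>A\<close> of the variety is compared with the functions on the
  space of its homomorphisms to \<open>[0,1]\<close>, a closed subspace of \<open>[0,1]\<^sup>A\<close>. Every continuous monotone function
  there is an evaluation, by an ordered Stone--Weierstrass theorem: the operations of infinite arity
  make the approximation exact. The heart of the matter is that homomorphisms separate the elements
  of \<open>A\<close>, in other words that quotients of subalgebras of powers of \<open>[0,1]\<close> are again
  subalgebras of such powers (\<open>homs_separate\<close>). Since \<open>A\<close> is a quotient of the algebra of functions
  on the cube \<open>[0,1]\<^sup>A\<close>, it is ordered by its meet operation, and this induces a relation on the
  cube: \<open>x\<close> precedes \<open>y\<close> if \<open>f(x) \<le> g(y)\<close> whenever the class of \<open>f\<close> lies below the class of \<open>g\<close>.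
  Points that precede themselves are exactly the homomorphisms. Transitivity of the congruence makes
  the relation interpolative, and a minimality argument in the compact cube then puts a homomorphism
  between any two related points. Hence two elements that no homomorphism tells apart are
  represented by functions \<open>f\<close>, \<open>g\<close> with \<open>f(x) \<le> g(y)\<close> for all related points, and the two-sided
  form of Stone--Weierstrass turns this into an inequality in \<open>A\<close>.

  Points of spaces and elements of algebras both live in the universe \<open>'u\<close>. Functions and
  homomorphisms on small sets are therefore coded by elements of \<open>'u\<close>, which is possible because
  \<open>|'u|\<close> is a strong limit.
\<close>

section \<open>Fully faithful and essentially surjective functors\<close>

text \<open>Choose for each object \<open>Y\<close> of the target an isomorphism \<open>e Y\<close> from some \<open>Fo (G Y)\<close> to \<open>Y\<close>. A
  morphism between objects of the target, conjugated by these isomorphisms, lifts uniquely along the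
  functor, which makes \<open>G\<close> a functor; all remaining equations can be checked after applying the
  faithful functor.\<close>

lemma equivalent_categories_if_fully_faithful:
  fixes \<C> :: "('o, 'm) category" and \<D> :: "('p, 'n) category"
  assumes C: "is_category \<C>" and D: "is_category \<D>" and F: "is_functor \<C> \<D> Fo Fm"
    and full: "\<And>A B g. A \<in> Ob \<C> \<Longrightarrow> B \<in> Ob \<C> \<Longrightarrow> g \<in> Hom \<D> (Fo A) (Fo B) \<Longrightarrow>
      \<exists>f \<in> Hom \<C> A B. Fm A B f = g"
    and faithful: "\<And>A B f f'. A \<in> Ob \<C> \<Longrightarrow> B \<in> Ob \<C> \<Longrightarrow> f \<in> Hom \<C> A B \<Longrightarrow> f' \<in> Hom \<C> A B \<Longrightarrow>
      Fm A B f = Fm A B f' \<Longrightarrow> f = f'"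
    and ess: "\<And>Y. Y \<in> Ob \<D> \<Longrightarrow> \<exists>A \<in> Ob \<C>. \<exists>e. is_iso \<D> (Fo A) Y e"
  shows "equivalent_categories \<C> \<D>"
proof -
  have FO: "Fo A \<in> Ob \<D>" if "A \<in> Ob \<C>" for A
    using F that by (auto simp: is_functor_def)
  have FM: "Fm A B f \<in> Hom \<D> (Fo A) (Fo B)" if "A \<in> Ob \<C>" "B \<in> Ob \<C>" "f \<in> Hom \<C> A B" for A B f
    using F that by (auto simp: is_functor_def)
  have FId: "Fm A A (Id \<C> A) = Id \<D> (Fo A)" if "A \<in> Ob \<C>" for A
    using F that by (auto simp: is_functor_def)
  have FComp: "Fm A B (Comp \<C> A M B g f) = Comp \<D> (Fo A) (Fo M) (Fo B) (Fm M B g) (Fm A M f)"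
    if "A \<in> Ob \<C>" "M \<in> Ob \<C>" "B \<in> Ob \<C>" "f \<in> Hom \<C> A M" "g \<in> Hom \<C> M B" for A M B f g
    using F that by (auto simp: is_functor_def)
  have CI: "Id \<C> A \<in> Hom \<C> A A" if "A \<in> Ob \<C>" for A
    using C that by (auto simp: is_category_def)
  have CC: "Comp \<C> A M B g f \<in> Hom \<C> A B"
    if "A \<in> Ob \<C>" "M \<in> Ob \<C>" "B \<in> Ob \<C>" "f \<in> Hom \<C> A M" "g \<in> Hom \<C> M B" for A M B f g
    using C that unfolding is_category_def by metis
  have DI: "Id \<D> A \<in> Hom \<D> A A" if "A \<in> Ob \<D>" for A
    using D that by (auto simp: is_category_def)
  have DC: "Comp \<D> A M B g f \<in> Hom \<D> A B"
    if "A \<in> Ob \<D>" "M \<in> Ob \<D>" "B \<in> Ob \<D>" "f \<in> Hom \<D> A M" "g \<in> Hom \<D> M B" for A M B f g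
    using D that unfolding is_category_def by metis
  have DU: "Comp \<D> A A B f (Id \<D> A) = f" "Comp \<D> A B B (Id \<D> B) f = f"
    if "A \<in> Ob \<D>" "B \<in> Ob \<D>" "f \<in> Hom \<D> A B" for A B f
    using D that by (auto simp: is_category_def)
  have DA: "Comp \<D> A M' B h (Comp \<D> A M M' g f) = Comp \<D> A M B (Comp \<D> M M' B h g) f"
    if "A \<in> Ob \<D>" "M \<in> Ob \<D>" "M' \<in> Ob \<D>" "B \<in> Ob \<D>"
      "f \<in> Hom \<D> A M" "g \<in> Hom \<D> M M'" "h \<in> Hom \<D> M' B" for A M M' B f g h
    using D that unfolding is_category_def by metis
  have "\<exists>A e d. A \<in> Ob \<C> \<and> e \<in> Hom \<D> (Fo A) Y \<and> d \<in> Hom \<D> Y (Fo A) \<and>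
      Comp \<D> (Fo A) Y (Fo A) d e = Id \<D> (Fo A) \<and> Comp \<D> Y (Fo A) Y e d = Id \<D> Y"
    if "Y \<in> Ob \<D>" for Y
    using ess[OF that] unfolding is_iso_def by blast
  then obtain G e d where G: "\<And>Y. Y \<in> Ob \<D> \<Longrightarrow> G Y \<in> Ob \<C>"
    and e: "\<And>Y. Y \<in> Ob \<D> \<Longrightarrow> e Y \<in> Hom \<D> (Fo (G Y)) Y"
    and d: "\<And>Y. Y \<in> Ob \<D> \<Longrightarrow> d Y \<in> Hom \<D> Y (Fo (G Y))"
    and de: "\<And>Y. Y \<in> Ob \<D> \<Longrightarrow> Comp \<D> (Fo (G Y)) Y (Fo (G Y)) (d Y) (e Y) = Id \<D> (Fo (G Y))"
    and ed: "\<And>Y. Y \<in> Ob \<D> \<Longrightarrow> Comp \<D> Y (Fo (G Y)) Y (e Y) (d Y) = Id \<D> Y"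
    by metis
  define lift where "lift A B g = inv_into (Hom \<C> A B) (Fm A B) g" for A B g
  have lift: "lift A B g \<in> Hom \<C> A B" "Fm A B (lift A B g) = g"
    if "A \<in> Ob \<C>" "B \<in> Ob \<C>" "g \<in> Hom \<D> (Fo A) (Fo B)" for A B g
    using full[OF that] unfolding lift_def by (metis image_eqI inv_into_into, metis image_eqI f_inv_into_f)
  define conjugate where "conjugate Y Z g =
      Comp \<D> (Fo (G Y)) Z (Fo (G Z)) (d Z) (Comp \<D> (Fo (G Y)) Y Z g (e Y))" for Y Z g
  have conjugate: "conjugate Y Z g \<in> Hom \<D> (Fo (G Y)) (Fo (G Z))"
    if "Y \<in> Ob \<D>" "Z \<in> Ob \<D>" "g \<in> Hom \<D> Y Z" for Y Z g
    unfolding conjugate_def by (meson DC FO G e d that)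
  have e_conjugate: "Comp \<D> (Fo (G Y)) (Fo (G Z)) Z (e Z) (conjugate Y Z g) = Comp \<D> (Fo (G Y)) Y Z g (e Y)"
    if "Y \<in> Ob \<D>" "Z \<in> Ob \<D>" "g \<in> Hom \<D> Y Z" for Y Z g
    unfolding conjugate_def using that
    by (simp add: DA[of _ Z "Fo (G Z)" Z] DC DU FO G e d ed)
  have conjugate_d: "Comp \<D> Y (Fo (G Y)) (Fo (G Z)) (conjugate Y Z g) (d Y) = Comp \<D> Y Z (Fo (G Z)) (d Z) g"
    if "Y \<in> Ob \<D>" "Z \<in> Ob \<D>" "g \<in> Hom \<D> Y Z" for Y Z g
    unfolding conjugate_def using that
    by (simp add: DA[symmetric, of _ "Fo (G Y)" Z] DA[symmetric, of _ "Fo (G Y)" Y] DC DU FO G e d ed)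
  have conjugate_comp: "conjugate Y W (Comp \<D> Y Z W h g) =
      Comp \<D> (Fo (G Y)) (Fo (G Z)) (Fo (G W)) (conjugate Z W h) (conjugate Y Z g)"
    if Y: "Y \<in> Ob \<D>" and Z: "Z \<in> Ob \<D>" and W: "W \<in> Ob \<D>" and g: "g \<in> Hom \<D> Y Z" and h: "h \<in> Hom \<D> Z W"
    for Y Z W g h
  proof -
    have "Comp \<D> (Fo (G Y)) (Fo (G Z)) (Fo (G W)) (conjugate Z W h) (conjugate Y Z g) =
        Comp \<D> (Fo (G Y)) W (Fo (G W)) (d W)
          (Comp \<D> (Fo (G Y)) (Fo (G Z)) W (Comp \<D> (Fo (G Z)) Z W h (e Z)) (conjugate Y Z g))"
      unfolding conjugate_def[of Z W]
      by (rule DA[symmetric]) (use that conjugate in \<open>auto intro!: DC FO G e d\<close>)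
    also have "Comp \<D> (Fo (G Y)) (Fo (G Z)) W (Comp \<D> (Fo (G Z)) Z W h (e Z)) (conjugate Y Z g) =
        Comp \<D> (Fo (G Y)) Z W h (Comp \<D> (Fo (G Y)) (Fo (G Z)) Z (e Z) (conjugate Y Z g))"
      by (rule DA[symmetric]) (use that conjugate in \<open>auto intro!: DC FO G e d\<close>)
    also have "\<dots> = Comp \<D> (Fo (G Y)) Y W (Comp \<D> Y Z W h g) (e Y)"
      unfolding e_conjugate[OF Y Z g] by (rule DA) (use that in \<open>auto intro!: FO G e\<close>)
    finally show ?thesis unfolding conjugate_def[of Y W] by simp
  qed
  define Gm where "Gm Y Z g = lift (G Y) (G Z) (conjugate Y Z g)" for Y Z g
  have Gm: "Gm Y Z g \<in> Hom \<C> (G Y) (G Z)" "Fm (G Y) (G Z) (Gm Y Z g) = conjugate Y Z g"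
    if "Y \<in> Ob \<D>" "Z \<in> Ob \<D>" "g \<in> Hom \<D> Y Z" for Y Z g
    using lift[OF G G conjugate] that unfolding Gm_def by auto
  have functor_G: "is_functor \<D> \<C> G Gm"
    unfolding is_functor_def
  proof (intro conjI ballI)
    fix Y assume Y: "Y \<in> Ob \<D>"
    have "conjugate Y Y (Id \<D> Y) = Id \<D> (Fo (G Y))"
      unfolding conjugate_def using Y by (simp add: DU e G FO de)
    then show "Gm Y Y (Id \<D> Y) = Id \<C> (G Y)"
      using Y by (intro faithful[OF G G]) (auto simp: Gm DI CI G FId)
  next
    fix Y Z W g h assume as: "Y \<in> Ob \<D>" "Z \<in> Ob \<D>" "W \<in> Ob \<D>" "g \<in> Hom \<D> Y Z" "h \<in> Hom \<D> Z W"
    then show "Gm Y W (Comp \<D> Y Z W h g) = Comp \<C> (G Y) (G Z) (G W) (Gm Z W h) (Gm Y Z g)"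
      by (intro faithful[of "G Y" "G W"]) (auto simp: Gm G FComp conjugate_comp DC intro!: Gm(1) CC[of "G Y" "G Z"] DC G)
  qed (auto simp: G Gm)
  define u where "u A = lift A (G (Fo A)) (d (Fo A))" for A
  define u' where "u' A = lift (G (Fo A)) A (e (Fo A))" for A
  have u: "u A \<in> Hom \<C> A (G (Fo A))" "Fm A (G (Fo A)) (u A) = d (Fo A)"
    and u': "u' A \<in> Hom \<C> (G (Fo A)) A" "Fm (G (Fo A)) A (u' A) = e (Fo A)"
    if "A \<in> Ob \<C>" for A
    unfolding u_def u'_def using that by (auto simp: lift G FO e d)
  have "is_natural_iso \<C> \<C> (\<lambda>A. A) (\<lambda>A B f. f) (\<lambda>A. G (Fo A)) (\<lambda>A B f. Gm (Fo A) (Fo B) (Fm A B f)) u"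
    unfolding is_natural_iso_def
  proof (intro conjI ballI)
    fix A assume A: "A \<in> Ob \<C>"
    have "Comp \<C> A (G (Fo A)) A (u' A) (u A) = Id \<C> A"
      using A by (intro faithful[OF A A] CC CI) (auto simp: u u' G FO FComp FId ed)
    moreover have "Comp \<C> (G (Fo A)) A (G (Fo A)) (u A) (u' A) = Id \<C> (G (Fo A))"
      using A by (intro faithful[of "G (Fo A)" "G (Fo A)"] CC CI) (auto simp: u u' G FO FComp FId de)
    ultimately show "is_iso \<C> A (G (Fo A)) (u A)"
      unfolding is_iso_def using u u' A by blast
  next
    fix A B f assume as: "A \<in> Ob \<C>" "B \<in> Ob \<C>" "f \<in> Hom \<C> A B"
    show "Comp \<C> A (G (Fo A)) (G (Fo B)) (Gm (Fo A) (Fo B) (Fm A B f)) (u A) =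
        Comp \<C> A B (G (Fo B)) (u B) f"
      using as
      by (intro faithful[of A "G (Fo B)"]) (auto simp: FComp Gm u FO G FM conjugate_d intro!: CC[of A "G (Fo A)"] CC[of A B] Gm(1) u(1))
  qed
  moreover have "is_natural_iso \<D> \<D> (\<lambda>Y. Fo (G Y)) (\<lambda>Y Z f. Fm (G Y) (G Z) (Gm Y Z f)) (\<lambda>Y. Y) (\<lambda>Y Z f. f) e"
    unfolding is_natural_iso_def is_iso_def
  proof (intro conjI ballI)
    show "\<exists>g \<in> Hom \<D> Y (Fo (G Y)). Comp \<D> (Fo (G Y)) Y (Fo (G Y)) g (e Y) = Id \<D> (Fo (G Y)) \<and>
        Comp \<D> Y (Fo (G Y)) Y (e Y) g = Id \<D> Y" if "Y \<in> Ob \<D>" for Y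
      using d de ed that by blast
  qed (auto simp: Gm e_conjugate e)
  ultimately show ?thesis
    unfolding equivalent_categories_def using C D F functor_G by blast
qed

section \<open>Order normality and Nachbin separation\<close>

definition up_closed :: "'a ordered_space \<Rightarrow> 'a set \<Rightarrow> bool" where
  "up_closed X A \<longleftrightarrow> (\<forall>(x, y) \<in> space_le X. x \<in> A \<longrightarrow> y \<in> A)"

definition down_closed :: "'a ordered_space \<Rightarrow> 'a set \<Rightarrow> bool" where
  "down_closed X A \<longleftrightarrow> (\<forall>(x, y) \<in> space_le X. y \<in> A \<longrightarrow> x \<in> A)"

lemma compact_ordered_spaceD:
  assumes "compact_ordered_space X"
  shows "compact_space (space_top X)"
    and "closedin (prod_topology (space_top X) (space_top X)) (space_le X)"
    and "\<And>x. x \<in> topspace (space_top X) \<Longrightarrow> (x, x) \<in> space_le X"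
    and "\<And>x y z. (x, y) \<in> space_le X \<Longrightarrow> (y, z) \<in> space_le X \<Longrightarrow> (x, z) \<in> space_le X"
    and "\<And>x y. (x, y) \<in> space_le X \<Longrightarrow> (y, x) \<in> space_le X \<Longrightarrow> x = y"
    and "\<And>x y. (x, y) \<in> space_le X \<Longrightarrow> x \<in> topspace (space_top X)"
    and "\<And>x y. (x, y) \<in> space_le X \<Longrightarrow> y \<in> topspace (space_top X)"
  using assms closedin_subset[of "prod_topology (space_top X) (space_top X)" "space_le X"]
  unfolding compact_ordered_space_def partial_order_on_def preorder_on_def
  by (auto simp: refl_on_def dest: transD antisymD)

lemma closedin_down_closure:
  assumes X: "compact_ordered_space X" and C: "closedin (space_top X) C"
  shows "closedin (space_top X) {x. \<exists>y \<in> C. (x, y) \<in> space_le X}"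
proof -
  let ?T = "space_top X"
  have "closedin (prod_topology ?T ?T) (space_le X \<inter> topspace ?T \<times> C)"
    using compact_ordered_spaceD(2)[OF X] C by (intro closedin_Int) (auto simp: closedin_prod_Times_iff)
  then have "closedin ?T (fst ` (space_le X \<inter> topspace ?T \<times> C))"
    using closed_map_fst[OF compact_ordered_spaceD(1)[OF X], of ?T] by (simp add: closed_map_def)
  moreover have "fst ` (space_le X \<inter> topspace ?T \<times> C) = {x. \<exists>y \<in> C. (x, y) \<in> space_le X}"
    using compact_ordered_spaceD(6)[OF X] by force
  ultimately show ?thesis by simp
qed

lemma closedin_up_closure:
  assumes X: "compact_ordered_space X" and C: "closedin (space_top X) C"
  shows "closedin (space_top X) {y. \<exists>x \<in> C. (x, y) \<in> space_le X}"
proof -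
  let ?T = "space_top X"
  have "closedin (prod_topology ?T ?T) (space_le X \<inter> C \<times> topspace ?T)"
    using compact_ordered_spaceD(2)[OF X] C by (intro closedin_Int) (auto simp: closedin_prod_Times_iff)
  then have "closedin ?T (snd ` (space_le X \<inter> C \<times> topspace ?T))"
    using closed_map_snd[OF compact_ordered_spaceD(1)[OF X], of ?T] by (simp add: closed_map_def)
  moreover have "snd ` (space_le X \<inter> C \<times> topspace ?T) = {y. \<exists>x \<in> C. (x, y) \<in> space_le X}"
    using compact_ordered_spaceD(7)[OF X] by force
  ultimately show ?thesis by simp
qed

text \<open>No point of \<open>A\<close> lies below a point of \<open>B\<close>, so the compact rectangle \<open>A \<times> B\<close> misses the closed
  order and has an open rectangle around it that misses the order too. The sides of that rectangle
  need not be closed upwards or downwards; their largest up-closed and down-closed parts are, and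
  these parts are open because the down- and up-closures of closed sets are closed.\<close>

lemma order_normality:
  assumes X: "compact_ordered_space X"
    and A: "closedin (space_top X) A" "up_closed X A"
    and B: "closedin (space_top X) B" "down_closed X B"
    and disj: "A \<inter> B = {}"
  obtains U V where "openin (space_top X) U" "up_closed X U" "A \<subseteq> U"
    and "openin (space_top X) V" "down_closed X V" "B \<subseteq> V" and "U \<inter> V = {}"
proof -
  let ?T = "space_top X"
  note D = compact_ordered_spaceD[OF X]
  have AT: "A \<subseteq> topspace ?T" and BT: "B \<subseteq> topspace ?T"
    using A B by (auto dest: closedin_subset)
  have "openin (prod_topology ?T ?T) (topspace ?T \<times> topspace ?T - space_le X)"
    using D(2) by (simp add: closedin_def)
  moreover have "A \<times> B \<subseteq> topspace ?T \<times> topspace ?T - space_le X"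
    using A(2) disj AT BT by (auto simp: up_closed_def)
  ultimately obtain U V where U: "openin ?T U" "A \<subseteq> U" and V: "openin ?T V" "B \<subseteq> V"
    and UV: "U \<times> V \<subseteq> topspace ?T \<times> topspace ?T - space_le X"
    using Wallace_theorem_prod_topology[OF closedin_compact_space[OF D(1) A(1)] closedin_compact_space[OF D(1) B(1)]]
    by metis
  (* The points all of whose upper bounds lie in U, and dually for V. *)
  let ?U = "topspace ?T - {x. \<exists>y \<in> topspace ?T - U. (x, y) \<in> space_le X}"
  let ?V = "topspace ?T - {y. \<exists>x \<in> topspace ?T - V. (x, y) \<in> space_le X}"
  show thesis
  proof
    show "openin ?T ?U"
      by (intro openin_diff openin_topspace closedin_down_closure[OF X]) (use U in auto)
    show "openin ?T ?V"
      by (intro openin_diff openin_topspace closedin_up_closure[OF X]) (use V in auto)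
    show "up_closed X ?U" "down_closed X ?V"
      unfolding up_closed_def down_closed_def using D by blast+
    show "A \<subseteq> ?U" "B \<subseteq> ?V"
      using AT BT A(2) B(2) U(2) V(2) unfolding up_closed_def down_closed_def by blast+
    show "?U \<inter> ?V = {}"
      using UV D(3) by blast
  qed
qed

lemma dyadics_dense:
  fixes a b :: real
  assumes "0 \<le> a" "a < b" "b \<le> 1"
  obtains r where "r \<in> dyadics \<inter> {0..1}" "a < r" "r < b"
proof -
  obtain n where n: "(1/2::real) ^ n < b - a"
    using real_arch_pow_inv[of "b - a" "1/2"] assms by auto
  let ?m = "nat (\<lfloor>a * 2 ^ n\<rfloor> + 1)"
  have m: "real ?m = real_of_int \<lfloor>a * 2 ^ n\<rfloor> + 1"
    using assms by simp
  have "a * 2 ^ n < real ?m" "real ?m \<le> a * 2 ^ n + 1"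
    unfolding m by linarith+
  then have "a < real ?m / 2 ^ n" "real ?m / 2 ^ n \<le> a + (1/2) ^ n"
    by (auto simp: field_simps power_divide)
  moreover define q where "q = real ?m / 2 ^ n"
  ultimately have "a < q" "q \<le> a + (1/2) ^ n"
    by simp_all
  moreover have "q \<in> dyadics"
    unfolding dyadics_def q_def by auto
  ultimately show thesis
    using assms n by (intro that[of q]) auto
qed

lemma closedin_principal:
  assumes X: "compact_ordered_space X" and z: "z \<in> topspace (space_top X)"
  shows "closedin (space_top X) {u. (u, z) \<in> space_le X}"
    and "closedin (space_top X) {u. (z, u) \<in> space_le X}"
proof -
  let ?T = "space_top X"
  note D = compact_ordered_spaceD[OF X]
  have "closedin ?T {u \<in> topspace ?T. (u, z) \<in> space_le X}"
    by (rule closedin_continuous_map_preimage[OF _ D(2)]) (use z in \<open>auto intro!: continuous_intros\<close>)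
  then show "closedin ?T {u. (u, z) \<in> space_le X}"
    using D(6) by (metis (mono_tags, lifting) Collect_cong)
  have "closedin ?T {u \<in> topspace ?T. (z, u) \<in> space_le X}"
    by (rule closedin_continuous_map_preimage[OF _ D(2)]) (use z in \<open>auto intro!: continuous_intros\<close>)
  then show "closedin ?T {u. (z, u) \<in> space_le X}"
    using D(7) by (metis (mono_tags, lifting) Collect_cong)
qed

text \<open>This is the construction of Urysohn's lemma carried out with open down-closed sets \<open>G r\<close>, indexed
  by dyadic numbers, where order normality supplies the interpolating sets. The function
  \<open>z \<mapsto> inf {r. z \<in> G r}\<close> is monotone because the sets are down-closed.\<close>

theorem Nachbin_separation:
  assumes X: "compact_ordered_space X"
    and xy: "x \<in> topspace (space_top X)" "y \<in> topspace (space_top X)" "(x, y) \<notin> space_le X"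
  obtains f :: "'a \<Rightarrow> real"
  where "continuous_map (space_top X) euclideanreal f" "\<And>z. f z \<in> {0..1}"
    "\<And>u v. (u, v) \<in> space_le X \<Longrightarrow> f u \<le> f v" "f y < f x"
proof -
  let ?T = "space_top X"
  note D = compact_ordered_spaceD[OF X]
  (* The closed set between U and V replaces the condition on the closure of U in the classical
     proof: the closure of a down-closed set need not be down-closed. *)
  define R where "R U V \<longleftrightarrow> openin ?T U \<and> down_closed X U \<and> openin ?T V \<and> down_closed X V \<and>
      (\<exists>C. closedin ?T C \<and> down_closed X C \<and> U \<subseteq> C \<and> C \<subseteq> V)" for U V
  have complement: "up_closed X (topspace ?T - U)" if "down_closed X U" for U
    using that D(7) by (auto simp: up_closed_def down_closed_def)
  have complement': "down_closed X (topspace ?T - U)" if "up_closed X U" for U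
    using that D(6) by (auto simp: up_closed_def down_closed_def)
  have between: "\<exists>W. R U W \<and> R W V" if "R U V" for U V
  proof -
    obtain C where C: "closedin ?T C" "down_closed X C" "U \<subseteq> C" "C \<subseteq> V"
      and U: "openin ?T U" "down_closed X U" and V: "openin ?T V" "down_closed X V"
      using \<open>R U V\<close> unfolding R_def by auto
    obtain W' W where W': "openin ?T W'" "up_closed X W'" "topspace ?T - V \<subseteq> W'"
      and W: "openin ?T W" "down_closed X W" "C \<subseteq> W" and disj: "W' \<inter> W = {}"
      by (rule order_normality[OF X _ complement[OF V(2)] C(1,2)]) (use V C in auto)
    have "R U W"
      unfolding R_def using U W C by blast
    moreover have "R W V"
      unfolding R_def using V W W' disj complement'[OF W'(2)] openin_subset[OF W(1)]
      by (intro conjI exI[of _ "topspace ?T - W'"]) auto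
    ultimately show ?thesis by blast
  qed
  let ?B = "{u. (u, y) \<in> space_le X}" and ?A = "{u. (x, u) \<in> space_le X}"
  obtain V U where V: "openin ?T V" "up_closed X V" "?A \<subseteq> V"
    and U: "openin ?T U" "down_closed X U" "?B \<subseteq> U" and disj: "V \<inter> U = {}"
  proof (rule order_normality[OF X])
    show "closedin ?T ?A" "closedin ?T ?B"
      using closedin_principal[OF X] xy by auto
    show "up_closed X ?A" "down_closed X ?B" "?A \<inter> ?B = {}"
      using D(4) xy by (auto simp: up_closed_def down_closed_def)
  qed
  have "R U (topspace ?T - ?A)"
    unfolding R_def
  proof (intro conjI exI)
    show "closedin ?T (topspace ?T - V)" "openin ?T (topspace ?T - ?A)"
      using V(1) closedin_principal[OF X] xy by auto
    show "down_closed X (topspace ?T - V)" by (rule complement'[OF V(2)])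
    show "down_closed X (topspace ?T - ?A)"
      using D(4) D(6) by (auto simp: down_closed_def)
    show "U \<subseteq> topspace ?T - V" using disj openin_subset[OF U(1)] by auto
    show "topspace ?T - V \<subseteq> topspace ?T - ?A" using V(3) by auto
  qed (use U in auto)
  moreover have "R U W" if "R U V" "R V W" for U V W
    using that unfolding R_def by (meson order_trans)
  ultimately have "\<exists>G :: real \<Rightarrow> 'a set. G 0 = U \<and> G 1 = topspace ?T - ?A \<and>
      (\<forall>r \<in> dyadics \<inter> {0..1}. \<forall>s \<in> dyadics \<inter> {0..1}. r < s \<longrightarrow> R (G r) (G s))"
    by (intro recursion_on_dyadic_fractions between)
  then obtain G :: "real \<Rightarrow> 'a set" where G0: "G 0 = U" and G1: "G 1 = topspace ?T - ?A"
    and G: "\<And>r s. r \<in> dyadics \<inter> {0..1} \<Longrightarrow> s \<in> dyadics \<inter> {0..1} \<Longrightarrow> r < s \<Longrightarrow> R (G r) (G s)"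
    by blast
  let ?D = "dyadics \<inter> {0..1::real}"
  have 01: "0 \<in> ?D" "1 \<in> ?D"
    using real_in_dyadics[of 0] real_in_dyadics[of 1] by auto
  have RG: "openin ?T (G r)" "down_closed X (G r)" if "r \<in> ?D" for r
  proof -
    have "R (G 0) (G r) \<or> R (G r) (G 1)"
      using G[OF 01(1) that] G[OF that 01(2)] that by force
    then show "openin ?T (G r)" "down_closed X (G r)" by (auto simp: R_def)
  qed
  define f where "f z = Inf (insert 1 {r \<in> ?D. z \<in> G r})" for z
  have bdd: "bdd_below (insert 1 {r \<in> ?D. z \<in> G r})" for z
    by (auto intro!: bdd_belowI[of _ 0])
  have f_le: "f z \<le> r" if "r \<in> ?D" "z \<in> G r" for r z
    unfolding f_def using that by (intro cInf_lower[OF _ bdd]) auto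
  have f_le1: "f z \<le> 1" for z
    unfolding f_def by (intro cInf_lower[OF _ bdd]) auto
  have f_ge: "b \<le> f z" if "b \<le> 1" "\<And>r. r \<in> ?D \<Longrightarrow> z \<in> G r \<Longrightarrow> b \<le> r" for b z
    unfolding f_def using that by (intro cInf_greatest) auto
  have f_less: "\<exists>r \<in> ?D. z \<in> G r \<and> r < b" if "f z < b" "b \<le> 1" for z b
    using f_ge[of b z] that by fastforce
  show thesis
  proof
    show "f z \<in> {0..1}" for z
      using f_le1[of z] f_ge[of 0 z] by auto
    show "f u \<le> f v" if "(u, v) \<in> space_le X" for u v
      using that RG(2) by (intro f_ge f_le1 f_le) (auto simp: down_closed_def)
    have "f y \<le> 0"
      by (rule f_le) (use 01 U(3) G0 D(3) xy in auto)
    moreover have "1 \<le> f x"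
    proof (rule f_ge)
      fix r assume r: "r \<in> ?D" "x \<in> G r"
      show "1 \<le> r"
      proof (rule ccontr)
        assume "\<not> 1 \<le> r"
        then have "R (G r) (G 1)" using G[OF r(1) 01(2)] by simp
        then have "x \<in> G 1" using r unfolding R_def by blast
        then show False using G1 D(3) xy by auto
      qed
    qed simp
    ultimately show "f y < f x" by simp
    have "openin ?T {z \<in> topspace ?T. f z < b}" for b
    proof (cases "b \<le> 1")
      case True
      have "{z \<in> topspace ?T. f z < b} = (\<Union>r \<in> {r \<in> ?D. r < b}. G r)"
        using f_less[OF _ True] f_le RG(1) by (fastforce dest: openin_subset)
      then show ?thesis using RG(1) by auto
    next
      case False
      then have "f z < b" for z
        using f_le1[of z] by linarith
      then have "{z \<in> topspace ?T. f z < b} = topspace ?T" by auto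
      then show ?thesis by simp
    qed
    moreover have "openin ?T {z \<in> topspace ?T. a < f z}" for a
    proof (subst openin_subopen, intro ballI)
      fix z assume "z \<in> {z \<in> topspace ?T. a < f z}"
      then have z: "z \<in> topspace ?T" "a < f z" by auto
      show "\<exists>W. openin ?T W \<and> z \<in> W \<and> W \<subseteq> {z \<in> topspace ?T. a < f z}"
      proof (cases "0 \<le> a")
        case False
        then show ?thesis using z f_ge[of 0]
          by (intro exI[of _ "topspace ?T"]) (auto simp: not_le intro: less_le_trans)
      next
        case True
        (* A closed set between G r and G s contains no point near z, and outside of it f is at least r. *)
        obtain s where s: "s \<in> ?D" "a < s" "s < f z"
          by (rule dyadics_dense[of a "f z"]) (use True z f_le1 in auto)
        obtain r where r: "r \<in> ?D" "a < r" "r < s"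
          by (rule dyadics_dense[of a s]) (use True s in auto)
        obtain C where C: "closedin ?T C" "G r \<subseteq> C" "C \<subseteq> G s"
          using G[OF r(1) s(1) r(3)] unfolding R_def by blast
        have "z \<notin> C" using C(3) f_le[OF s(1), of z] s(3) by auto
        moreover have "a < f w" if "w \<notin> C" for w
        proof -
          have "r \<le> f w"
          proof (rule f_ge)
            fix q assume q: "q \<in> ?D" "w \<in> G q"
            then have "\<not> q < r"
              using G[OF q(1) r(1)] C(2) that unfolding R_def by blast
            then show "r \<le> q" by simp
          qed (use r in auto)
          then show ?thesis using r by simp
        qed
        ultimately show ?thesis
          using C z by (intro exI[of _ "topspace ?T - C"]) auto
      qed
    qed
    ultimately show "continuous_map ?T euclideanreal f"
      by (simp add: continuous_map_upper_lower_semicontinuous_lt)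
  qed
qed

section \<open>Monotone continuous operations on the unit interval\<close>

text \<open>The compactness argument behind both the evaluation theorem and the interpolation property.
  Finitely many of the given neighbourhoods cover the space; the minimum of the corresponding
  members of \<open>L\<close> and the maximum of those of \<open>U\<close> are comparable, as at each point the former is at
  most \<open>0\<close> or the latter is at least \<open>1\<close>.\<close>

lemma ordered_pair_from_cover:
  fixes L U :: "('a \<Rightarrow> real) set"
  assumes T: "compact_space T"
    and L: "L \<noteq> {}" "\<And>f z. f \<in> L \<Longrightarrow> z \<in> topspace T \<Longrightarrow> f z \<le> 1"
      "\<And>f g. f \<in> L \<Longrightarrow> g \<in> L \<Longrightarrow> \<exists>h \<in> L. \<forall>z \<in> topspace T. h z \<le> min (f z) (g z)"
    and U: "U \<noteq> {}" "\<And>f z. f \<in> U \<Longrightarrow> z \<in> topspace T \<Longrightarrow> 0 \<le> f z"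
      "\<And>f g. f \<in> U \<Longrightarrow> g \<in> U \<Longrightarrow> \<exists>h \<in> U. \<forall>z \<in> topspace T. max (f z) (g z) \<le> h z"
    and cover: "\<And>z. z \<in> topspace T \<Longrightarrow>
      \<exists>W. openin T W \<and> z \<in> W \<and> ((\<exists>f \<in> L. \<forall>w \<in> W. f w \<le> 0) \<or> (\<exists>g \<in> U. \<forall>w \<in> W. 1 \<le> g w))"
  obtains f g where "f \<in> L" "g \<in> U" "\<And>z. z \<in> topspace T \<Longrightarrow> f z \<le> g z"
proof -
  define \<W> where "\<W> = {W. openin T W \<and> ((\<exists>f \<in> L. \<forall>w \<in> W. f w \<le> 0) \<or> (\<exists>g \<in> U. \<forall>w \<in> W. 1 \<le> g w))}"
  have "\<exists>\<F>. finite \<F> \<and> \<F> \<subseteq> \<W> \<and> topspace T \<subseteq> \<Union>\<F>"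
  proof (rule compactinD)
    show "compactin T (topspace T)" using T by (simp add: compact_space_def)
    show "topspace T \<subseteq> \<Union>\<W>"
    proof
      fix z assume "z \<in> topspace T"
      from cover[OF this] obtain W where "W \<in> \<W>" "z \<in> W"
        unfolding \<W>_def mem_Collect_eq by (elim exE conjE) blast
      then show "z \<in> \<Union>\<W>" by blast
    qed
  qed (simp add: \<W>_def)
  then obtain \<F> where \<F>: "finite \<F>" "\<F> \<subseteq> \<W>" "topspace T \<subseteq> \<Union>\<F>" by blast
  from \<F>(1,2) have "\<exists>f \<in> L. \<exists>g \<in> U. \<forall>z \<in> topspace T \<inter> \<Union>\<F>. f z \<le> 0 \<or> 1 \<le> g z"
  proof (induction rule: finite_induct)
    case empty
    then show ?case using L(1) U(1) by auto
  next
    case (insert W \<F>)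
    then obtain f g where fg: "f \<in> L" "g \<in> U" "\<forall>z \<in> topspace T \<inter> \<Union>\<F>. f z \<le> 0 \<or> 1 \<le> g z"
      by auto
    from insert.prems have "(\<exists>f \<in> L. \<forall>w \<in> W. f w \<le> 0) \<or> (\<exists>g \<in> U. \<forall>w \<in> W. 1 \<le> g w)"
      by (auto simp: \<W>_def)
    then show ?case
    proof
      assume "\<exists>f \<in> L. \<forall>w \<in> W. f w \<le> 0"
      then obtain f' where f': "f' \<in> L" "\<forall>w \<in> W. f' w \<le> 0" by blast
      obtain h where h: "h \<in> L" "\<forall>z \<in> topspace T. h z \<le> min (f z) (f' z)"
        using L(3)[OF fg(1) f'(1)] by blast
      have "h z \<le> 0 \<or> 1 \<le> g z" if "z \<in> topspace T \<inter> \<Union> (insert W \<F>)" for z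
      proof -
        have "f' z \<le> 0 \<or> f z \<le> 0 \<or> 1 \<le> g z" using that fg(3) f'(2) by blast
        moreover have "h z \<le> min (f z) (f' z)" using that h(2) by blast
        ultimately show ?thesis by linarith
      qed
      then show ?thesis using h(1) fg(2) by blast
    next
      assume "\<exists>g \<in> U. \<forall>w \<in> W. 1 \<le> g w"
      then obtain g' where g': "g' \<in> U" "\<forall>w \<in> W. 1 \<le> g' w" by blast
      obtain h where h: "h \<in> U" "\<forall>z \<in> topspace T. max (g z) (g' z) \<le> h z"
        using U(3)[OF fg(2) g'(1)] by blast
      have "f z \<le> 0 \<or> 1 \<le> h z" if "z \<in> topspace T \<inter> \<Union> (insert W \<F>)" for z
      proof -
        have "1 \<le> g' z \<or> f z \<le> 0 \<or> 1 \<le> g z" using that fg(3) g'(2) by blast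
        moreover have "max (g z) (g' z) \<le> h z" using that h(2) by blast
        ultimately show ?thesis by linarith
      qed
      then show ?thesis using h(1) fg(1) by blast
    qed
  qed
  then obtain f g where fg: "f \<in> L" "g \<in> U" "\<forall>z \<in> topspace T \<inter> \<Union>\<F>. f z \<le> 0 \<or> 1 \<le> g z" by blast
  have "f z \<le> g z" if "z \<in> topspace T" for z
  proof -
    have "f z \<le> 0 \<or> 1 \<le> g z" using fg(3) \<F>(3) that by blast
    then show ?thesis using L(2)[OF fg(1) that] U(2)[OF fg(2) that] by linarith
  qed
  then show thesis using that fg by blast
qed

definition unit_clamp :: "real \<Rightarrow> real" where
  "unit_clamp t = max 0 (min 1 t)"

lemma unit_clamp_mem [simp]: "unit_clamp t \<in> {0..1}" "0 \<le> unit_clamp t" "unit_clamp t \<le> 1"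
  by (auto simp: unit_clamp_def)

lemma unit_clamp_eq [simp]: "t \<in> {0..1} \<Longrightarrow> unit_clamp t = t"
  by (auto simp: unit_clamp_def)

lemma mono_unit_clamp: "s \<le> t \<Longrightarrow> unit_clamp s \<le> unit_clamp t"
  by (auto simp: unit_clamp_def)

lemma continuous_on_unit_clamp [continuous_intros]:
  "continuous_on S f \<Longrightarrow> continuous_on S (\<lambda>x. unit_clamp (f x))"
  unfolding unit_clamp_def by (intro continuous_intros)

definition ramp :: "real \<Rightarrow> real \<Rightarrow> real \<Rightarrow> real" where
  "ramp a b t = unit_clamp ((t - a) / (b - a))"

lemma ramp_mem [simp]: "ramp a b t \<in> {0..1}" "0 \<le> ramp a b t" "ramp a b t \<le> 1"
  by (auto simp: ramp_def)

lemma ramp_eq_0: "a < b \<Longrightarrow> t \<le> a \<Longrightarrow> ramp a b t = 0"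
  by (auto simp: ramp_def unit_clamp_def max_def min_def field_simps)

lemma ramp_eq_1: "a < b \<Longrightarrow> b \<le> t \<Longrightarrow> ramp a b t = 1"
  by (auto simp: ramp_def unit_clamp_def max_def min_def field_simps)

lemma mono_ramp: "a < b \<Longrightarrow> s \<le> t \<Longrightarrow> ramp a b s \<le> ramp a b t"
  unfolding ramp_def by (intro mono_unit_clamp divide_right_mono) auto

lemma continuous_on_ramp [continuous_intros]:
  "continuous_on S f \<Longrightarrow> continuous_on S (\<lambda>x. ramp a b (f x))"
  unfolding ramp_def by (cases "a = b") (auto intro!: continuous_intros)

text \<open>Operations are defined on all of \<open>\<real>\<^sup>\<omega>\<close>. Only their values on the cube \<open>[0,1]\<^sup>\<omega>\<close> matter, but total
  operations compose without side conditions. Every continuous monotone map on the cube extends to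
  such an operation, by clamping the arguments.\<close>

definition clone :: "((nat \<Rightarrow> real) \<Rightarrow> real) set" where
  "clone = {g. continuous_on UNIV g \<and> mono g \<and> range g \<subseteq> {0..1}}"

lemma clone_range: "g \<in> clone \<Longrightarrow> g v \<in> {0..1}"
  unfolding clone_def by (auto dest: range_subsetD)

lemma clone_mono: "g \<in> clone \<Longrightarrow> (\<And>i. v i \<le> w i) \<Longrightarrow> g v \<le> g w"
  unfolding clone_def by (auto simp: le_fun_def elim: monoD)

lemma clone_continuous: "g \<in> clone \<Longrightarrow> continuous_on UNIV g"
  unfolding clone_def by auto

lemma cloneI:
  assumes "continuous_on UNIV g" "\<And>v w. (\<And>i. v i \<le> w i) \<Longrightarrow> g v \<le> g w" "\<And>v. g v \<in> {0..1}"
  shows "g \<in> clone"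
  using assms unfolding clone_def mono_def le_fun_def by blast

lemma continuous_on_coordinate [continuous_intros]:
  "continuous_on S (\<lambda>v :: 'a \<Rightarrow> 'b :: topological_space. v i)"
  by (rule continuous_on_subset[OF continuous_on_product_coordinates]) simp

lemma clone_const: "c \<in> {0..1} \<Longrightarrow> (\<lambda>v. c) \<in> clone"
  by (rule cloneI) auto

lemma clone_proj: "(\<lambda>v. unit_clamp (v n)) \<in> clone"
  by (rule cloneI) (auto intro!: continuous_intros mono_unit_clamp)

lemma clone_ramp: "a < b \<Longrightarrow> (\<lambda>v. ramp a b (v n)) \<in> clone"
  by (rule cloneI) (auto intro!: continuous_intros mono_ramp)

lemma clone_min: "(\<lambda>v. unit_clamp (min (v m) (v n))) \<in> clone"
  by (rule cloneI) (auto intro!: continuous_intros mono_unit_clamp min.mono)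

lemma clone_max: "(\<lambda>v. unit_clamp (max (v m) (v n))) \<in> clone"
  by (rule cloneI) (auto intro!: continuous_intros mono_unit_clamp max.mono)

lemma clone_comp:
  assumes g: "g \<in> clone" and h: "\<And>i. h i \<in> clone"
  shows "(\<lambda>v. g (\<lambda>i. h i (\<lambda>j. v (\<sigma> i j)))) \<in> clone"
proof (rule cloneI)
  have "continuous_on UNIV (\<lambda>v. h i (\<lambda>j. v (\<sigma> i j)))" for i
    by (rule continuous_on_compose2[OF clone_continuous[OF h]])
      (auto intro!: continuous_on_coordinatewise_then_product continuous_on_coordinate)
  then show "continuous_on UNIV (\<lambda>v. g (\<lambda>i. h i (\<lambda>j. v (\<sigma> i j))))"
    by (intro continuous_on_compose2[OF clone_continuous[OF g]])
      (auto intro!: continuous_on_coordinatewise_then_product)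
qed (simp_all add: clone_range[OF g] clone_mono[OF g] clone_mono[OF h] del: atLeastAtMost_iff)

lemma continuous_map_clone:
  assumes "g \<in> clone" "\<And>i. continuous_map T euclideanreal (f i)"
  shows "continuous_map T euclideanreal (\<lambda>x. g (\<lambda>i. f i x))"
proof -
  have "continuous_map T (euclidean :: (nat \<Rightarrow> real) topology) (\<lambda>x i. f i x)"
    using assms(2) by (simp add: continuous_map_componentwise_UNIV flip: euclidean_product_topology)
  moreover have "continuous_map (euclidean :: (nat \<Rightarrow> real) topology) euclideanreal g"
    using clone_continuous[OF assms(1)] by simp
  ultimately show ?thesis
    using continuous_map_compose[of T euclidean "\<lambda>x i. f i x" euclideanreal g] by (simp add: o_def)
qed

text \<open>The pairs \<open>(x, y)\<close> with \<open>f x - g y \<ge> \<epsilon>\<close> form a compact set, which is covered by the open sets on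
  which a given member of \<open>P\<close> leaves a given gap \<open>(a, b)\<close>.\<close>

lemma finite_separating_family:
  fixes f g :: "'a \<Rightarrow> real" and P :: "(('a \<Rightarrow> real) \<times> ('a \<Rightarrow> real)) set"
  assumes T: "compact_space T"
    and f: "continuous_map T euclideanreal f" and g: "continuous_map T euclideanreal g"
    and P: "\<And>p. p \<in> P \<Longrightarrow> continuous_map T euclideanreal (fst p)"
      "\<And>p. p \<in> P \<Longrightarrow> continuous_map T euclideanreal (snd p)"
    and sep: "\<And>x y. x \<in> topspace T \<Longrightarrow> y \<in> topspace T \<Longrightarrow> g y < f x \<Longrightarrow> \<exists>p \<in> P. snd p y < fst p x"
    and \<epsilon>: "0 < \<epsilon>"
  obtains J where "finite J" "J \<subseteq> P \<times> {(a, b). a < b}"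
    "\<And>x y. x \<in> topspace T \<Longrightarrow> y \<in> topspace T \<Longrightarrow> \<epsilon> \<le> f x - g y \<Longrightarrow>
      \<exists>(p, a, b) \<in> J. snd p y < a \<and> b < fst p x"
proof -
  let ?TT = "prod_topology T T"
  let ?O = "\<lambda>(p :: ('a \<Rightarrow> real) \<times> ('a \<Rightarrow> real), a, b). {z \<in> topspace ?TT. b < fst p (fst z) \<and> snd p (snd z) < a}"
  have c1: "continuous_map ?TT euclideanreal (\<lambda>z. h (fst z))"
    and c2: "continuous_map ?TT euclideanreal (\<lambda>z. h (snd z))"
    if "continuous_map T euclideanreal h" for h
    using continuous_map_compose[OF continuous_map_fst that] continuous_map_compose[OF continuous_map_snd that]
    by (auto simp: o_def)
  let ?C = "{z \<in> topspace ?TT. f (fst z) - g (snd z) \<in> {\<epsilon>..}}"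
  have "closedin ?TT ?C"
    by (rule closedin_continuous_map_preimage[where Y = euclideanreal])
      (auto intro!: continuous_map_diff c1 c2 f g)
  then have "compactin ?TT ?C"
    using T by (intro closedin_compact_space) (auto simp: compact_space_prod_topology)
  then have "\<exists>\<F>. finite \<F> \<and> \<F> \<subseteq> ?O ` (P \<times> {(a, b). a < b}) \<and> ?C \<subseteq> \<Union>\<F>"
  proof (rule compactinD)
    fix W assume "W \<in> ?O ` (P \<times> {(a, b). a < b})"
    then obtain p a b where p: "p \<in> P" and W: "W = ?O (p, a, b)" by auto
    have "openin ?TT {z \<in> topspace ?TT. fst p (fst z) \<in> {b<..}}"
      by (rule openin_continuous_map_preimage[OF c1[OF P(1)[OF p]]]) simp
    moreover have "openin ?TT {z \<in> topspace ?TT. snd p (snd z) \<in> {..<a}}"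
      by (rule openin_continuous_map_preimage[OF c2[OF P(2)[OF p]]]) simp
    ultimately have "openin ?TT ({z \<in> topspace ?TT. fst p (fst z) \<in> {b<..}} \<inter> {z \<in> topspace ?TT. snd p (snd z) \<in> {..<a}})"
      by (rule openin_Int)
    then show "openin ?TT W" unfolding W by (rule back_subst[of "openin ?TT"]) auto
  next
    show "?C \<subseteq> \<Union> (?O ` (P \<times> {(a, b). a < b}))"
    proof
      fix z assume z: "z \<in> ?C"
      then have "fst z \<in> topspace T" "snd z \<in> topspace T" "g (snd z) < f (fst z)" using \<epsilon> by auto
      then obtain p where p: "p \<in> P" "snd p (snd z) < fst p (fst z)" using sep by blast
      obtain a where a: "snd p (snd z) < a" "a < fst p (fst z)" using dense[OF p(2)] by blast
      obtain b where b: "a < b" "b < fst p (fst z)" using dense[OF a(2)] by blast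
      show "z \<in> \<Union> (?O ` (P \<times> {(a, b). a < b}))"
        using z p a b by (intro UnionI[OF imageI[of "(p, a, b)"]]) auto
    qed
  qed
  then obtain \<F> where \<F>: "finite \<F>" "\<F> \<subseteq> ?O ` (P \<times> {(a, b). a < b})" "?C \<subseteq> \<Union>\<F>" by blast
  obtain J where J: "J \<subseteq> P \<times> {(a, b). a < b}" "finite J" "\<F> = ?O ` J"
    using finite_subset_image[OF \<F>(1,2)] by blast
  show thesis
  proof (rule that[OF J(2,1)])
    fix x y assume "x \<in> topspace T" "y \<in> topspace T" "\<epsilon> \<le> f x - g y"
    then have "(x, y) \<in> ?C" by auto
    then have "(x, y) \<in> \<Union> (?O ` J)" using \<F>(3) J(3) by blast
    then show "\<exists>(p, a, b) \<in> J. snd p y < a \<and> b < fst p x" by fastforce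
  qed
qed

text \<open>The finite families for the thresholds \<open>2\<^sup>-\<^sup>n\<close> are concatenated. A member of the \<open>n\<close>-th family
  carries the weight \<open>2 \<cdot> 2\<^sup>-\<^sup>n\<close>, which exceeds \<open>f x - g y\<close> when \<open>n\<close> is the first threshold below this
  difference. The weights tend to \<open>0\<close>, and this makes the operation built from them continuous.\<close>

lemma countable_separating_sequence:
  fixes f g :: "'a \<Rightarrow> real" and P :: "(('a \<Rightarrow> real) \<times> ('a \<Rightarrow> real)) set"
  assumes T: "compact_space T"
    and f: "continuous_map T euclideanreal f" "\<And>x. x \<in> topspace T \<Longrightarrow> f x \<in> {0..1}"
    and g: "continuous_map T euclideanreal g" "\<And>x. x \<in> topspace T \<Longrightarrow> g x \<in> {0..1}"
    and P: "\<And>p. p \<in> P \<Longrightarrow> continuous_map T euclideanreal (fst p)"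
      "\<And>p. p \<in> P \<Longrightarrow> continuous_map T euclideanreal (snd p)" "P \<noteq> {}"
    and sep: "\<And>x y. x \<in> topspace T \<Longrightarrow> y \<in> topspace T \<Longrightarrow> g y < f x \<Longrightarrow> \<exists>p \<in> P. snd p y < fst p x"
  obtains p :: "nat \<Rightarrow> ('a \<Rightarrow> real) \<times> ('a \<Rightarrow> real)" and a b w :: "nat \<Rightarrow> real"
  where "\<And>i. p i \<in> P" "\<And>i. a i < b i" "\<And>i. 0 \<le> w i" "\<And>\<epsilon>. 0 < \<epsilon> \<Longrightarrow> finite {i. \<epsilon> \<le> w i}"
    "\<And>x y. x \<in> topspace T \<Longrightarrow> y \<in> topspace T \<Longrightarrow> g y < f x \<Longrightarrow>
      \<exists>i. f x - g y < w i \<and> snd (p i) y < a i \<and> b i < fst (p i) x"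
proof -
  have "\<exists>l. set l \<subseteq> P \<times> {(a, b). a < b} \<and> (\<forall>x \<in> topspace T. \<forall>y \<in> topspace T. (1/2) ^ n \<le> f x - g y \<longrightarrow>
      (\<exists>(p, a, b) \<in> set l. snd p y < a \<and> b < fst p x))" for n :: nat
  proof -
    obtain J where J: "finite J" "J \<subseteq> P \<times> {(a, b). a < b}"
      "\<And>x y. x \<in> topspace T \<Longrightarrow> y \<in> topspace T \<Longrightarrow> (1/2) ^ n \<le> f x - g y \<Longrightarrow>
        \<exists>(p, a, b) \<in> J. snd p y < a \<and> b < fst p x"
      by (rule finite_separating_family[OF T f(1) g(1) P(1,2) sep, of "(1/2) ^ n"]) auto
    moreover obtain l where "set l = J" using finite_list[OF J(1)] by blast
    ultimately show ?thesis by (intro exI[of _ l]) simp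
  qed
  then have "\<exists>l. \<forall>n :: nat. set (l n) \<subseteq> P \<times> {(a, b). a < b} \<and> (\<forall>x \<in> topspace T. \<forall>y \<in> topspace T.
      (1/2) ^ n \<le> f x - g y \<longrightarrow> (\<exists>(p, a, b) \<in> set (l n). snd p y < a \<and> b < fst p x))"
    by (intro choice allI)
  then obtain l where l: "\<And>n :: nat. set (l n) \<subseteq> P \<times> {(a, b). a < b}"
    and l_sep: "\<And>n x y. x \<in> topspace T \<Longrightarrow> y \<in> topspace T \<Longrightarrow> (1/2) ^ n \<le> f x - g y \<Longrightarrow>
      \<exists>(p, a, b) \<in> set (l n). snd p y < a \<and> b < fst p x"
    by blast
  obtain p0 where p0: "p0 \<in> P" using P(3) by blast
  (* Indices are pairs of a threshold n and a position in the list for n. Indices beyond the end of a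
     list get weight 0 and an arbitrary member of P. *)
  define valid where "valid i \<longleftrightarrow> snd (prod_decode i) < length (l (fst (prod_decode i)))" for i
  define q where "q i = (if valid i then l (fst (prod_decode i)) ! snd (prod_decode i) else (p0, 0, 1))" for i
  define w where "w i = (if valid i then 2 * (1/2) ^ fst (prod_decode i) else 0 :: real)" for i
  have q: "q i \<in> P \<times> {(a, b). a < b}" for i
    using l[of "fst (prod_decode i)"] p0 unfolding q_def valid_def by (auto dest!: nth_mem)
  show thesis
  proof (rule that[of "\<lambda>i. fst (q i)" "\<lambda>i. fst (snd (q i))" "\<lambda>i. snd (snd (q i))" w])
    show "fst (q i) \<in> P" "fst (snd (q i)) < snd (snd (q i))" for i
      using q[of i] by auto
    show "0 \<le> w i" for i by (simp add: w_def)
    show "finite {i. \<epsilon> \<le> w i}" if \<epsilon>: "0 < \<epsilon>" for \<epsilon>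
    proof -
      obtain N where N: "(1/2::real) ^ N < \<epsilon> / 2"
        using real_arch_pow_inv[of "\<epsilon> / 2" "1/2"] \<epsilon> by auto
      have "{i. \<epsilon> \<le> w i} \<subseteq> prod_encode ` (SIGMA n:{..N}. {..<length (l n)})"
      proof
        fix i assume "i \<in> {i. \<epsilon> \<le> w i}"
        then have v: "valid i" and "\<epsilon> \<le> 2 * (1/2) ^ fst (prod_decode i)"
          using \<epsilon> by (auto simp: w_def split: if_splits)
        then have "(1/2::real) ^ N < (1/2) ^ fst (prod_decode i)" using N by linarith
        then have "fst (prod_decode i) \<le> N"
          using power_decreasing[of N "fst (prod_decode i)" "1/2 :: real"] by fastforce
        then show "i \<in> prod_encode ` (SIGMA n:{..N}. {..<length (l n)})"
          using v unfolding valid_def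
          by (intro image_eqI[of _ _ "prod_decode i"]) (auto simp: mem_Times_iff Sigma_def split_beta intro!: prod.collapse[symmetric])
      qed
      then show ?thesis by (rule finite_subset) auto
    qed
    show "\<exists>i. f x - g y < w i \<and> snd (fst (q i)) y < fst (snd (q i)) \<and> snd (snd (q i)) < fst (fst (q i)) x"
      if xy: "x \<in> topspace T" "y \<in> topspace T" "g y < f x" for x y
    proof -
      have ex: "\<exists>n. (1/2::real) ^ n \<le> f x - g y"
        using real_arch_pow_inv[of "f x - g y" "1/2"] xy(3) by (auto intro: less_imp_le)
      define n where "n = (LEAST n. (1/2::real) ^ n \<le> f x - g y)"
      have n: "(1/2) ^ n \<le> f x - g y" unfolding n_def by (rule LeastI_ex[OF ex])
      have "f x - g y < 2 * (1/2) ^ n"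
      proof (cases n)
        case 0
        then show ?thesis using f(2)[OF xy(1)] g(2)[OF xy(2)] by auto
      next
        case (Suc m)
        then have "\<not> (1/2::real) ^ m \<le> f x - g y"
          using not_less_Least[of m "\<lambda>n. (1/2::real) ^ n \<le> f x - g y"] n_def by auto
        then show ?thesis by (simp add: Suc)
      qed
      moreover obtain p a b where pab: "(p, a, b) \<in> set (l n)" "snd p y < a" "b < fst p x"
        using l_sep[OF xy(1,2) n] by blast
      moreover obtain k where "k < length (l n)" "l n ! k = (p, a, b)"
        using pab(1) by (auto simp: in_set_conv_nth)
      ultimately show ?thesis
        by (intro exI[of _ "prod_encode (n, k)"]) (auto simp: w_def q_def valid_def)
    qed
  qed
qed

text \<open>Let \<open>D(x, t)\<close> be the supremum over \<open>i\<close> of \<open>w i\<close> times the positive part of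
  \<open>s i (fst (p i) x) - s i (t i)\<close>, where \<open>s i\<close> is the ramp from \<open>a i\<close> to \<open>b i\<close>. The weights are such that
  \<open>f x - g y \<le> D(x, snd p y)\<close>. The operation \<open>G\<close> is the extension formula of McShane,
  \<open>G t = sup\<^sub>x (f x - D(x, t))\<close>, cut off at \<open>0\<close>: it dominates \<open>f\<close> at \<open>t = fst p x\<close> because the distance
  vanishes there, and is dominated by \<open>g\<close> at \<open>t = snd p y\<close>. The set \<open>S t\<close> below expresses this
  supremum without a nested one.

  With \<open>f = g\<close> and a set \<open>P\<close> of diagonal pairs, this says that \<open>f\<close> is obtained by a single operation from
  countably many members of any family whose induced preorder \<open>f\<close> respects.\<close>

theorem two_sided_Stone_Weierstrass:
  fixes f g :: "'a \<Rightarrow> real" and P :: "(('a \<Rightarrow> real) \<times> ('a \<Rightarrow> real)) set"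
  assumes T: "compact_space T"
    and f: "continuous_map T euclideanreal f" "\<And>x. x \<in> topspace T \<Longrightarrow> f x \<in> {0..1}"
    and g: "continuous_map T euclideanreal g" "\<And>x. x \<in> topspace T \<Longrightarrow> g x \<in> {0..1}"
    and P: "\<And>p. p \<in> P \<Longrightarrow> continuous_map T euclideanreal (fst p)"
      "\<And>p. p \<in> P \<Longrightarrow> continuous_map T euclideanreal (snd p)" "P \<noteq> {}"
    and sep: "\<And>x y. x \<in> topspace T \<Longrightarrow> y \<in> topspace T \<Longrightarrow> g y < f x \<Longrightarrow> \<exists>p \<in> P. snd p y < fst p x"
  obtains G :: "(nat \<Rightarrow> real) \<Rightarrow> real" and p :: "nat \<Rightarrow> ('a \<Rightarrow> real) \<times> ('a \<Rightarrow> real)"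
  where "G \<in> clone" "\<And>i. p i \<in> P"
    "\<And>x. x \<in> topspace T \<Longrightarrow> f x \<le> G (\<lambda>i. fst (p i) x)"
    "\<And>x. x \<in> topspace T \<Longrightarrow> G (\<lambda>i. snd (p i) x) \<le> g x"
proof -
  obtain p a b w where p: "\<And>i :: nat. p i \<in> P" and ab: "\<And>i. a i < b i" and w: "\<And>i. 0 \<le> w i"
    and w_finite: "\<And>\<epsilon>. 0 < \<epsilon> \<Longrightarrow> finite {i. \<epsilon> \<le> w i}"
    and seq: "\<And>x y. x \<in> topspace T \<Longrightarrow> y \<in> topspace T \<Longrightarrow> g y < f x \<Longrightarrow>
      \<exists>i. f x - g y < w i \<and> snd (p i) y < a i \<and> b i < fst (p i) x"
    by (rule countable_separating_sequence[OF T f g P sep]) (assumption | blast)+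
  let ?s = "\<lambda>i. ramp (a i) (b i)"
  define S where "S t = {r. r = 0 \<or> (\<exists>x \<in> topspace T. r \<le> f x \<and>
      (\<forall>i. r + w i * (?s i (fst (p i) x) - ?s i (t i)) \<le> f x))}" for t
  define G where "G t = Sup (S t)" for t
  have S0: "0 \<in> S t" for t by (simp add: S_def)
  have S1: "r \<le> 1" if "r \<in> S t" for r t
    using that f(2) unfolding S_def by fastforce
  have bdd: "bdd_above (S t)" for t by (rule bdd_aboveI[of _ 1]) (rule S1)
  have G_upper: "r \<le> G t" if "r \<in> S t" for r t
    unfolding G_def by (rule cSup_upper[OF that bdd])
  have G_least: "G t \<le> c" if "\<And>r. r \<in> S t \<Longrightarrow> r \<le> c" for t c
    unfolding G_def using S0 that by (intro cSup_least) auto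
  have G_range: "G t \<in> {0..1}" for t
    using G_upper[OF S0] G_least[OF S1] by auto
  have S_I: "r \<in> S t" if "x \<in> topspace T" "r \<le> f x"
    "\<And>i. r + w i * (?s i (fst (p i) x) - ?s i (t i)) \<le> f x" for r t x
    unfolding S_def using that by blast
  have G_mono: "G t \<le> G t'" if "\<And>i. t i \<le> t' i" for t t'
  proof (rule G_least)
    have *: "w i * (c - ?s i (t' i)) \<le> w i * (c - ?s i (t i))" for c i
      using mono_ramp[OF ab that, of i] w by (intro mult_left_mono) auto
    fix r assume "r \<in> S t"
    then consider "r = 0" | x where "x \<in> topspace T" "r \<le> f x"
      "\<And>i. r + w i * (?s i (fst (p i) x) - ?s i (t i)) \<le> f x"
      unfolding S_def by blast
    then have "r \<in> S t'"
    proof cases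
      case 2
      then show ?thesis
        by (intro S_I[OF 2(1,2)] order.trans[OF add_left_mono[OF *]])
    qed (simp add: S0)
    then show "r \<le> G t'" by (rule G_upper)
  qed
  have G_Lipschitz: "G t \<le> G t' + \<epsilon>" if "\<And>i. w i * \<bar>?s i (t i) - ?s i (t' i)\<bar> \<le> \<epsilon>" for t t' \<epsilon>
  proof (rule G_least)
    have "0 \<le> w 0 * \<bar>?s 0 (t 0) - ?s 0 (t' 0)\<bar>" using w by simp
    then have \<epsilon>: "0 \<le> \<epsilon>" using that[of 0] by linarith
    fix r assume "r \<in> S t"
    then consider "r = 0" | x where "x \<in> topspace T" "r \<le> f x"
      "\<And>i. r + w i * (?s i (fst (p i) x) - ?s i (t i)) \<le> f x"
      unfolding S_def by blast
    then show "r \<le> G t' + \<epsilon>"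
    proof cases
      case 1
      then show ?thesis using \<epsilon> G_range[of t'] by auto
    next
      case 2
      have "r - \<epsilon> \<in> S t'"
      proof (rule S_I[OF 2(1)])
        fix i
        have "w i * (?s i (t i) - ?s i (t' i)) \<le> \<epsilon>"
          using that[of i] w[of i] by (meson abs_ge_self mult_left_mono order_trans)
        then show "r - \<epsilon> + w i * (?s i (fst (p i) x) - ?s i (t' i)) \<le> f x"
          using 2(3)[of i] by (simp add: algebra_simps)
      qed (use 2 \<epsilon> in simp)
      then show ?thesis using G_upper by fastforce
    qed
  qed
  have "isCont G t" for t
    unfolding isCont_def
  proof (rule tendstoI)
    fix \<epsilon> :: real assume \<epsilon>: "0 < \<epsilon>"
    have "eventually (\<lambda>t'. w i * \<bar>?s i (t' i) - ?s i (t i)\<bar> < \<epsilon> / 2) (at t)" for i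
    proof -
      have "continuous_on UNIV (\<lambda>t'. w i * \<bar>?s i (t' i) - ?s i (t i)\<bar>)"
        by (intro continuous_intros continuous_on_ramp continuous_on_coordinate)
      then have "((\<lambda>t'. w i * \<bar>?s i (t' i) - ?s i (t i)\<bar>) \<longlongrightarrow> w i * \<bar>?s i (t i) - ?s i (t i)\<bar>) (at t)"
        unfolding continuous_on_def by blast
      then show ?thesis
        by (rule order_tendstoD) (use \<epsilon> in simp)
    qed
    then have "eventually (\<lambda>t'. \<forall>i \<in> {i. \<epsilon> / 2 \<le> w i}. w i * \<bar>?s i (t' i) - ?s i (t i)\<bar> < \<epsilon> / 2) (at t)"
      using w_finite[of "\<epsilon> / 2"] \<epsilon> by (intro eventually_ball_finite) auto
    then show "eventually (\<lambda>t'. dist (G t') (G t) < \<epsilon>) (at t)"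
    proof (rule eventually_mono)
      fix t' assume t': "\<forall>i \<in> {i. \<epsilon> / 2 \<le> w i}. w i * \<bar>?s i (t' i) - ?s i (t i)\<bar> < \<epsilon> / 2"
      have *: "w i * \<bar>?s i (t' i) - ?s i (t i)\<bar> \<le> \<epsilon> / 2" for i
      proof (cases "\<epsilon> / 2 \<le> w i")
        case True
        then show ?thesis using t' by (auto intro: less_imp_le)
      next
        case False
        have "\<bar>?s i (t' i) - ?s i (t i)\<bar> \<le> 1"
          using ramp_mem(2,3)[of "a i" "b i" "t' i"] ramp_mem(2,3)[of "a i" "b i" "t i"] by linarith
        then have "w i * \<bar>?s i (t' i) - ?s i (t i)\<bar> \<le> w i * 1"
          using w[of i] by (rule mult_left_mono)
        then show ?thesis using False by linarith
      qed
      have "G t' \<le> G t + \<epsilon> / 2" "G t \<le> G t' + \<epsilon> / 2"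
        using * by (auto intro!: G_Lipschitz simp: abs_minus_commute)
      then show "dist (G t') (G t) < \<epsilon>"
        using \<epsilon> by (auto simp: dist_real_def)
    qed
  qed
  then have "G \<in> clone"
    by (intro cloneI G_mono G_range) (auto simp: continuous_on_eq_continuous_at)
  moreover have "f x \<le> G (\<lambda>i. fst (p i) x)" if "x \<in> topspace T" for x
    using that by (intro G_upper S_I) auto
  moreover have "G (\<lambda>i. snd (p i) y) \<le> g y" if y: "y \<in> topspace T" for y
  proof (rule G_least)
    fix r assume "r \<in> S (\<lambda>i. snd (p i) y)"
    then consider "r = 0" | x where "x \<in> topspace T" "r \<le> f x"
      "\<And>i. r + w i * (?s i (fst (p i) x) - ?s i (snd (p i) y)) \<le> f x"
      unfolding S_def by blast
    then show "r \<le> g y"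
    proof cases
      case 1
      then show ?thesis using g(2)[OF y] by simp
    next
      case 2
      show ?thesis
      proof (rule ccontr)
        assume "\<not> r \<le> g y"
        then have "g y < f x" using 2 by simp
        then obtain i where i: "f x - g y < w i" "snd (p i) y < a i" "b i < fst (p i) x"
          using seq 2 y by blast
        then have "r + w i \<le> f x"
          using 2(3)[of i] ab[of i] by (simp add: ramp_eq_0 ramp_eq_1)
        then show False using i \<open>\<not> r \<le> g y\<close> by simp
      qed
    qed
  qed
  ultimately show thesis using that p by blast
qed

section \<open>Algebras over the clone and their homomorphisms to the unit interval\<close>

lemma closedin_Collect_ball:
  assumes "\<And>i. i \<in> I \<Longrightarrow> closedin T {x \<in> topspace T. Q i x}"
  shows "closedin T {x \<in> topspace T. \<forall>i \<in> I. Q i x}"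
proof -
  have "closedin T (\<Inter> (insert (topspace T) ((\<lambda>i. {x \<in> topspace T. Q i x}) ` I)))"
    using assms by (intro closedin_Inter) auto
  moreover have "\<Inter> (insert (topspace T) ((\<lambda>i. {x \<in> topspace T. Q i x}) ` I)) =
      {x \<in> topspace T. \<forall>i \<in> I. Q i x}" by auto
  ultimately show ?thesis by simp
qed

lemma closedin_Collect_le:
  fixes f g :: "'a \<Rightarrow> real"
  assumes "continuous_map T euclideanreal f" "continuous_map T euclideanreal g"
  shows "closedin T {x \<in> topspace T. f x \<le> g x}"
proof -
  have "closedin T {x \<in> topspace T. g x - f x \<in> {0..}}"
    by (rule closedin_continuous_map_preimage[where Y = euclideanreal])
      (auto intro!: continuous_map_diff assms)
  then show ?thesis by simp
qed

text \<open>Besides closure, three laws are extracted from the equations valid in \<open>[0,1]\<close>: the first projection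
  acts as such, nested operations can be flattened, and two operations with the variables renamed
  agree if they agree on \<open>[0,1]\<close>.\<close>

locale clone_algebra =
  fixes A :: "'a set" and oper :: "((nat \<Rightarrow> real) \<Rightarrow> real) \<Rightarrow> (nat \<Rightarrow> 'a) \<Rightarrow> 'a"
  assumes nonempty: "A \<noteq> {}"
    and oper_closed: "g \<in> clone \<Longrightarrow> (\<And>i. a i \<in> A) \<Longrightarrow> oper g a \<in> A"
    and oper_proj: "(\<And>i. a i \<in> A) \<Longrightarrow> oper (\<lambda>v. unit_clamp (v 0)) a = a 0"
    and oper_comp: "g \<in> clone \<Longrightarrow> (\<And>i. h i \<in> clone) \<Longrightarrow> (\<And>i. a i \<in> A) \<Longrightarrow>
      oper g (\<lambda>i. oper (h i) (\<lambda>j. a (prod_encode (i, j)))) =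
      oper (\<lambda>v. g (\<lambda>i. h i (\<lambda>j. v (prod_encode (i, j))))) a"
    and oper_cong: "g \<in> clone \<Longrightarrow> k \<in> clone \<Longrightarrow> (\<And>i. a i \<in> A) \<Longrightarrow>
      (\<And>v :: nat \<Rightarrow> real. (\<And>i. v i \<in> {0..1}) \<Longrightarrow> g (\<lambda>i. v (\<sigma> i)) = k (\<lambda>i. v (\<tau> i))) \<Longrightarrow>
      oper g (\<lambda>i. a (\<sigma> i)) = oper k (\<lambda>i. a (\<tau> i))"
begin

definition cube :: "('a \<Rightarrow> real) topology" where
  "cube = product_topology (\<lambda>_. top_of_set {0..1}) A"

lemma topspace_cube: "topspace cube = A \<rightarrow>\<^sub>E {0..1}"
  by (simp add: cube_def)

lemma cube_range: "x \<in> topspace cube \<Longrightarrow> \<alpha> \<in> A \<Longrightarrow> x \<alpha> \<in> {0..1}"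
  unfolding topspace_cube by blast

lemma cube_ext: "x \<in> topspace cube \<Longrightarrow> y \<in> topspace cube \<Longrightarrow> (\<And>\<alpha>. \<alpha> \<in> A \<Longrightarrow> x \<alpha> = y \<alpha>) \<Longrightarrow> x = y"
  unfolding topspace_cube by (rule PiE_ext)

lemma compact_cube: "compact_space cube"
  unfolding cube_def by (intro compact_space_product_topology[THEN iffD2] disjI2) (simp add: compact_space_subtopology)

lemma continuous_map_coordinate:
  assumes "\<alpha> \<in> A" shows "continuous_map cube euclideanreal (\<lambda>x. x \<alpha>)"
  unfolding cube_def
  by (rule continuous_map_into_fulltopology[OF continuous_map_product_projection[OF assms]])

text \<open>\<open>rep f \<alpha>\<close> is the graph of the homomorphism from the free algebra over the set \<open>A\<close>, whose elements
  are functions on the cube, onto the algebra \<open>A\<close>. It is presented as a relation so that functions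
  need to agree on the cube only.\<close>

definition rep :: "(('a \<Rightarrow> real) \<Rightarrow> real) \<Rightarrow> 'a \<Rightarrow> bool" where
  "rep f \<alpha> \<longleftrightarrow> (\<exists>g \<in> clone. \<exists>a. (\<forall>i. a i \<in> A) \<and> \<alpha> = oper g a \<and>
     (\<forall>x \<in> topspace cube. f x = g (\<lambda>i. x (a i))))"

lemma repE:
  assumes "rep f \<alpha>"
  obtains g a where "g \<in> clone" "\<And>i. a i \<in> A" "\<alpha> = oper g a"
    "\<And>x. x \<in> topspace cube \<Longrightarrow> f x = g (\<lambda>i. x (a i))"
  using assms unfolding rep_def by blast

lemma rep_in_carrier: "rep f \<alpha> \<Longrightarrow> \<alpha> \<in> A"
  unfolding rep_def by (elim bexE exE conjE) (simp add: oper_closed)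

lemma rep_range: "rep f \<alpha> \<Longrightarrow> x \<in> topspace cube \<Longrightarrow> f x \<in> {0..1}"
  unfolding rep_def by (elim bexE exE conjE) (simp add: clone_range del: atLeastAtMost_iff)

lemma rep_continuous:
  assumes "rep f \<alpha>" shows "continuous_map cube euclideanreal f"
proof -
  obtain g a where g: "g \<in> clone" "\<And>i. a i \<in> A" "\<And>x. x \<in> topspace cube \<Longrightarrow> f x = g (\<lambda>i. x (a i))"
    using assms by (rule repE) blast
  have "continuous_map cube euclideanreal (\<lambda>x. g (\<lambda>i. x (a i)))"
    by (rule continuous_map_clone[OF g(1) continuous_map_coordinate[OF g(2)]])
  then show ?thesis by (rule continuous_map_eq) (simp add: g)
qed

lemma rep_cong: "rep f \<alpha> \<Longrightarrow> (\<And>x. x \<in> topspace cube \<Longrightarrow> f' x = f x) \<Longrightarrow> rep f' \<alpha>"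
  unfolding rep_def by auto

lemma rep_coordinate: "\<alpha> \<in> A \<Longrightarrow> rep (\<lambda>x. x \<alpha>) \<alpha>"
  unfolding rep_def
  by (intro bexI[OF _ clone_proj[of 0]] exI[of _ "\<lambda>_. \<alpha>"])
    (auto simp: oper_proj[of "\<lambda>_. \<alpha>"] unit_clamp_eq[OF cube_range])

lemma rep_oper:
  assumes g: "g \<in> clone" and f: "\<And>i. rep (f i) (\<alpha> i)"
  shows "rep (\<lambda>x. g (\<lambda>i. f i x)) (oper g \<alpha>)"
proof -
  have "\<forall>i. \<exists>h a. h \<in> clone \<and> (\<forall>j. a j \<in> A) \<and> \<alpha> i = oper h a \<and>
      (\<forall>x \<in> topspace cube. f i x = h (\<lambda>j. x (a j)))"
    using f unfolding rep_def by blast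
  then obtain h a where h: "\<And>i. h i \<in> clone" and a: "\<And>i j. a i j \<in> A"
    and \<alpha>: "\<And>i. \<alpha> i = oper (h i) (a i)"
    and fx: "\<And>i x. x \<in> topspace cube \<Longrightarrow> f i x = h i (\<lambda>j. x (a i j))"
    by metis
  let ?b = "\<lambda>k. a (fst (prod_decode k)) (snd (prod_decode k))"
  have "oper g (\<lambda>i. oper (h i) (\<lambda>j. ?b (prod_encode (i, j)))) =
      oper (\<lambda>v. g (\<lambda>i. h i (\<lambda>j. v (prod_encode (i, j))))) ?b"
    by (rule oper_comp[OF g h]) (rule a)
  then have "oper g \<alpha> = oper (\<lambda>v. g (\<lambda>i. h i (\<lambda>j. v (prod_encode (i, j))))) ?b"
    using ext[of \<alpha> "\<lambda>i. oper (h i) (a i)", OF \<alpha>] by simp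
  then show ?thesis
    unfolding rep_def
    by (intro bexI[OF _ clone_comp[OF g h]] exI[of _ ?b]) (auto simp: a fx)
qed

text \<open>Two representations of the same function use two sequences \<open>a\<close> and \<open>b\<close> of generators. They are
  merged into one sequence \<open>c\<close>. To turn equality on the cube into an equation between operations,
  equal members of \<open>c\<close> have to receive the same variable, namely the first index at which they
  occur.\<close>

lemma rep_unique:
  assumes "rep f \<alpha>" "rep f' \<beta>" and eq: "\<And>x. x \<in> topspace cube \<Longrightarrow> f x = f' x"
  shows "\<alpha> = \<beta>"
proof -
  obtain g a where g: "g \<in> clone" "\<And>i. a i \<in> A" "\<alpha> = oper g a"
    "\<And>x. x \<in> topspace cube \<Longrightarrow> f x = g (\<lambda>i. x (a i))" using assms(1) by (rule repE) blast
  obtain h b where h: "h \<in> clone" "\<And>i. b i \<in> A" "\<beta> = oper h b"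
    "\<And>x. x \<in> topspace cube \<Longrightarrow> f' x = h (\<lambda>i. x (b i))" using assms(2) by (rule repE) blast
  define c where "c k = (if even k then a (k div 2) else b (k div 2))" for k :: nat
  define first where "first \<gamma> = (LEAST k. c k = \<gamma>)" for \<gamma>
  have c_first: "c (first (c k)) = c k" for k
    unfolding first_def by (rule LeastI) simp
  have "oper g (\<lambda>i. c (first (c (2 * i)))) = oper h (\<lambda>i. c (first (c (2 * i + 1))))"
  proof (rule oper_cong[OF g(1) h(1)])
    show "c i \<in> A" for i using g(2) h(2) by (simp add: c_def)
    fix v :: "nat \<Rightarrow> real" assume v: "\<And>i. v i \<in> {0..1}"
    (* The point of the cube that realises the assignment v of values to variables. *)
    let ?x = "\<lambda>\<gamma> \<in> A. v (first \<gamma>)"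
    have x: "?x \<in> topspace cube" using v by (auto simp: topspace_cube)
    have "g (\<lambda>i. ?x (a i)) = h (\<lambda>i. ?x (b i))"
      using eq[OF x] g(4)[OF x] h(4)[OF x] by simp
    then show "g (\<lambda>i. v (first (c (2 * i)))) = h (\<lambda>i. v (first (c (2 * i + 1))))"
      using g(2) h(2) by (simp add: c_def)
  qed
  then have "oper g (\<lambda>i. c (2 * i)) = oper h (\<lambda>i. c (2 * i + 1))"
    by (simp only: c_first)
  then show ?thesis
    using g(3) h(3) by (simp add: c_def)
qed

lemma rep_const: "c \<in> {0..1} \<Longrightarrow> \<exists>\<alpha>. rep (\<lambda>_. c) \<alpha>"
  using nonempty rep_oper[OF clone_const rep_coordinate] by fastforce

definition meet :: "'a \<Rightarrow> 'a \<Rightarrow> 'a" where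
  "meet \<alpha> \<beta> = oper (\<lambda>v. unit_clamp (min (v 0) (v 1))) (\<lambda>i. if i = 0 then \<alpha> else \<beta>)"

definition join :: "'a \<Rightarrow> 'a \<Rightarrow> 'a" where
  "join \<alpha> \<beta> = oper (\<lambda>v. unit_clamp (max (v 0) (v 1))) (\<lambda>i. if i = 0 then \<alpha> else \<beta>)"

text \<open>The order of the algebra. Although the operations are only monotone, every inequality between
  functions on the cube is the equation \<open>min f g = f\<close>, and so passes to \<open>A\<close>.\<close>

definition below :: "'a \<Rightarrow> 'a \<Rightarrow> bool" where
  "below \<alpha> \<beta> \<longleftrightarrow> meet \<alpha> \<beta> = \<alpha>"

lemma rep_meet: 
  assumes "rep f \<alpha>" "rep g \<beta>" shows "rep (\<lambda>x. min (f x) (g x)) (meet \<alpha> \<beta>)"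
proof -
  have "rep (\<lambda>x. unit_clamp (min (if (0::nat) = 0 then f x else g x) (if (1::nat) = 0 then f x else g x))) (meet \<alpha> \<beta>)"
    unfolding meet_def
    by (rule rep_oper[OF clone_min, of "\<lambda>i x. if i = 0 then f x else g x"]) (use assms in auto)
  then show ?thesis
    by (rule rep_cong) (use rep_range[OF assms(1)] rep_range[OF assms(2)] in \<open>auto simp: min_def\<close>)
qed

lemma rep_join: 
  assumes "rep f \<alpha>" "rep g \<beta>" shows "rep (\<lambda>x. max (f x) (g x)) (join \<alpha> \<beta>)"
proof -
  have "rep (\<lambda>x. unit_clamp (max (if (0::nat) = 0 then f x else g x) (if (1::nat) = 0 then f x else g x))) (join \<alpha> \<beta>)"
    unfolding join_def
    by (rule rep_oper[OF clone_max, of "\<lambda>i x. if i = 0 then f x else g x"]) (use assms in auto)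
  then show ?thesis
    by (rule rep_cong) (use rep_range[OF assms(1)] rep_range[OF assms(2)] in \<open>auto simp: max_def\<close>)
qed

lemma below_if_pointwise:
  assumes "rep f \<alpha>" "rep g \<beta>" "\<And>x. x \<in> topspace cube \<Longrightarrow> f x \<le> g x"
  shows "below \<alpha> \<beta>"
  unfolding below_def
  by (rule rep_unique[OF rep_meet[OF assms(1,2)] assms(1)]) (simp add: assms(3) min_absorb1)

lemma below_refl: "\<alpha> \<in> A \<Longrightarrow> below \<alpha> \<alpha>"
  by (rule below_if_pointwise[OF rep_coordinate rep_coordinate]) auto

lemma below_antisym:
  assumes "\<alpha> \<in> A" "\<beta> \<in> A" "below \<alpha> \<beta>" "below \<beta> \<alpha>" shows "\<alpha> = \<beta>"
proof -
  have "meet \<alpha> \<beta> = meet \<beta> \<alpha>"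
    by (rule rep_unique[OF rep_meet rep_meet]; (rule rep_coordinate, fact)?) (simp add: min.commute)
  then show ?thesis using assms by (simp add: below_def)
qed

lemma below_trans:
  assumes A: "\<alpha> \<in> A" "\<beta> \<in> A" "\<gamma> \<in> A" and "below \<alpha> \<beta>" "below \<beta> \<gamma>" shows "below \<alpha> \<gamma>"
proof -
  note r = A[THEN rep_coordinate]
  have "meet (meet \<alpha> \<beta>) \<gamma> = meet \<alpha> (meet \<beta> \<gamma>)"
    by (rule rep_unique[OF rep_meet[OF rep_meet[OF r(1,2)] r(3)] rep_meet[OF r(1) rep_meet[OF r(2,3)]]])
      (simp add: min.assoc)
  then show ?thesis using assms by (simp add: below_def)
qed

lemma oper_mono:
  assumes g: "g \<in> clone" and ab: "\<And>i. a i \<in> A" "\<And>i. b i \<in> A" "\<And>i. below (a i) (b i)"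
  shows "below (oper g a) (oper g b)"
proof -
  have "rep (\<lambda>x. g (\<lambda>i. min (x (a i)) (x (b i)))) (oper g (\<lambda>i. meet (a i) (b i)))"
    by (intro rep_oper g rep_meet rep_coordinate ab)
  then have "rep (\<lambda>x. g (\<lambda>i. min (x (a i)) (x (b i)))) (oper g a)"
    using ab(3) by (simp add: below_def)
  moreover have "rep (\<lambda>x. g (\<lambda>i. x (b i))) (oper g b)"
    by (intro rep_oper g rep_coordinate ab)
  ultimately show ?thesis
    by (rule below_if_pointwise) (auto intro!: clone_mono[OF g])
qed

lemma meet_mono:
  assumes "\<alpha> \<in> A" "\<beta> \<in> A" "\<alpha>' \<in> A" "\<beta>' \<in> A" "below \<alpha> \<alpha>'" "below \<beta> \<beta>'"
  shows "below (meet \<alpha> \<beta>) (meet \<alpha>' \<beta>')"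
  unfolding meet_def by (rule oper_mono[OF clone_min]) (use assms in auto)

lemma join_mono:
  assumes "\<alpha> \<in> A" "\<beta> \<in> A" "\<alpha>' \<in> A" "\<beta>' \<in> A" "below \<alpha> \<alpha>'" "below \<beta> \<beta>'"
  shows "below (join \<alpha> \<beta>) (join \<alpha>' \<beta>')"
  unfolding join_def by (rule oper_mono[OF clone_max]) (use assms in auto)

definition homs :: "('a \<Rightarrow> real) set" where
  "homs = {\<phi> \<in> A \<rightarrow>\<^sub>E {0..1}. \<forall>g \<in> clone. \<forall>a. (\<forall>i. a i \<in> A) \<longrightarrow> \<phi> (oper g a) = g (\<lambda>i. \<phi> (a i))}"

lemma homs_oper: "\<phi> \<in> homs \<Longrightarrow> g \<in> clone \<Longrightarrow> (\<And>i. a i \<in> A) \<Longrightarrow> \<phi> (oper g a) = g (\<lambda>i. \<phi> (a i))"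
  unfolding homs_def by blast

lemma homs_cube: "\<phi> \<in> homs \<Longrightarrow> \<phi> \<in> topspace cube"
  unfolding homs_def topspace_cube by blast

text \<open>The preorder on two copies of the cube that corresponds to the congruence with quotient \<open>A\<close>,
  restricted to pairs with \<open>x\<close> in the first and \<open>y\<close> in the second copy.\<close>

definition precedes :: "('a \<Rightarrow> real) \<Rightarrow> ('a \<Rightarrow> real) \<Rightarrow> bool" where
  "precedes x y \<longleftrightarrow> (\<forall>f \<alpha> g \<beta>. rep f \<alpha> \<longrightarrow> rep g \<beta> \<longrightarrow> below \<alpha> \<beta> \<longrightarrow> f x \<le> g y)"

lemma precedesD: "precedes x y \<Longrightarrow> rep f \<alpha> \<Longrightarrow> rep g \<beta> \<Longrightarrow> below \<alpha> \<beta> \<Longrightarrow> f x \<le> g y"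
  unfolding precedes_def by blast

lemma precedes_imp_le: "precedes x y \<Longrightarrow> \<alpha> \<in> A \<Longrightarrow> x \<alpha> \<le> y \<alpha>"
  using precedesD[OF _ rep_coordinate rep_coordinate below_refl] .

text \<open>A point that precedes itself takes equal values under functions of the same class, and
  \<open>x \<mapsto> x (oper g a)\<close> and \<open>x \<mapsto> g (\<lambda>i. x (a i))\<close> are of the same class.\<close>

lemma precedes_refl_imp_hom:
  assumes v: "v \<in> topspace cube" "precedes v v" shows "v \<in> homs"
  unfolding homs_def
proof (intro CollectI conjI ballI allI impI)
  fix g and a :: "nat \<Rightarrow> 'a" assume g: "g \<in> clone" and a: "\<forall>i. a i \<in> A"
  have A: "oper g a \<in> A" using oper_closed[OF g] a by blast
  have r: "rep (\<lambda>x. g (\<lambda>i. x (a i))) (oper g a)"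
    using a by (intro rep_oper[OF g] rep_coordinate) blast
  show "v (oper g a) = g (\<lambda>i. v (a i))"
    using precedesD[OF v(2) r rep_coordinate[OF A] below_refl[OF A]]
      precedesD[OF v(2) rep_coordinate[OF A] r below_refl[OF A]] by simp
qed (use v topspace_cube in simp)

text \<open>A witness \<open>(f, g)\<close> against \<open>x\<close> preceding \<open>y\<close> can be rescaled by a ramp so that it takes the values
  \<open>1\<close> at \<open>x\<close> and \<open>0\<close> near \<open>y\<close>, or \<open>1\<close> near \<open>x\<close> and \<open>0\<close> at \<open>y\<close>.\<close>

lemma not_precedes_ramps:
  assumes "\<not> precedes x y"
  obtains f \<alpha> g \<beta> p q where "rep f \<alpha>" "rep g \<beta>" "below \<alpha> \<beta>" "p < q" "g y < p" "q < f x"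
    "rep (\<lambda>z. ramp p q (f z)) (oper (\<lambda>v. ramp p q (v 0)) (\<lambda>_. \<alpha>))"
    "rep (\<lambda>z. ramp p q (g z)) (oper (\<lambda>v. ramp p q (v 0)) (\<lambda>_. \<beta>))"
    "below (oper (\<lambda>v. ramp p q (v 0)) (\<lambda>_. \<alpha>)) (oper (\<lambda>v. ramp p q (v 0)) (\<lambda>_. \<beta>))"
proof -
  obtain f \<alpha> g \<beta> where fg: "rep f \<alpha>" "rep g \<beta>" "below \<alpha> \<beta>" "g y < f x"
    using assms unfolding precedes_def by (auto simp: not_le)
  obtain p where p: "g y < p" "p < f x" using dense[OF fg(4)] by blast
  obtain q where q: "p < q" "q < f x" using dense[OF p(2)] by blast
  show thesis
    by (rule that[OF fg(1-3) q(1) p(1) q(2)])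
      (intro rep_oper[OF clone_ramp[OF q(1)]] oper_mono[OF clone_ramp[OF q(1)]] fg
        rep_in_carrier[OF fg(1)] rep_in_carrier[OF fg(2)])+
qed

text \<open>If no point lies between, then every \<open>z\<close> fails on one of the two sides, and rescaled witnesses of
  this failure near \<open>z\<close> form a cover. The cover lemma yields classes \<open>f' \<le> f \<le> g \<le> g'\<close> with \<open>f' x = 1\<close>
  and \<open>g' y = 0\<close>, where the middle inequality is pointwise. By transitivity \<open>f' \<le> g'\<close>, so that \<open>x\<close>
  does not precede \<open>y\<close>.\<close>

lemma precedes_interpolation:
  assumes xy: "x \<in> topspace cube" "y \<in> topspace cube" "precedes x y"
  obtains z where "z \<in> topspace cube" "precedes x z" "precedes z y"
proof (rule ccontr)
  assume "\<not> thesis"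
  then have no: "\<And>z. z \<in> topspace cube \<Longrightarrow> \<not> precedes x z \<or> \<not> precedes z y"
    using that by blast
  define L where "L = {g. \<exists>f \<alpha> \<beta>. rep f \<alpha> \<and> rep g \<beta> \<and> below \<alpha> \<beta> \<and> f x = 1}"
  define U where "U = {g. \<exists>h \<alpha> \<beta>. rep g \<alpha> \<and> rep h \<beta> \<and> below \<alpha> \<beta> \<and> h y = 0}"
  obtain f g where "f \<in> L" "g \<in> U" and fg: "\<And>z. z \<in> topspace cube \<Longrightarrow> f z \<le> g z"
  proof (rule ordered_pair_from_cover[OF compact_cube, of L U])
    show "L \<noteq> {}" using rep_const[of 1] below_refl rep_in_carrier unfolding L_def by fastforce
    show "U \<noteq> {}" using rep_const[of 0] below_refl rep_in_carrier unfolding U_def by fastforce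
    show "f z \<le> 1" if "f \<in> L" "z \<in> topspace cube" for f z
      using that rep_range unfolding L_def by fastforce
    show "0 \<le> f z" if "f \<in> U" "z \<in> topspace cube" for f z
      using that rep_range unfolding U_def by fastforce
    show "\<exists>h \<in> L. \<forall>z \<in> topspace cube. h z \<le> min (f z) (g z)" if "f \<in> L" "g \<in> L" for f g
    proof -
      obtain f' \<alpha> \<beta> where f: "rep f' \<alpha>" "rep f \<beta>" "below \<alpha> \<beta>" "f' x = 1"
        using \<open>f \<in> L\<close> unfolding L_def by blast
      obtain g' \<alpha>' \<beta>' where g: "rep g' \<alpha>'" "rep g \<beta>'" "below \<alpha>' \<beta>'" "g' x = 1"
        using \<open>g \<in> L\<close> unfolding L_def by blast
      have "(\<lambda>z. min (f z) (g z)) \<in> L"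
        unfolding L_def using rep_meet[OF f(1) g(1)] rep_meet[OF f(2) g(2)]
          meet_mono[OF f(1)[THEN rep_in_carrier] g(1)[THEN rep_in_carrier]
            f(2)[THEN rep_in_carrier] g(2)[THEN rep_in_carrier] f(3) g(3)] f(4) g(4)
        by fastforce
      then show ?thesis by (rule rev_bexI) simp
    qed
    show "\<exists>h \<in> U. \<forall>z \<in> topspace cube. max (f z) (g z) \<le> h z" if "f \<in> U" "g \<in> U" for f g
    proof -
      obtain f' \<alpha> \<beta> where f: "rep f \<alpha>" "rep f' \<beta>" "below \<alpha> \<beta>" "f' y = 0"
        using \<open>f \<in> U\<close> unfolding U_def by blast
      obtain g' \<alpha>' \<beta>' where g: "rep g \<alpha>'" "rep g' \<beta>'" "below \<alpha>' \<beta>'" "g' y = 0"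
        using \<open>g \<in> U\<close> unfolding U_def by blast
      have "(\<lambda>z. max (f z) (g z)) \<in> U"
        unfolding U_def using rep_join[OF f(1) g(1)] rep_join[OF f(2) g(2)]
          join_mono[OF f(1)[THEN rep_in_carrier] g(1)[THEN rep_in_carrier]
            f(2)[THEN rep_in_carrier] g(2)[THEN rep_in_carrier] f(3) g(3)] f(4) g(4)
        by fastforce
      then show ?thesis by (rule rev_bexI) simp
    qed
    fix z assume z: "z \<in> topspace cube"
    from no[OF z] show "\<exists>W. openin cube W \<and> z \<in> W \<and>
        ((\<exists>f \<in> L. \<forall>w \<in> W. f w \<le> 0) \<or> (\<exists>g \<in> U. \<forall>w \<in> W. 1 \<le> g w))"
    proof
      assume "\<not> precedes x z"
      then obtain f \<alpha> g \<beta> p q where fg: "rep f \<alpha>" "rep g \<beta>" "below \<alpha> \<beta>" "p < q" "g z < p" "q < f x"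
        "rep (\<lambda>z. ramp p q (f z)) (oper (\<lambda>v. ramp p q (v 0)) (\<lambda>_. \<alpha>))"
        "rep (\<lambda>z. ramp p q (g z)) (oper (\<lambda>v. ramp p q (v 0)) (\<lambda>_. \<beta>))"
        "below (oper (\<lambda>v. ramp p q (v 0)) (\<lambda>_. \<alpha>)) (oper (\<lambda>v. ramp p q (v 0)) (\<lambda>_. \<beta>))"
        by (rule not_precedes_ramps)
      have "ramp p q (f x) = 1" using fg(4,6) by (simp add: ramp_eq_1)
      then have "(\<lambda>z. ramp p q (g z)) \<in> L"
        unfolding L_def using fg(7-9) by blast
      moreover have "openin cube {w \<in> topspace cube. g w \<in> {..<p}}"
        by (rule openin_continuous_map_preimage[OF rep_continuous[OF fg(2)]]) simp
      ultimately show ?thesis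
        using z fg(4,5) by (intro exI[of _ "{w \<in> topspace cube. g w \<in> {..<p}}"] conjI disjI1
            bexI[of _ "\<lambda>z. ramp p q (g z)"])
          (auto simp: ramp_eq_0)
    next
      assume "\<not> precedes z y"
      then obtain f \<alpha> g \<beta> p q where fg: "rep f \<alpha>" "rep g \<beta>" "below \<alpha> \<beta>" "p < q" "g y < p" "q < f z"
        "rep (\<lambda>z. ramp p q (f z)) (oper (\<lambda>v. ramp p q (v 0)) (\<lambda>_. \<alpha>))"
        "rep (\<lambda>z. ramp p q (g z)) (oper (\<lambda>v. ramp p q (v 0)) (\<lambda>_. \<beta>))"
        "below (oper (\<lambda>v. ramp p q (v 0)) (\<lambda>_. \<alpha>)) (oper (\<lambda>v. ramp p q (v 0)) (\<lambda>_. \<beta>))"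
        by (rule not_precedes_ramps)
      have "ramp p q (g y) = 0" using fg(4,5) by (simp add: ramp_eq_0)
      then have "(\<lambda>z. ramp p q (f z)) \<in> U"
        unfolding U_def using fg(7-9) by blast
      moreover have "openin cube {w \<in> topspace cube. f w \<in> {q<..}}"
        by (rule openin_continuous_map_preimage[OF rep_continuous[OF fg(1)]]) simp
      ultimately show ?thesis
        using z fg(4,6) by (intro exI[of _ "{w \<in> topspace cube. f w \<in> {q<..}}"] conjI disjI2
            bexI[of _ "\<lambda>z. ramp p q (f z)"])
          (auto simp: ramp_eq_1)
    qed
  qed (rule that)
  obtain f' \<alpha> \<beta> where f: "rep f' \<alpha>" "rep f \<beta>" "below \<alpha> \<beta>" "f' x = 1"
    using \<open>f \<in> L\<close> unfolding L_def by blast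
  obtain g' \<gamma> \<delta> where g: "rep g \<gamma>" "rep g' \<delta>" "below \<gamma> \<delta>" "g' y = 0"
    using \<open>g \<in> U\<close> unfolding U_def by blast
  have "below \<beta> \<gamma>" using fg by (rule below_if_pointwise[OF f(2) g(1)])
  then have "below \<alpha> \<delta>"
    using f g by (meson below_trans rep_in_carrier)
  then have "f' x \<le> g' y" using precedesD[OF xy(3) f(1) g(2)] by blast
  then show False using f g by simp
qed

text \<open>Among the points below \<open>y\<close> that \<open>u\<close> precedes, take a minimal one \<open>m\<close>; it exists by Zorn's lemma,
  since these points form a compact set. A point \<open>z\<close> interpolated between \<open>u\<close> and \<open>m\<close> lies below \<open>m\<close>,
  hence equals \<open>m\<close>, and therefore \<open>m\<close> precedes itself.\<close>

lemma precedes_through_hom: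
  assumes u: "u \<in> topspace cube" and y: "y \<in> topspace cube" and "precedes u y"
  obtains v where "v \<in> homs" "\<And>\<alpha>. \<alpha> \<in> A \<Longrightarrow> u \<alpha> \<le> v \<alpha>" "\<And>\<alpha>. \<alpha> \<in> A \<Longrightarrow> v \<alpha> \<le> y \<alpha>"
proof -
  define M where "M = {v \<in> topspace cube. precedes u v \<and> (\<forall>\<alpha> \<in> A. v \<alpha> \<le> y \<alpha>)}"
  have cont: "continuous_map cube euclideanreal (\<lambda>x. c)" for c :: real by simp
  have closed_M: "closedin cube M"
  proof -
    let ?I = "{(f, \<alpha>, g, \<beta>). rep f \<alpha> \<and> rep g \<beta> \<and> below \<alpha> \<beta>}"
    have "closedin cube {v \<in> topspace cube. \<forall>(f, \<alpha>, g, \<beta>) \<in> ?I. f u \<le> g v}"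
      by (intro closedin_Collect_ball) (auto intro!: closedin_Collect_le[OF cont] dest: rep_continuous)
    moreover have "closedin cube {v \<in> topspace cube. \<forall>\<alpha> \<in> A. v \<alpha> \<le> y \<alpha>}"
      by (intro closedin_Collect_ball closedin_Collect_le[OF continuous_map_coordinate cont])
    ultimately have "closedin cube ({v \<in> topspace cube. \<forall>(f, \<alpha>, g, \<beta>) \<in> ?I. f u \<le> g v} \<inter>
        {v \<in> topspace cube. \<forall>\<alpha> \<in> A. v \<alpha> \<le> y \<alpha>})"
      by (rule closedin_Int)
    moreover have "M = {v \<in> topspace cube. \<forall>(f, \<alpha>, g, \<beta>) \<in> ?I. f u \<le> g v} \<inter>
        {v \<in> topspace cube. \<forall>\<alpha> \<in> A. v \<alpha> \<le> y \<alpha>}"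
      unfolding M_def precedes_def by blast
    ultimately show ?thesis by simp
  qed
  (* Zorn's lemma yields maximal elements, so the order is reversed. *)
  let ?P = "\<lambda>v w. \<forall>\<alpha> \<in> A. w \<alpha> \<le> v \<alpha>"
  have "\<exists>m \<in> M. \<forall>v \<in> M. ?P m v \<longrightarrow> v = m"
  proof (rule predicate_Zorn)
    show "partial_order_on M (relation_of ?P M)"
      unfolding partial_order_on_def preorder_on_def
    proof (intro conjI)
      show "refl_on M (relation_of ?P M)" "relation_of ?P M \<subseteq> M \<times> M"
        by (auto simp: refl_on_def relation_of_def)
      show "trans (relation_of ?P M)"
        by (auto simp: trans_def relation_of_def intro: order_trans)
      show "antisym (relation_of ?P M)"
        unfolding antisym_def relation_of_def M_def by (auto intro!: cube_ext intro: order.antisym)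
    qed
  next
    fix C assume C: "C \<in> Chains (relation_of ?P M)"
    then have CM: "C \<subseteq> M" and chain: "\<And>c c'. c \<in> C \<Longrightarrow> c' \<in> C \<Longrightarrow> ?P c c' \<or> ?P c' c"
      unfolding Chains_def relation_of_def by blast+
    show "\<exists>v \<in> M. \<forall>c \<in> C. ?P c v"
    proof (cases "C = {}")
      case True
      have "y \<in> M" using assms by (simp add: M_def)
      then show ?thesis using True by blast
    next
      case False
      let ?D = "\<lambda>c. M \<inter> {v \<in> topspace cube. \<forall>\<alpha> \<in> A. v \<alpha> \<le> c \<alpha>}"
      have "\<Inter> (?D ` C) \<noteq> {}"
      proof (rule compact_space_fip[THEN iffD1, rule_format, OF compact_cube], intro conjI ballI allI impI)
        fix K assume "K \<in> ?D ` C"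
        then show "closedin cube K"
          by (auto intro!: closedin_Int closed_M closedin_Collect_ball closedin_Collect_le[OF continuous_map_coordinate cont])
      next
        fix \<F> assume "finite \<F> \<and> \<F> \<subseteq> ?D ` C"
        then obtain C' where C': "C' \<subseteq> C" "finite C'" "\<F> = ?D ` C'"
          using finite_subset_image[of \<F> ?D C] by blast
        show "\<Inter>\<F> \<noteq> {}"
        proof (cases "C' = {}")
          case True
          then show ?thesis using C'(3) by simp
        next
          case False
          from C'(2) False C'(1) have "\<exists>m \<in> C'. \<forall>c \<in> C'. ?P c m"
          proof (induction rule: finite_ne_induct)
            case (insert c F)
            then obtain m where m: "m \<in> F" "\<forall>c \<in> F. ?P c m" by auto
            from insert.prems m have "?P c m \<or> ?P m c" using chain[of c m] by auto
            then show ?case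
            proof
              assume "?P c m"
              then show ?thesis using m by (intro bexI[of _ m]) auto
            next
              assume "?P m c"
              then have "\<forall>d \<in> insert c F. ?P d c" using m(2) by (auto intro: order_trans)
              then show ?thesis by blast
            qed
          qed auto
          then obtain m where m: "m \<in> C'" "\<forall>c \<in> C'. ?P c m" by blast
          then have "m \<in> M" using C' CM by blast
          then have "m \<in> \<Inter>\<F>" using m unfolding C'(3) M_def by auto
          then show ?thesis by blast
        qed
      qed
      then obtain v where v: "\<And>c. c \<in> C \<Longrightarrow> v \<in> ?D c" by blast
      then have "v \<in> M" using False by blast
      then show ?thesis using v by (intro bexI[of _ v]) auto
    qed
  qed
  then obtain m where m: "m \<in> M" and min: "\<And>v. v \<in> M \<Longrightarrow> ?P m v \<Longrightarrow> v = m" by blast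
  have mc: "m \<in> topspace cube" "precedes u m" "\<And>\<alpha>. \<alpha> \<in> A \<Longrightarrow> m \<alpha> \<le> y \<alpha>"
    using m by (auto simp: M_def)
  obtain z where z: "z \<in> topspace cube" "precedes u z" "precedes z m"
    by (rule precedes_interpolation[OF u mc(1,2)])
  have zm: "?P m z" using precedes_imp_le[OF z(3)] by blast
  moreover have "z \<in> M" unfolding M_def using z zm mc(3) by (auto intro: order_trans)
  ultimately have "z = m" by (rule min[rotated])
  then have "precedes m m" using z by simp
  then have "m \<in> homs" using mc(1) by (intro precedes_refl_imp_hom)
  then show thesis using that precedes_imp_le[OF mc(2)] mc(3) by blast
qed

text \<open>If \<open>x\<close> precedes \<open>y\<close>, then a homomorphism \<open>v\<close> in between gives \<open>x \<alpha> \<le> v \<alpha> \<le> v \<beta> \<le> y \<beta>\<close>. So the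
  relation is fine enough for the two-sided Stone--Weierstrass theorem, applied to the pairs of
  functions with comparable classes; the operation that it provides takes the first members of such
  pairs to something above \<open>\<alpha>\<close> and the second members to something below \<open>\<beta>\<close>.\<close>

theorem homs_separate:
  assumes \<alpha>\<beta>: "\<alpha> \<in> A" "\<beta> \<in> A" and le: "\<And>\<phi>. \<phi> \<in> homs \<Longrightarrow> \<phi> \<alpha> \<le> \<phi> \<beta>"
  shows "below \<alpha> \<beta>"
proof -
  define P where "P = {(f, g). \<exists>\<gamma> \<delta>. rep f \<gamma> \<and> rep g \<delta> \<and> below \<gamma> \<delta>}"
  obtain G p where G: "G \<in> clone" and p: "\<And>i :: nat. p i \<in> P"
    and lower: "\<And>x. x \<in> topspace cube \<Longrightarrow> x \<alpha> \<le> G (\<lambda>i. fst (p i) x)"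
    and upper: "\<And>x. x \<in> topspace cube \<Longrightarrow> G (\<lambda>i. snd (p i) x) \<le> x \<beta>"
  proof (rule two_sided_Stone_Weierstrass[OF compact_cube, of "\<lambda>x. x \<alpha>" "\<lambda>x. x \<beta>" P])
    show "\<exists>p \<in> P. snd p y < fst p x"
      if xy: "x \<in> topspace cube" "y \<in> topspace cube" "y \<beta> < x \<alpha>" for x y
    proof -
      have "\<not> precedes x y"
      proof
        assume "precedes x y"
        then obtain v where "v \<in> homs" "x \<alpha> \<le> v \<alpha>" "v \<beta> \<le> y \<beta>"
          using precedes_through_hom[OF xy(1,2)] \<alpha>\<beta> by metis
        then show False using le[of v] xy(3) by simp
      qed
      then show ?thesis unfolding precedes_def P_def by (fastforce simp: not_le)
    qed
    show "P \<noteq> {}" unfolding P_def using rep_coordinate[OF \<alpha>\<beta>(1)] below_refl[OF \<alpha>\<beta>(1)] by blast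
    show "continuous_map cube euclideanreal (fst p)" "continuous_map cube euclideanreal (snd p)"
      if "p \<in> P" for p
      using that unfolding P_def by (auto dest: rep_continuous)
    show "continuous_map cube euclideanreal (\<lambda>x. x \<alpha>)" "continuous_map cube euclideanreal (\<lambda>x. x \<beta>)"
      using \<alpha>\<beta> by (auto intro: continuous_map_coordinate)
    show "x \<alpha> \<in> {0..1}" "x \<beta> \<in> {0..1}" if "x \<in> topspace cube" for x
      using cube_range[OF that] \<alpha>\<beta> by blast+
  qed (rule that)
  have "\<forall>i. \<exists>\<gamma> \<delta>. rep (fst (p i)) \<gamma> \<and> rep (snd (p i)) \<delta> \<and> below \<gamma> \<delta>"
    using p unfolding P_def by (auto simp: split_beta)
  then obtain \<gamma> \<delta> where \<gamma>: "\<And>i. rep (fst (p i)) (\<gamma> i)" and \<delta>: "\<And>i. rep (snd (p i)) (\<delta> i)"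
    and \<gamma>\<delta>: "\<And>i. below (\<gamma> i) (\<delta> i)" by metis
  have "below \<alpha> (oper G \<gamma>)"
    using lower by (rule below_if_pointwise[OF rep_coordinate[OF \<alpha>\<beta>(1)] rep_oper[OF G \<gamma>]])
  moreover have "below (oper G \<gamma>) (oper G \<delta>)"
    by (intro oper_mono G \<gamma>\<delta> rep_in_carrier[OF \<gamma>] rep_in_carrier[OF \<delta>])
  moreover have "below (oper G \<delta>) \<beta>"
    using upper by (rule below_if_pointwise[OF rep_oper[OF G \<delta>] rep_coordinate[OF \<alpha>\<beta>(2)]])
  moreover have "oper G \<gamma> \<in> A" "oper G \<delta> \<in> A"
    using rep_in_carrier[OF rep_oper[OF G \<gamma>]] rep_in_carrier[OF rep_oper[OF G \<delta>]] .
  ultimately show ?thesis using \<alpha>\<beta> by (meson below_trans)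
qed

lemma homs_eqI:
  assumes "\<alpha> \<in> A" "\<beta> \<in> A" "\<And>\<phi>. \<phi> \<in> homs \<Longrightarrow> \<phi> \<alpha> = \<phi> \<beta>" shows "\<alpha> = \<beta>"
proof (rule below_antisym[OF assms(1,2)])
  show "below \<alpha> \<beta>"
    by (rule homs_separate[OF assms(1,2) eq_refl[OF assms(3)]])
  show "below \<beta> \<alpha>"
    by (rule homs_separate[OF assms(2,1) eq_refl[OF assms(3)[symmetric]]])
qed

lemma closedin_homs: "closedin cube homs"
proof -
  let ?I = "{(g, a). g \<in> clone \<and> (\<forall>i :: nat. a i \<in> A)}"
  have cont: "continuous_map cube euclideanreal (\<lambda>x. x (oper g a))"
    "continuous_map cube euclideanreal (\<lambda>x. g (\<lambda>i. x (a i)))" if "(g, a) \<in> ?I" for g a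
    using that oper_closed by (blast intro: continuous_map_coordinate, blast intro: continuous_map_clone[OF _ continuous_map_coordinate])
  have "closedin cube ({x \<in> topspace cube. \<forall>(g, a) \<in> ?I. x (oper g a) \<le> g (\<lambda>i. x (a i))} \<inter>
      {x \<in> topspace cube. \<forall>(g, a) \<in> ?I. g (\<lambda>i. x (a i)) \<le> x (oper g a)})"
    using cont by (intro closedin_Int closedin_Collect_ball; clarify) (rule closedin_Collect_le; blast)+
  moreover have "homs = {x \<in> topspace cube. \<forall>(g, a) \<in> ?I. x (oper g a) \<le> g (\<lambda>i. x (a i))} \<inter>
      {x \<in> topspace cube. \<forall>(g, a) \<in> ?I. g (\<lambda>i. x (a i)) \<le> x (oper g a)}"
    unfolding homs_def topspace_cube by (auto simp: order_eq_iff)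
  ultimately show ?thesis by simp
qed

lemma compact_homs: "compact_space (subtopology cube homs)"
  using closedin_compact_space[OF compact_cube closedin_homs] by (rule compact_space_subtopology)

text \<open>The order of the space of homomorphisms is induced by the evaluations, so Stone--Weierstrass
  expresses \<open>f\<close> as an operation \<open>G\<close> applied to evaluations at elements \<open>a i\<close>. On homomorphisms this
  is the evaluation at \<open>oper G a\<close>.\<close>

theorem monotone_functions_on_homs_are_evaluations:
  assumes f: "continuous_map (subtopology cube homs) euclideanreal f" "\<And>\<phi>. \<phi> \<in> homs \<Longrightarrow> f \<phi> \<in> {0..1}"
    and mono: "\<And>\<phi> \<psi>. \<phi> \<in> homs \<Longrightarrow> \<psi> \<in> homs \<Longrightarrow> (\<And>\<alpha>. \<alpha> \<in> A \<Longrightarrow> \<phi> \<alpha> \<le> \<psi> \<alpha>) \<Longrightarrow> f \<phi> \<le> f \<psi>"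
  obtains \<alpha> where "\<alpha> \<in> A" "\<And>\<phi>. \<phi> \<in> homs \<Longrightarrow> f \<phi> = \<phi> \<alpha>"
proof -
  have top: "topspace (subtopology cube homs) = homs"
    using homs_cube by auto
  let ?ev = "\<lambda>\<alpha> \<phi> :: 'a \<Rightarrow> real. \<phi> \<alpha>"
  obtain G p where G: "G \<in> clone" and p: "\<And>i :: nat. p i \<in> (\<lambda>\<alpha>. (?ev \<alpha>, ?ev \<alpha>)) ` A"
    and lower: "\<And>\<phi>. \<phi> \<in> homs \<Longrightarrow> f \<phi> \<le> G (\<lambda>i. fst (p i) \<phi>)"
    and upper: "\<And>\<phi>. \<phi> \<in> homs \<Longrightarrow> G (\<lambda>i. snd (p i) \<phi>) \<le> f \<phi>"
  proof (rule two_sided_Stone_Weierstrass[OF compact_homs, of f f "(\<lambda>\<alpha>. (?ev \<alpha>, ?ev \<alpha>)) ` A", unfolded top])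
    show "\<exists>p \<in> (\<lambda>\<alpha>. (?ev \<alpha>, ?ev \<alpha>)) ` A. snd p \<psi> < fst p \<phi>"
      if less: "\<phi> \<in> homs" "\<psi> \<in> homs" "f \<psi> < f \<phi>" for \<phi> \<psi>
    proof -
      obtain \<alpha> where "\<alpha> \<in> A" "\<psi> \<alpha> < \<phi> \<alpha>"
        using mono[OF less(1,2)] less(3) by (meson not_le)
      then show ?thesis by (intro bexI[OF _ imageI]) auto
    qed
  qed (use f nonempty in \<open>auto intro!: continuous_map_from_subtopology continuous_map_coordinate\<close>)
  have "\<forall>i. \<exists>\<alpha>. \<alpha> \<in> A \<and> p i = (?ev \<alpha>, ?ev \<alpha>)" using p by blast
  then obtain a where a: "\<And>i. a i \<in> A" and pa: "\<And>i. p i = (?ev (a i), ?ev (a i))" by metis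
  show thesis
  proof (rule that[OF oper_closed[OF G a]])
    fix \<phi> assume \<phi>: "\<phi> \<in> homs"
    show "f \<phi> = \<phi> (oper G a)"
      using lower[OF \<phi>] upper[OF \<phi>] homs_oper[OF \<phi> G a] by (simp add: pa)
  qed
qed

end

section \<open>Encoding the clone and its algebras in the universe\<close>

lemma lesspoll_iff_ordLess: "A \<prec> B \<longleftrightarrow> ordLess2 (card_of A) (card_of B)"
proof -
  have "A \<lesssim> B \<longleftrightarrow> ordLeq2 (card_of A) (card_of B)"
    by (simp add: lepoll_def card_of_ordLeq)
  then show ?thesis
    unfolding lesspoll_def eqpoll_iff_card_of_ordIso
    using not_ordLess_ordIso ordLeq_iff_ordLess_or_ordIso by blast
qed

context
  assumes universe: "is_universe TYPE('u)"
begin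

lemma infinite_universe: "infinite (UNIV :: 'u set)"
proof -
  have "(UNIV :: nat set) \<lesssim> (UNIV :: 'u set)"
    using universe unfolding is_universe_def by (blast intro: lesspoll_imp_lepoll)
  then show ?thesis
    by (simp add: infinite_le_lepoll)
qed

lemma Pow_lesspoll_universe:
  assumes "A \<prec> (UNIV :: 'u set)" shows "Pow A \<prec> (UNIV :: 'u set)"
proof -
  obtain f :: "'a \<Rightarrow> 'u" where f: "inj_on f A"
    using lesspoll_imp_lepoll[OF assms] unfolding lepoll_def by blast
  have "small (f ` A)"
    unfolding small_def using inj_on_image_eqpoll_self[OF f] assms by (rule eq_lesspoll_trans)
  then have "Pow (f ` A) \<prec> (UNIV :: 'u set)"
    using universe unfolding is_universe_def by blast
  moreover have "Pow A \<lesssim> Pow (f ` A)"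
    unfolding lepoll_def using inj_on_image_Pow[OF f] by (intro exI[of _ "image f"]) auto
  ultimately show ?thesis by (blast intro: lesspoll_trans1)
qed

text \<open>The pair \<open>(a, b)\<close> is coded by the two-element set \<open>{Inl a, Inr b}\<close>, so that products reduce to sums
  and power sets.\<close>

lemma Times_lesspoll_universe:
  assumes "A \<prec> (UNIV :: 'u set)" "B \<prec> (UNIV :: 'u set)" shows "A \<times> B \<prec> (UNIV :: 'u set)"
proof -
  have "A <+> B \<prec> (UNIV :: 'u set)"
    using assms infinite_universe by (simp add: lesspoll_iff_ordLess card_of_Plus_ordLess_infinite)
  then have "Pow (A <+> B) \<prec> (UNIV :: 'u set)"
    by (rule Pow_lesspoll_universe)
  moreover have "A \<times> B \<lesssim> Pow (A <+> B)"
    unfolding lepoll_def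
    by (rule exI[of _ "\<lambda>(a, b). {Inl a, Inr b}"]) (auto simp: inj_on_def doubleton_eq_iff)
  ultimately show ?thesis by (blast intro: lesspoll_trans1)
qed

lemma PiE_lesspoll_universe:
  assumes "A \<prec> (UNIV :: 'u set)" "B \<prec> (UNIV :: 'u set)" shows "(A \<rightarrow>\<^sub>E B) \<prec> (UNIV :: 'u set)"
proof -
  have "inj_on (\<lambda>f. (\<lambda>x. (x, f x)) ` A) (A \<rightarrow>\<^sub>E B)"
  proof (rule inj_onI)
    fix f g assume "f \<in> A \<rightarrow>\<^sub>E B" "g \<in> A \<rightarrow>\<^sub>E B" and eq: "(\<lambda>x. (x, f x)) ` A = (\<lambda>x. (x, g x)) ` A"
    moreover have "f x = g x" if "x \<in> A" for x
    proof -
      have "(x, f x) \<in> (\<lambda>x. (x, g x)) ` A" using that unfolding eq[symmetric] by (rule imageI)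
      then show ?thesis by blast
    qed
    ultimately show "f = g" by (intro PiE_ext) auto
  qed
  then have "(A \<rightarrow>\<^sub>E B) \<lesssim> Pow (A \<times> B)"
    unfolding lepoll_def by (intro exI[of _ "\<lambda>f. (\<lambda>x. (x, f x)) ` A"]) auto
  then show ?thesis
    using Pow_lesspoll_universe[OF Times_lesspoll_universe[OF assms]] by (rule lesspoll_trans1)
qed

lemma nat_lesspoll_universe: "(UNIV :: nat set) \<prec> (UNIV :: 'u set)"
  using universe unfolding is_universe_def by blast

lemma real_lesspoll_universe: "(UNIV :: real set) \<prec> (UNIV :: 'u set)"
proof -
  let ?cut = "\<lambda>x :: real. to_nat ` {q :: rat. of_rat q < x}"
  have "inj ?cut"
  proof (rule injI)
    fix x y :: real assume "?cut x = ?cut y"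
    then have eq: "{q :: rat. of_rat q < x} = {q. of_rat q < y}"
      by (metis inj_image_eq_iff inj_to_nat)
    show "x = y"
    proof (rule ccontr)
      assume "x \<noteq> y"
      then consider "x < y" | "y < x" by linarith
      then obtain q :: rat where "min x y < of_rat q" "of_rat q < max x y"
        using of_rat_dense[of x y] of_rat_dense[of y x] by cases auto
      moreover have "of_rat q < x \<longleftrightarrow> of_rat q < y"
        using eq by blast
      ultimately show False by linarith
    qed
  qed
  then have "(UNIV :: real set) \<lesssim> Pow (UNIV :: nat set)"
    unfolding lepoll_def by blast
  then show ?thesis
    using Pow_lesspoll_universe[OF nat_lesspoll_universe] by (rule lesspoll_trans1)
qed

lemma subset_lesspoll_universe: "A \<subseteq> B \<Longrightarrow> B \<prec> (UNIV :: 'u set) \<Longrightarrow> A \<prec> (UNIV :: 'u set)"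
  by (meson lesspoll_trans1 subset_imp_lepoll)

lemma clone_lesspoll_universe: "clone \<prec> (UNIV :: 'u set)"
proof (rule subset_lesspoll_universe)
  have "((UNIV :: nat set) \<rightarrow>\<^sub>E (UNIV :: real set)) \<prec> (UNIV :: 'u set)"
    by (rule PiE_lesspoll_universe[OF nat_lesspoll_universe real_lesspoll_universe])
  then have "(UNIV :: (nat \<Rightarrow> real) set) \<prec> (UNIV :: 'u set)"
    by (simp add: PiE_UNIV_domain)
  then have "((UNIV :: (nat \<Rightarrow> real) set) \<rightarrow>\<^sub>E (UNIV :: real set)) \<prec> (UNIV :: 'u set)"
    by (rule PiE_lesspoll_universe[OF _ real_lesspoll_universe])
  then show "(UNIV :: ((nat \<Rightarrow> real) \<Rightarrow> real) set) \<prec> (UNIV :: 'u set)"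
    by (simp add: PiE_UNIV_domain)
qed simp

end

text \<open>An unspecified injective coding of \<open>A\<close> by elements of a small subset of the universe, provided that
  there is one.\<close>

definition encode :: "'b set \<Rightarrow> 'b \<Rightarrow> 'u" where
  "encode A = (SOME c. inj_on c A \<and> small (c ` A))"

definition enc :: "'u set \<Rightarrow> ('u \<Rightarrow> real) \<Rightarrow> 'u" where
  "enc S = encode (S \<rightarrow>\<^sub>E {0..1})"

definition dec :: "'u set \<Rightarrow> 'u \<Rightarrow> 'u \<Rightarrow> real" where
  "dec S = inv_into (S \<rightarrow>\<^sub>E {0..1}) (enc S)"

context
  assumes universe: "is_universe TYPE('u)"
begin

lemma encode:
  assumes "A \<prec> (UNIV :: 'u set)"
  shows "inj_on (encode A :: 'b \<Rightarrow> 'u) A" "small (encode A ` A :: 'u set)"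
proof -
  obtain c :: "'b \<Rightarrow> 'u" where c: "inj_on c A"
    using lesspoll_imp_lepoll[OF assms] unfolding lepoll_def by blast
  moreover have "small (c ` A)"
    unfolding small_def using inj_on_image_eqpoll_self[OF c] assms by (rule eq_lesspoll_trans)
  ultimately have "inj_on (encode A :: 'b \<Rightarrow> 'u) A \<and> small (encode A ` A :: 'u set)"
    using someI[of "\<lambda>c :: 'b \<Rightarrow> 'u. inj_on c A \<and> small (c ` A)" c] unfolding encode_def by blast
  then show "inj_on (encode A :: 'b \<Rightarrow> 'u) A" "small (encode A ` A :: 'u set)" by auto
qed

lemma unit_functions_lesspoll:
  "small (S :: 'u set) \<Longrightarrow> (S \<rightarrow>\<^sub>E {0..1 :: real}) \<prec> (UNIV :: 'u set)"
  unfolding small_def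
  by (intro PiE_lesspoll_universe[OF universe] subset_lesspoll_universe[OF universe subset_UNIV real_lesspoll_universe[OF universe]])

lemma dec_enc: "small (S :: 'u set) \<Longrightarrow> f \<in> S \<rightarrow>\<^sub>E {0..1} \<Longrightarrow> dec S (enc S f) = f"
  unfolding dec_def enc_def by (rule inv_into_f_f[OF encode(1)[OF unit_functions_lesspoll]])

lemma small_enc_image:
  assumes "small (S :: 'u set)" "F \<subseteq> S \<rightarrow>\<^sub>E {0..1}" shows "small (enc S ` F)"
proof -
  have "enc S ` F \<lesssim> enc S ` (S \<rightarrow>\<^sub>E {0..1})"
    by (intro subset_imp_lepoll image_mono assms)
  then show ?thesis
    using encode(2)[OF unit_functions_lesspoll[OF assms(1)]]
    unfolding small_def enc_def by (rule lesspoll_trans1)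
qed

lemma inj_on_op_symbol: "inj_on (encode clone :: _ \<Rightarrow> 'u) clone"
  and small_symbols: "small (encode clone ` clone :: 'u set)"
  using encode[OF clone_lesspoll_universe[OF universe]] by auto

end

definition op_symbol :: "((nat \<Rightarrow> real) \<Rightarrow> real) \<Rightarrow> 'u" where
  "op_symbol = encode clone"

definition op_of :: "'u \<Rightarrow> (nat \<Rightarrow> real) \<Rightarrow> real" where
  "op_of = inv_into clone op_symbol"

text \<open>Every operation has arity \<open>\<infinity>\<close>, except that the constant \<open>0\<close> is a nullary symbol. Without a nullary
  symbol the empty algebra would be a model. It is not a function algebra, as even the function
  algebra of the empty space has an element.\<close>

definition clone_signature :: "'u signature" where
  "clone_signature = \<lparr>symbols = op_symbol ` clone, arity = (\<lambda>s. if s = op_symbol (\<lambda>_. 0) then 0 else \<infinity>)\<rparr>"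

text \<open>Evaluation in \<open>[0,1]\<close>. Passing arguments at positions that a nullary symbol does not have is
  harmless, because the operation \<open>0\<close> ignores its arguments.\<close>

primrec real_eval :: "(nat \<Rightarrow> real) \<Rightarrow> 'u trm \<Rightarrow> real" where
  "real_eval v (Var n) = v n"
| "real_eval v (App s ts) = op_of s (\<lambda>i. real_eval v (ts i))"

definition clone_equations :: "('u trm \<times> 'u trm) set" where
  "clone_equations = {(s, t) \<in> terms clone_signature \<times> terms clone_signature.
     \<forall>v \<in> UNIV \<rightarrow> {0..1}. real_eval v s = real_eval v t}"

text \<open>Operations act on total sequences, of which the nullary symbol reads nothing. This gives all
  symbols a uniform treatment.\<close>

definition alg_op :: "'u algebra \<Rightarrow> ((nat \<Rightarrow> real) \<Rightarrow> real) \<Rightarrow> (nat \<Rightarrow> 'u) \<Rightarrow> 'u" where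
  "alg_op M g a = interp M (op_symbol g) (\<lambda>i \<in> positions clone_signature (op_symbol g :: 'u). a i)"

abbreviation clone_variety :: "('u algebra, 'u \<Rightarrow> 'u) category" where
  "clone_variety \<equiv> model_category clone_signature clone_equations"

lemma eval_App_op_symbol: "eval clone_signature M v (App (op_symbol g) ts) = alg_op M g (\<lambda>i. eval clone_signature M v (ts i))"
  by (simp add: alg_op_def)

lemma zero_clone: "(\<lambda>_. 0) \<in> clone"
  by (rule clone_const) simp

lemma op_symbol_in_symbols: "g \<in> clone \<Longrightarrow> (op_symbol g :: 'u) \<in> symbols clone_signature"
  by (simp add: clone_signature_def)

lemma symbols_cases:
  assumes "s \<in> symbols (clone_signature :: 'u signature)" obtains g where "g \<in> clone" "s = op_symbol g"
  using assms by (auto simp: clone_signature_def)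

lemma App_op_symbol_terms: "g \<in> clone \<Longrightarrow> (\<And>i. ts i \<in> terms clone_signature) \<Longrightarrow>
    App (op_symbol g :: 'u) ts \<in> terms clone_signature"
  by (rule terms.App) (auto intro: op_symbol_in_symbols)

lemma Var_terms: "Var n \<in> terms (clone_signature :: 'u signature)"
  by (rule terms.Var)

lemma interp_in_carrier:
  assumes M: "is_algebra clone_signature (M :: 'u algebra)" and "s \<in> symbols clone_signature"
    and "t \<in> tuples clone_signature M s"
  shows "interp M s t \<in> alg_carrier M"
  using assms unfolding is_algebra_def by (auto dest!: PiE_mem)

lemma alg_op_closed:
  assumes M: "is_algebra clone_signature (M :: 'u algebra)" and g: "g \<in> clone"
    and a: "\<And>i. a i \<in> alg_carrier M"
  shows "alg_op M g a \<in> alg_carrier M"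
  unfolding alg_op_def
  by (rule interp_in_carrier[OF M op_symbol_in_symbols[OF g]]) (use a in \<open>auto simp: tuples_def\<close>)

context
  assumes universe: "is_universe TYPE('u)"
begin

lemma op_of_op_symbol: "g \<in> clone \<Longrightarrow> op_of (op_symbol g :: 'u) = g"
  unfolding op_of_def op_symbol_def by (rule inv_into_f_f[OF inj_on_op_symbol[OF universe]])

lemma op_symbol_eq_iff: "g \<in> clone \<Longrightarrow> h \<in> clone \<Longrightarrow> (op_symbol g :: 'u) = op_symbol h \<longleftrightarrow> g = h"
  unfolding op_symbol_def using inj_on_op_symbol[OF universe] by (meson inj_on_eq_iff)

lemma positions_op_symbol:
  "g \<in> clone \<Longrightarrow> positions clone_signature (op_symbol g :: 'u) = (if g = (\<lambda>_. 0) then {} else UNIV)"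
  by (auto simp: positions_def clone_signature_def op_symbol_eq_iff[OF _ zero_clone] zero_enat_def)

lemma carrier_nonempty:
  assumes M: "is_algebra clone_signature (M :: 'u algebra)" shows "alg_carrier M \<noteq> {}"
proof -
  have "interp M (op_symbol (\<lambda>_. 0)) (\<lambda>_. undefined) \<in> alg_carrier M"
    by (rule interp_in_carrier[OF M op_symbol_in_symbols[OF zero_clone]])
      (auto simp: tuples_def positions_op_symbol[OF zero_clone])
  then show ?thesis by blast
qed

lemma model_satisfies:
  assumes M: "M \<in> Ob (clone_variety :: ('u algebra, 'u \<Rightarrow> 'u) category)"
    and "s \<in> terms clone_signature" "t \<in> terms clone_signature"
    and "\<And>v. (\<And>i. v i \<in> {0..1}) \<Longrightarrow> real_eval v s = real_eval v t"
    and a: "\<And>i. a i \<in> alg_carrier M"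
  shows "eval clone_signature M a s = eval clone_signature M a t"
proof -
  have "(s, t) \<in> clone_equations"
    unfolding clone_equations_def using assms(2-4) by (auto simp: Pi_iff)
  then have "satisfies clone_signature M (s, t)"
    using M by (simp add: model_category_def)
  then show ?thesis
    unfolding satisfies_def using a by auto
qed

lemma model_is_clone_algebra:
  assumes M: "M \<in> Ob (clone_variety :: ('u algebra, 'u \<Rightarrow> 'u) category)"
  shows "clone_algebra (alg_carrier M) (alg_op M)"
proof
  have alg: "is_algebra clone_signature M" using M by (simp add: model_category_def)
  show "alg_carrier M \<noteq> {}" by (rule carrier_nonempty[OF alg])
  show "alg_op M g a \<in> alg_carrier M" if "g \<in> clone" "\<And>i. a i \<in> alg_carrier M" for g a
    by (rule alg_op_closed[OF alg that])
  show "alg_op M (\<lambda>v. unit_clamp (v 0)) a = a 0" if a: "\<And>i. a i \<in> alg_carrier M" for a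
  proof -
    have "eval clone_signature M a (App (op_symbol (\<lambda>v. unit_clamp (v 0))) Var) = eval clone_signature M a (Var 0)"
      by (rule model_satisfies[OF M _ _ _ a])
        (auto intro!: App_op_symbol_terms Var_terms clone_proj simp: op_of_op_symbol[OF clone_proj])
    then show ?thesis by (simp add: eval_App_op_symbol del: eval.simps(2))
  qed
  show "alg_op M g (\<lambda>i. alg_op M (h i) (\<lambda>j. a (prod_encode (i, j)))) =
      alg_op M (\<lambda>v. g (\<lambda>i. h i (\<lambda>j. v (prod_encode (i, j))))) a"
    if g: "g \<in> clone" and h: "\<And>i. h i \<in> clone" and a: "\<And>i. a i \<in> alg_carrier M" for g h a
  proof -
    let ?s = "App (op_symbol g :: 'u) (\<lambda>i. App (op_symbol (h i)) (\<lambda>j. Var (prod_encode (i, j))))"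
    let ?t = "App (op_symbol (\<lambda>v. g (\<lambda>i. h i (\<lambda>j. v (prod_encode (i, j))))) :: 'u) Var"
    have gh: "(\<lambda>v. g (\<lambda>i. h i (\<lambda>j. v (prod_encode (i, j))))) \<in> clone"
      by (rule clone_comp[OF g h])
    have "eval clone_signature M a ?s = eval clone_signature M a ?t"
    proof (rule model_satisfies[OF M _ _ _ a])
      show "?s \<in> terms clone_signature"
        by (intro App_op_symbol_terms g h Var_terms)
      show "?t \<in> terms clone_signature"
        by (rule App_op_symbol_terms[OF gh Var_terms])
      show "real_eval v ?s = real_eval v ?t" for v
        by (simp only: real_eval.simps op_of_op_symbol[OF g] op_of_op_symbol[OF h] op_of_op_symbol[OF gh])
    qed
    then show ?thesis by (simp add: eval_App_op_symbol del: eval.simps(2))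
  qed
  show "alg_op M g (\<lambda>i. a (\<sigma> i)) = alg_op M k (\<lambda>i. a (\<tau> i))"
    if g: "g \<in> clone" and k: "k \<in> clone" and a: "\<And>i. a i \<in> alg_carrier M"
      and eq: "\<And>v. (\<And>i. v i \<in> {0..1}) \<Longrightarrow> g (\<lambda>i. v (\<sigma> i)) = k (\<lambda>i. v (\<tau> i))" for g k and a :: "nat \<Rightarrow> 'u" and \<sigma> \<tau>
  proof -
    have "eval clone_signature M a (App (op_symbol g) (\<lambda>i. Var (\<sigma> i))) =
        eval clone_signature M a (App (op_symbol k) (\<lambda>i. Var (\<tau> i)))"
      by (rule model_satisfies[OF M _ _ _ a])
        (auto intro!: App_op_symbol_terms g k Var_terms eq simp: op_of_op_symbol g k)
    then show ?thesis by (simp add: eval_App_op_symbol del: eval.simps(2))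
  qed
qed

lemma homomorphisms_iff:
  assumes M: "is_algebra clone_signature (M :: 'u algebra)"
  shows "h \<in> homomorphisms clone_signature M N \<longleftrightarrow> h \<in> alg_carrier M \<rightarrow>\<^sub>E alg_carrier N \<and>
    (\<forall>g \<in> clone. \<forall>a. (\<forall>i. a i \<in> alg_carrier M) \<longrightarrow> h (alg_op M g a) = alg_op N g (\<lambda>i. h (a i)))"
    (is "_ \<longleftrightarrow> ?R")
proof
  assume h: "h \<in> homomorphisms clone_signature M N"
  have "h (alg_op M g a) = alg_op N g (\<lambda>i. h (a i))"
    if g: "g \<in> clone" and a: "\<forall>i. a i \<in> alg_carrier M" for g a
  proof -
    have "restrict a (positions clone_signature (op_symbol g :: 'u)) \<in> tuples clone_signature M (op_symbol g)"
      using a by (auto simp: tuples_def)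
    then have "h (alg_op M g a) = interp N (op_symbol g) (\<lambda>i \<in> positions clone_signature (op_symbol g :: 'u).
        h (restrict a (positions clone_signature (op_symbol g :: 'u)) i))"
      unfolding alg_op_def using h op_symbol_in_symbols[OF g] unfolding homomorphisms_def by blast
    also have "\<dots> = alg_op N g (\<lambda>i. h (a i))"
      unfolding alg_op_def by (rule arg_cong[where f = "interp N (op_symbol g)"]) auto
    finally show ?thesis .
  qed
  then show ?R using h unfolding homomorphisms_def by blast
next
  assume R: ?R
  obtain z where z: "z \<in> alg_carrier M" using carrier_nonempty[OF M] by blast
  have "h (interp M s t) = interp N s (\<lambda>i \<in> positions clone_signature s. h (t i))"
    if s: "s \<in> symbols clone_signature" and t: "t \<in> tuples clone_signature M s" for s t
  proof -
    obtain g where g: "g \<in> clone" "s = op_symbol g" using s by (rule symbols_cases)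
    define a where "a i = (if i \<in> positions clone_signature s then t i else z)" for i
    have "a i \<in> alg_carrier M" for i using t z unfolding a_def tuples_def by auto
    moreover have "restrict a (positions clone_signature s) = t"
      using t unfolding tuples_def a_def by (auto simp: restrict_def PiE_def extensional_def)
    moreover have "(\<lambda>i \<in> positions clone_signature s. h (a i)) = (\<lambda>i \<in> positions clone_signature s. h (t i))"
      by (auto simp: a_def)
    ultimately show ?thesis
      using R g unfolding alg_op_def by metis
  qed
  then show "h \<in> homomorphisms clone_signature M N"
    using R unfolding homomorphisms_def by blast
qed

end

section \<open>The algebra of monotone functions\<close>

abbreviation points :: "'a ordered_space \<Rightarrow> 'a set" where
  "points X \<equiv> topspace (space_top X)"

definition monotone_functions :: "'a ordered_space \<Rightarrow> ('a \<Rightarrow> real) set" where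
  "monotone_functions X = {f \<in> points X \<rightarrow>\<^sub>E {0..1}.
     continuous_map (space_top X) euclideanreal f \<and> (\<forall>(x, y) \<in> space_le X. f x \<le> f y)}"

lemma monotone_functionsD:
  assumes "f \<in> monotone_functions X"
  shows "f \<in> points X \<rightarrow>\<^sub>E {0..1}" "continuous_map (space_top X) euclideanreal f"
    "\<And>x y. (x, y) \<in> space_le X \<Longrightarrow> f x \<le> f y" "\<And>x. x \<in> points X \<Longrightarrow> f x \<in> {0..1}"
  using assms unfolding monotone_functions_def by (auto dest: PiE_mem)

lemma monotone_functionsI:
  assumes X: "compact_ordered_space X" and "continuous_map (space_top X) euclideanreal f"
    "\<And>x y. (x, y) \<in> space_le X \<Longrightarrow> f x \<le> f y" "\<And>x. x \<in> points X \<Longrightarrow> f x \<in> {0..1}"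
  shows "restrict f (points X) \<in> monotone_functions X"
  unfolding monotone_functions_def
proof (intro CollectI conjI)
  show "restrict f (points X) \<in> points X \<rightarrow>\<^sub>E {0..1}" using assms(4) by auto
  show "continuous_map (space_top X) euclideanreal (restrict f (points X))"
    by (rule continuous_map_eq[OF assms(2)]) simp
  show "\<forall>(x, y) \<in> space_le X. restrict f (points X) x \<le> restrict f (points X) y"
    using assms(3) compact_ordered_spaceD(6,7)[OF X] by auto
qed

lemma monotone_functions_op:
  assumes X: "compact_ordered_space X" and g: "g \<in> clone" and a: "\<And>i. a i \<in> monotone_functions X"
  shows "(\<lambda>x \<in> points X. g (\<lambda>i. a i x)) \<in> monotone_functions X"
  using a by (intro monotone_functionsI[OF X] continuous_map_clone[OF g] clone_mono[OF g] clone_range[OF g])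
    (auto dest: monotone_functionsD)

lemma monotone_functions_separate:
  assumes X: "compact_ordered_space X" and xy: "x \<in> points X" "y \<in> points X" "(x, y) \<notin> space_le X"
  obtains f where "f \<in> monotone_functions X" "f y < f x"
proof -
  obtain f :: "'a \<Rightarrow> real" where "continuous_map (space_top X) euclideanreal f" "\<And>z. f z \<in> {0..1}"
    "\<And>u v. (u, v) \<in> space_le X \<Longrightarrow> f u \<le> f v" and f: "f y < f x"
    by (rule Nachbin_separation[OF X xy]) blast
  then have "restrict f (points X) \<in> monotone_functions X"
    by (intro monotone_functionsI[OF X]) auto
  then show thesis using that[of "restrict f (points X)"] f xy by simp
qed

lemma monotone_functions_eqI:
  assumes X: "compact_ordered_space X" and xy: "x \<in> points X" "y \<in> points X"
    and "\<And>f. f \<in> monotone_functions X \<Longrightarrow> f x = f y"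
  shows "x = y"
proof -
  have "(x, y) \<in> space_le X" "(y, x) \<in> space_le X"
    using monotone_functions_separate[OF X] xy assms(4) by (metis less_irrefl)+
  then show ?thesis by (rule compact_ordered_spaceD(5)[OF X])
qed

text \<open>If \<open>\<phi>\<close> is not the evaluation at \<open>z\<close>, some function \<open>f\<close> has \<open>f z < \<phi> f\<close> or \<open>\<phi> f < f z\<close>. A ramp turns it
  into a function that vanishes near \<open>z\<close> and has \<open>\<phi>\<close>-value \<open>1\<close>, or is \<open>1\<close> near \<open>z\<close> and has \<open>\<phi>\<close>-value \<open>0\<close>. If
  this happens at all points, the cover lemma gives \<open>f \<le> g\<close> with \<open>\<phi> f = 1\<close> and \<open>\<phi> g = 0\<close>, although
  \<open>f = min f g\<close>.\<close>

theorem functional_is_evaluation: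
  assumes X: "compact_ordered_space X"
    and \<phi>: "\<And>g a. g \<in> clone \<Longrightarrow> (\<And>i. a i \<in> monotone_functions X) \<Longrightarrow>
      \<phi> (\<lambda>x \<in> points X. g (\<lambda>i. a i x)) = g (\<lambda>i. \<phi> (a i))"
  obtains x where "x \<in> points X" "\<And>f. f \<in> monotone_functions X \<Longrightarrow> \<phi> f = f x"
proof (rule ccontr)
  let ?T = "space_top X"
  assume "\<not> thesis"
  then have no: "\<And>x. x \<in> points X \<Longrightarrow> \<exists>f \<in> monotone_functions X. \<phi> f \<noteq> f x"
    using that by blast
  let ?C = "monotone_functions X"
  let ?pair = "\<lambda>f g i. if i = (0::nat) then f else (g :: 'a \<Rightarrow> real)"
  have unary: "restrict (\<lambda>x. h (f x)) (points X) \<in> ?C" "\<phi> (restrict (\<lambda>x. h (f x)) (points X)) = h (\<phi> f)"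
    if "(\<lambda>v. h (v 0)) \<in> clone" "f \<in> ?C" for h f
    using monotone_functions_op[OF X that(1), of "\<lambda>_. f"] \<phi>[OF that(1), of "\<lambda>_. f"] that(2) by auto
  have binary: "restrict (\<lambda>x. h (f x) (g x)) (points X) \<in> ?C"
    "\<phi> (restrict (\<lambda>x. h (f x) (g x)) (points X)) = h (\<phi> f) (\<phi> g)"
    if "(\<lambda>v. h (v 0) (v 1)) \<in> clone" "f \<in> ?C" "g \<in> ?C" for h f g
    using monotone_functions_op[OF X that(1), of "?pair f g"] \<phi>[OF that(1), of "?pair f g"] that(2,3) by auto
  have const: "restrict (\<lambda>x. c) (points X) \<in> ?C" "\<phi> (restrict (\<lambda>x. c) (points X)) = c" if "c \<in> {0..1}" for c
  proof -
    have mem: "restrict (\<lambda>x. c) (points X) \<in> ?C"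
      using that by (intro monotone_functionsI[OF X]) auto
    then show "restrict (\<lambda>x. c) (points X) \<in> ?C" .
    show "\<phi> (restrict (\<lambda>x. c) (points X)) = c"
      using \<phi>[OF clone_const[OF that], of "\<lambda>_. restrict (\<lambda>x. c) (points X)"] mem by simp
  qed
  obtain f g where f: "f \<in> {f \<in> ?C. \<phi> f = 1}" and g: "g \<in> {f \<in> ?C. \<phi> f = 0}"
    and fg: "\<And>x. x \<in> points X \<Longrightarrow> f x \<le> g x"
  proof (rule ordered_pair_from_cover[OF compact_ordered_spaceD(1)[OF X], of "{f \<in> ?C. \<phi> f = 1}" "{f \<in> ?C. \<phi> f = 0}"])
    show "{f \<in> ?C. \<phi> f = 1} \<noteq> {}" "{f \<in> ?C. \<phi> f = 0} \<noteq> {}"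
      using const[of 1] const[of 0] by auto
    show "f x \<le> 1" if "f \<in> {f \<in> ?C. \<phi> f = 1}" "x \<in> points X" for f x
      using that monotone_functionsD(4)[of f X x] by auto
    show "0 \<le> f x" if "f \<in> {f \<in> ?C. \<phi> f = 0}" "x \<in> points X" for f x
      using that monotone_functionsD(4)[of f X x] by auto
    show "\<exists>h \<in> {f \<in> ?C. \<phi> f = 1}. \<forall>z \<in> points X. h z \<le> min (f z) (g z)"
      if fg: "f \<in> {f \<in> ?C. \<phi> f = 1}" "g \<in> {f \<in> ?C. \<phi> f = 1}" for f g
    proof (rule bexI)
      let ?h = "restrict (\<lambda>x. unit_clamp (min (f x) (g x))) (points X)"
      show "?h \<in> {f \<in> ?C. \<phi> f = 1}"
        using binary[of "\<lambda>s t. unit_clamp (min s t)" f g, OF clone_min] fg by simp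
      show "\<forall>z \<in> points X. ?h z \<le> min (f z) (g z)"
        using fg monotone_functionsD(4)[of f X] monotone_functionsD(4)[of g X] by (auto simp: unit_clamp_def)
    qed
    show "\<exists>h \<in> {f \<in> ?C. \<phi> f = 0}. \<forall>z \<in> points X. max (f z) (g z) \<le> h z"
      if fg: "f \<in> {f \<in> ?C. \<phi> f = 0}" "g \<in> {f \<in> ?C. \<phi> f = 0}" for f g
    proof (rule bexI)
      let ?h = "restrict (\<lambda>x. unit_clamp (max (f x) (g x))) (points X)"
      show "?h \<in> {f \<in> ?C. \<phi> f = 0}"
        using binary[of "\<lambda>s t. unit_clamp (max s t)" f g, OF clone_max] fg by simp
      show "\<forall>z \<in> points X. max (f z) (g z) \<le> ?h z"
        using fg monotone_functionsD(4)[of f X] monotone_functionsD(4)[of g X] by (auto simp: unit_clamp_def)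
    qed
    fix z assume z: "z \<in> points X"
    obtain f where f: "f \<in> ?C" "\<phi> f \<noteq> f z" using no[OF z] by blast
    have ramp: "restrict (\<lambda>x. ramp p q (f x)) (points X) \<in> ?C"
      "\<phi> (restrict (\<lambda>x. ramp p q (f x)) (points X)) = ramp p q (\<phi> f)" if "p < q" for p q
      using unary[of "ramp p q" f, OF clone_ramp[OF that] f(1)] .
    from f(2) consider "f z < \<phi> f" | "\<phi> f < f z" by linarith
    then show "\<exists>W. openin ?T W \<and> z \<in> W \<and> ((\<exists>f \<in> {f \<in> ?C. \<phi> f = 1}. \<forall>w \<in> W. f w \<le> 0) \<or>
        (\<exists>g \<in> {f \<in> ?C. \<phi> f = 0}. \<forall>w \<in> W. 1 \<le> g w))"
    proof cases
      case 1
      obtain p where p: "f z < p" "p < \<phi> f" using dense[OF 1] by blast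
      let ?W = "{w \<in> points X. f w \<in> {..<p}}"
      have "openin ?T ?W"
        by (rule openin_continuous_map_preimage[OF monotone_functionsD(2)[OF f(1)]]) simp
      moreover have "restrict (\<lambda>x. ramp p (\<phi> f) (f x)) (points X) \<in> {f \<in> ?C. \<phi> f = 1}"
        using ramp[OF p(2)] ramp_eq_1[OF p(2)] by simp
      moreover have "\<forall>w \<in> ?W. restrict (\<lambda>x. ramp p (\<phi> f) (f x)) (points X) w \<le> 0"
        using ramp_eq_0[OF p(2)] by auto
      ultimately show ?thesis using z p(1) by blast
    next
      case 2
      obtain q where q: "\<phi> f < q" "q < f z" using dense[OF 2] by blast
      let ?W = "{w \<in> points X. f w \<in> {q<..}}"
      have "openin ?T ?W"
        by (rule openin_continuous_map_preimage[OF monotone_functionsD(2)[OF f(1)]]) simp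
      moreover have "restrict (\<lambda>x. ramp (\<phi> f) q (f x)) (points X) \<in> {f \<in> ?C. \<phi> f = 0}"
        using ramp[OF q(1)] ramp_eq_0[OF q(1)] by simp
      moreover have "\<forall>w \<in> ?W. 1 \<le> restrict (\<lambda>x. ramp (\<phi> f) q (f x)) (points X) w"
        using ramp_eq_1[OF q(1)] by auto
      ultimately show ?thesis using z q(2) by blast
    qed
  qed (rule that)
  have "restrict (\<lambda>x. unit_clamp (min (f x) (g x))) (points X) = f"
  proof (rule extensionalityI)
    show "f \<in> extensional (points X)" using f monotone_functionsD(1)[of f X] by (auto simp: PiE_def)
    show "restrict (\<lambda>x. unit_clamp (min (f x) (g x))) (points X) x = f x" if "x \<in> points X" for x
      using that fg[OF that] f monotone_functionsD(4)[of f X x] by (auto simp: min_def)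
  qed simp
  then have "\<phi> f = unit_clamp (min (\<phi> f) (\<phi> g))"
    using binary(2)[of "\<lambda>s t. unit_clamp (min s t)" f g, OF clone_min] f g by simp
  then show False using f g by (simp add: unit_clamp_def)
qed

definition function_algebra :: "'u ordered_space \<Rightarrow> 'u algebra" where
  "function_algebra X = \<lparr>alg_carrier = enc (points X) ` monotone_functions X,
     interp = (\<lambda>s \<in> symbols clone_signature.
       \<lambda>t \<in> positions clone_signature s \<rightarrow>\<^sub>E enc (points X) ` monotone_functions X.
         enc (points X) (\<lambda>x \<in> points X. op_of s (\<lambda>i. dec (points X) (t i) x)))\<rparr>"

definition precomposition :: "'u ordered_space \<Rightarrow> 'u ordered_space \<Rightarrow> ('u \<Rightarrow> 'u) \<Rightarrow> 'u \<Rightarrow> 'u" where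
  "precomposition X Y k = (\<lambda>t \<in> alg_carrier (function_algebra Y).
     enc (points X) (\<lambda>x \<in> points X. dec (points Y) t (k x)))"

lemma KH_le_simps [simp]:
  "X \<in> Ob KH_le \<longleftrightarrow> compact_ordered_space X \<and> small (points X)"
  "Hom KH_le = continuous_monotone_maps"
  "category.Id KH_le X = (\<lambda>x \<in> points X. x)"
  "Comp KH_le X Y Z g f = compose (points X) g f"
  by (simp_all add: KH_le_def)

lemma continuous_monotone_mapsD:
  assumes "k \<in> continuous_monotone_maps X Y"
  shows "k \<in> extensional (points X)" "continuous_map (space_top X) (space_top Y) k"
    "\<And>x y. (x, y) \<in> space_le X \<Longrightarrow> (k x, k y) \<in> space_le Y" "\<And>x. x \<in> points X \<Longrightarrow> k x \<in> points Y"
  using assms continuous_map_image_subset_topspace unfolding continuous_monotone_maps_def by fastforce+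

lemma monotone_functions_compose:
  assumes X: "compact_ordered_space X" and k: "k \<in> continuous_monotone_maps X Y"
    and f: "f \<in> monotone_functions Y"
  shows "(\<lambda>x \<in> points X. f (k x)) \<in> monotone_functions X"
proof (rule monotone_functionsI[OF X])
  show "continuous_map (space_top X) euclideanreal (\<lambda>x. f (k x))"
    using continuous_map_compose[OF continuous_monotone_mapsD(2)[OF k] monotone_functionsD(2)[OF f]]
    by (simp add: o_def)
qed (use continuous_monotone_mapsD[OF k] monotone_functionsD[OF f] in auto)

context
  assumes universe: "is_universe TYPE('u)"
begin

context
  fixes X :: "'u ordered_space"
  assumes X: "compact_ordered_space X" and small_X: "small (points X)"
begin

lemma function_algebra_carrier: "alg_carrier (function_algebra X) = enc (points X) ` monotone_functions X"
  by (simp add: function_algebra_def)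

lemma dec_enc_function: "f \<in> monotone_functions X \<Longrightarrow> dec (points X) (enc (points X) f) = f"
  by (rule dec_enc[OF universe small_X monotone_functionsD(1)])

lemma dec_in_monotone_functions:
  "t \<in> alg_carrier (function_algebra X) \<Longrightarrow> dec (points X) t \<in> monotone_functions X"
  by (auto simp: function_algebra_carrier dec_enc_function)

lemma enc_dec: "t \<in> alg_carrier (function_algebra X) \<Longrightarrow> enc (points X) (dec (points X) t) = t"
  by (auto simp: function_algebra_carrier dec_enc_function)

lemma alg_op_function_algebra:
  assumes g: "g \<in> clone" and a: "\<And>i. a i \<in> alg_carrier (function_algebra X)"
  shows "alg_op (function_algebra X) g a = enc (points X) (\<lambda>x \<in> points X. g (\<lambda>i. dec (points X) (a i) x))"
proof -
  have "(\<lambda>i \<in> positions clone_signature (op_symbol g :: 'u). a i) \<in>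
      positions clone_signature (op_symbol g :: 'u) \<rightarrow>\<^sub>E enc (points X) ` monotone_functions X"
    using a by (auto simp: function_algebra_carrier)
  then show ?thesis
    by (simp add: op_symbol_in_symbols[OF g] alg_op_def function_algebra_def op_of_op_symbol[OF universe g] positions_op_symbol[OF universe g])
qed

lemma is_algebra_function_algebra: "is_algebra clone_signature (function_algebra X)"
  unfolding is_algebra_def tuples_def function_algebra_carrier
proof (subst function_algebra_def, simp only: algebra.simps, intro restrict_PiE_iff[THEN iffD2] ballI)
  fix s :: 'u and t :: "nat \<Rightarrow> 'u"
  assume s: "s \<in> symbols clone_signature"
    and t: "t \<in> positions clone_signature s \<rightarrow>\<^sub>E enc (points X) ` monotone_functions X"
  obtain g where g: "g \<in> clone" "s = op_symbol g" using s by (rule symbols_cases)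
  show "enc (points X) (\<lambda>x \<in> points X. op_of s (\<lambda>i. dec (points X) (t i) x)) \<in> enc (points X) ` monotone_functions X"
  proof (cases "g = (\<lambda>_. 0)")
    case True
    then have "(\<lambda>x \<in> points X. op_of s (\<lambda>i. dec (points X) (t i) x)) = (\<lambda>x \<in> points X. 0)"
      using g by (simp add: op_of_op_symbol[OF universe zero_clone])
    moreover have "(\<lambda>x \<in> points X. 0) \<in> monotone_functions X"
      by (rule monotone_functionsI[OF X]) auto
    ultimately show ?thesis by simp
  next
    case False
    then have "t i \<in> alg_carrier (function_algebra X)" for i
      using t g by (auto simp: positions_op_symbol[OF universe g(1)] function_algebra_carrier)
    then have "(\<lambda>x \<in> points X. g (\<lambda>i. dec (points X) (t i) x)) \<in> monotone_functions X"
      by (intro monotone_functions_op[OF X g(1)] dec_in_monotone_functions)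
    then show ?thesis by (simp add: g(2) op_of_op_symbol[OF universe g(1)])
  qed
qed

lemma eval_function_algebra:
  assumes v: "\<And>n. v n \<in> alg_carrier (function_algebra X)" and "t \<in> terms clone_signature"
  shows "eval clone_signature (function_algebra X) v t \<in> alg_carrier (function_algebra X) \<and>
    dec (points X) (eval clone_signature (function_algebra X) v t) =
      (\<lambda>x \<in> points X. real_eval (\<lambda>n. dec (points X) (v n) x) t)"
  using assms(2)
proof induction
  case (Var n)
  have "dec (points X) (v n) \<in> extensional (points X)"
    using dec_in_monotone_functions[OF v] monotone_functionsD(1) by (fastforce simp: PiE_def)
  then show ?case using v by (simp add: extensional_restrict)
next
  case (App s ts)
  let ?e = "\<lambda>i. eval clone_signature (function_algebra X) v (ts i)"
  obtain g where g: "g \<in> clone" "s = op_symbol g" using App.hyps(1) by (rule symbols_cases)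
  have eq: "eval clone_signature (function_algebra X) v (App s ts) = alg_op (function_algebra X) g ?e"
    unfolding g(2) by (rule eval_App_op_symbol)
  show ?case
  proof (cases "g = (\<lambda>_. 0)")
    case True
    have "alg_op (function_algebra X) g ?e = alg_op (function_algebra X) g v"
      by (simp add: alg_op_def True positions_op_symbol[OF universe zero_clone] restrict_def)
    also have "\<dots> = enc (points X) (\<lambda>x \<in> points X. 0)"
      by (subst alg_op_function_algebra[OF g(1) v]) (simp add: True)
    finally have "alg_op (function_algebra X) g ?e = enc (points X) (\<lambda>x \<in> points X. 0)" .
    moreover have "(\<lambda>x \<in> points X. 0) \<in> monotone_functions X"
      by (rule monotone_functionsI[OF X]) auto
    moreover have "real_eval w (App s ts) = 0" for w
      by (simp add: g(2) op_of_op_symbol[OF universe g(1)]) (simp add: True)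
    ultimately show ?thesis
      unfolding eq by (simp add: dec_enc_function function_algebra_carrier del: real_eval.simps)
  next
    case False
    then have pos: "positions clone_signature s = UNIV"
      by (simp add: g(2) positions_op_symbol[OF universe g(1)])
    have e: "?e i \<in> alg_carrier (function_algebra X)"
      "dec (points X) (?e i) = (\<lambda>x \<in> points X. real_eval (\<lambda>n. dec (points X) (v n) x) (ts i))" for i
      using App.IH[of i] pos by auto
    have mem: "(\<lambda>x \<in> points X. g (\<lambda>i. dec (points X) (?e i) x)) \<in> monotone_functions X"
      by (intro monotone_functions_op[OF X g(1)] dec_in_monotone_functions e)
    have "(\<lambda>x \<in> points X. g (\<lambda>i. dec (points X) (?e i) x)) =
        (\<lambda>x \<in> points X. real_eval (\<lambda>n. dec (points X) (v n) x) (App s ts))"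
      by (rule restrict_ext) (simp add: e(2) g(2) op_of_op_symbol[OF universe g(1)])
    then show ?thesis
      unfolding eq alg_op_function_algebra[OF g(1) e(1)]
      using mem dec_enc_function[OF mem] by (simp add: function_algebra_carrier)
  qed
qed

lemma function_algebra_in_variety: "function_algebra X \<in> Ob clone_variety"
proof -
  have "small (alg_carrier (function_algebra X))"
    unfolding function_algebra_carrier
    by (rule small_enc_image[OF universe small_X]) (auto dest: monotone_functionsD(1))
  moreover have "satisfies clone_signature (function_algebra X) e" if e: "e \<in> clone_equations" for e
    unfolding satisfies_def
  proof
    fix v :: "nat \<Rightarrow> 'u" assume "v \<in> UNIV \<rightarrow> alg_carrier (function_algebra X)"
    then have v: "\<And>n. v n \<in> alg_carrier (function_algebra X)" by auto
    obtain s t where st: "e = (s, t)" "s \<in> terms clone_signature" "t \<in> terms clone_signature"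
      and eq: "\<forall>v \<in> UNIV \<rightarrow> {0..1}. real_eval v s = real_eval v t"
      using e unfolding clone_equations_def by auto
    let ?es = "eval clone_signature (function_algebra X) v s"
    let ?et = "eval clone_signature (function_algebra X) v t"
    (* Terms are evaluated pointwise, and at each point the equation is valid in the unit interval. *)
    have "dec (points X) ?es = dec (points X) ?et"
      unfolding conjunct2[OF eval_function_algebra[OF v st(2)]] conjunct2[OF eval_function_algebra[OF v st(3)]]
    proof (rule restrict_ext)
      fix x assume "x \<in> points X"
      then show "real_eval (\<lambda>n. dec (points X) (v n) x) s = real_eval (\<lambda>n. dec (points X) (v n) x) t"
        using monotone_functionsD(4)[OF dec_in_monotone_functions[OF v]] by (intro eq[rule_format]) blast
    qed
    then have "enc (points X) (dec (points X) ?es) = enc (points X) (dec (points X) ?et)"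
      by (rule arg_cong)
    then have "?es = ?et"
      by (simp only: enc_dec[OF conjunct1[OF eval_function_algebra[OF v st(2)]]]
        enc_dec[OF conjunct1[OF eval_function_algebra[OF v st(3)]]])
    then show "eval clone_signature (function_algebra X) v (fst e) = eval clone_signature (function_algebra X) v (snd e)"
      using st by simp
  qed
  ultimately show ?thesis
    using is_algebra_function_algebra by (simp add: model_category_def)
qed

end

end

section \<open>The duality\<close>

text \<open>The functions in \<open>F\<close> describe the graph of \<open>k\<close> as a closed set, and projection along a compact
  factor is a closed map, so preimages of closed sets under \<open>k\<close> are closed.\<close>

lemma continuous_map_into_separated:
  fixes F :: "('b \<Rightarrow> real) set"
  assumes Y: "compact_space TY" and k: "\<And>x. x \<in> topspace TX \<Longrightarrow> k x \<in> topspace TY"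
    and F: "\<And>f. f \<in> F \<Longrightarrow> continuous_map TY euclideanreal f"
      "\<And>f. f \<in> F \<Longrightarrow> continuous_map TX euclideanreal (\<lambda>x. f (k x))"
    and sep: "\<And>y y'. y \<in> topspace TY \<Longrightarrow> y' \<in> topspace TY \<Longrightarrow> (\<And>f. f \<in> F \<Longrightarrow> f y = f y') \<Longrightarrow> y = y'"
  shows "continuous_map TX TY k"
  unfolding continuous_map_closedin
proof (intro conjI allI impI)
  show "k \<in> topspace TX \<rightarrow> topspace TY" using k by auto
  fix C assume C: "closedin TY C"
  let ?P = "prod_topology TX TY"
  have c1: "continuous_map ?P euclideanreal (\<lambda>z. f (k (fst z)))"
    and c2: "continuous_map ?P euclideanreal (\<lambda>z. f (snd z))" if "f \<in> F" for f
    using continuous_map_compose[OF continuous_map_fst F(2)[OF that]]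
      continuous_map_compose[OF continuous_map_snd F(1)[OF that]] by (auto simp: o_def)
  let ?G = "{z \<in> topspace ?P. \<forall>f \<in> F. f (k (fst z)) \<le> f (snd z)} \<inter>
    {z \<in> topspace ?P. \<forall>f \<in> F. f (snd z) \<le> f (k (fst z))} \<inter> topspace TX \<times> C"
  have "closedin ?P ?G"
    using C by (intro closedin_Int closedin_Collect_ball closedin_Collect_le c1 c2)
      (auto simp: closedin_prod_Times_iff)
  then have "closedin TX (fst ` ?G)"
    using closed_map_fst[OF Y, of TX] by (simp add: closed_map_def)
  moreover have "fst ` ?G = {x \<in> topspace TX. k x \<in> C}"
  proof (intro equalityI subsetI)
    fix x assume "x \<in> fst ` ?G"
    then obtain y where y: "(x, y) \<in> ?G" by auto
    then have "k x = y"
      using closedin_subset[OF C] by (intro sep k) (auto intro: order.antisym)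
    then show "x \<in> {x \<in> topspace TX. k x \<in> C}" using y by auto
  next
    fix x assume "x \<in> {x \<in> topspace TX. k x \<in> C}"
    then have "(x, k x) \<in> ?G" using k by auto
    then show "x \<in> fst ` ?G" by force
  qed
  ultimately show "closedin TX {x \<in> topspace TX. k x \<in> C}" by simp
qed

lemma variety_simps [simp]:
  "Hom (opposite (model_category S E)) A B = homomorphisms S B A"
  "category.Id (opposite (model_category S E)) A = (\<lambda>a \<in> alg_carrier A. a)"
  "Comp (opposite (model_category S E)) A B C g f = compose (alg_carrier C) f g"
  "Ob (opposite (model_category S E)) = Ob (model_category S E)"
  by (simp_all add: opposite_def model_category_def)

context
  assumes universe: "is_universe TYPE('u)"
begin

lemma precomposition_apply:
  assumes X: "compact_ordered_space (X :: 'u ordered_space)" "small (points X)"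
    and Y: "compact_ordered_space (Y :: 'u ordered_space)" "small (points Y)"
    and k: "k \<in> continuous_monotone_maps X Y" and t: "t \<in> alg_carrier (function_algebra Y)"
  shows "precomposition X Y k t \<in> alg_carrier (function_algebra X)"
    and "dec (points X) (precomposition X Y k t) = (\<lambda>x \<in> points X. dec (points Y) t (k x))"
proof -
  have "(\<lambda>x \<in> points X. dec (points Y) t (k x)) \<in> monotone_functions X"
    by (intro monotone_functions_compose[OF X(1) k] dec_in_monotone_functions[OF universe Y t])
  then show "precomposition X Y k t \<in> alg_carrier (function_algebra X)"
    "dec (points X) (precomposition X Y k t) = (\<lambda>x \<in> points X. dec (points Y) t (k x))"
    using t by (auto simp: precomposition_def dec_enc_function[OF universe X] function_algebra_carrier[OF universe X])
qed

lemma function_algebra_eqI: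
  assumes X: "compact_ordered_space (X :: 'u ordered_space)" "small (points X)"
    and "s \<in> alg_carrier (function_algebra X)" "t \<in> alg_carrier (function_algebra X)"
    and "\<And>x. x \<in> points X \<Longrightarrow> dec (points X) s x = dec (points X) t x"
  shows "s = t"
proof -
  have "dec (points X) s \<in> points X \<rightarrow>\<^sub>E {0..1}" "dec (points X) t \<in> points X \<rightarrow>\<^sub>E {0..1}"
    by (intro monotone_functionsD(1) dec_in_monotone_functions[OF universe X] assms)+
  then have "dec (points X) s = dec (points X) t"
    using assms(5) by (rule PiE_ext)
  then have "enc (points X) (dec (points X) s) = enc (points X) (dec (points X) t)"
    by (rule arg_cong)
  then show ?thesis
    by (simp only: enc_dec[OF universe X assms(3)] enc_dec[OF universe X assms(4)])
qed

lemma alg_op_function_algebra_apply: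
  assumes X: "compact_ordered_space (X :: 'u ordered_space)" "small (points X)"
    and g: "g \<in> clone" and a: "\<And>i. a i \<in> alg_carrier (function_algebra X)"
  shows "alg_op (function_algebra X) g a \<in> alg_carrier (function_algebra X)"
    and "x \<in> points X \<Longrightarrow> dec (points X) (alg_op (function_algebra X) g a) x = g (\<lambda>i. dec (points X) (a i) x)"
proof -
  have "(\<lambda>x \<in> points X. g (\<lambda>i. dec (points X) (a i) x)) \<in> monotone_functions X"
    by (intro monotone_functions_op[OF X(1) g] dec_in_monotone_functions[OF universe X] a)
  then show "alg_op (function_algebra X) g a \<in> alg_carrier (function_algebra X)"
    "x \<in> points X \<Longrightarrow> dec (points X) (alg_op (function_algebra X) g a) x = g (\<lambda>i. dec (points X) (a i) x)"
    by (simp_all add: alg_op_function_algebra[OF universe X g a] function_algebra_carrier[OF universe X] dec_enc_function[OF universe X])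
qed

lemma precomposition_hom:
  assumes X: "compact_ordered_space (X :: 'u ordered_space)" "small (points X)"
    and Y: "compact_ordered_space (Y :: 'u ordered_space)" "small (points Y)"
    and k: "k \<in> continuous_monotone_maps X Y"
  shows "precomposition X Y k \<in> homomorphisms clone_signature (function_algebra Y) (function_algebra X)"
  unfolding homomorphisms_iff[OF universe is_algebra_function_algebra[OF universe Y]]
proof (intro conjI ballI allI impI)
  note pre = precomposition_apply[OF X Y k]
  show "precomposition X Y k \<in> alg_carrier (function_algebra Y) \<rightarrow>\<^sub>E alg_carrier (function_algebra X)"
    using pre(1) by (auto simp: precomposition_def)
  fix g and a :: "nat \<Rightarrow> 'u" assume g: "g \<in> clone" and "\<forall>i. a i \<in> alg_carrier (function_algebra Y)"
  then have a: "\<And>i. a i \<in> alg_carrier (function_algebra Y)" by blast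
  note opY = alg_op_function_algebra_apply[OF Y g a]
  note opX = alg_op_function_algebra_apply[OF X g pre(1)[OF a]]
  show "precomposition X Y k (alg_op (function_algebra Y) g a) =
      alg_op (function_algebra X) g (\<lambda>i. precomposition X Y k (a i))"
  proof (rule function_algebra_eqI[OF X pre(1)[OF opY(1)] opX(1)])
    fix x assume x: "x \<in> points X"
    then show "dec (points X) (precomposition X Y k (alg_op (function_algebra Y) g a)) x =
        dec (points X) (alg_op (function_algebra X) g (\<lambda>i. precomposition X Y k (a i))) x"
      by (simp add: opX(2) pre(2)[OF opY(1)] pre(2)[OF a] opY(2) continuous_monotone_mapsD(4)[OF k])
  qed
qed

lemma functor_function_algebra:
  "is_functor (KH_le :: ('u ordered_space, 'u \<Rightarrow> 'u) category) (opposite clone_variety)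
     function_algebra precomposition"
  unfolding is_functor_def variety_simps KH_le_simps
proof (intro conjI ballI; (elim conjE)?)
  fix X :: "'u ordered_space" assume obX: "X \<in> Ob KH_le"
  then have X: "compact_ordered_space X" "small (points X)" by auto
  show "function_algebra X \<in> Ob clone_variety"
    by (rule function_algebra_in_variety[OF universe X])
  have "dec (points X) t \<in> extensional (points X)" if "t \<in> alg_carrier (function_algebra X)" for t
    using monotone_functionsD(1)[OF dec_in_monotone_functions[OF universe X that]] by (simp add: PiE_def)
  then show "precomposition X X (\<lambda>x \<in> points X. x) = (\<lambda>a \<in> alg_carrier (function_algebra X). a)"
    unfolding precomposition_def
    by (intro restrict_ext) (simp add: enc_dec[OF universe X] extensional_restrict cong: restrict_cong)
  fix Y :: "'u ordered_space" assume obY: "Y \<in> Ob KH_le"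
  then have Y: "compact_ordered_space Y" "small (points Y)" by auto
  show "precomposition X Y k \<in> homomorphisms clone_signature (function_algebra Y) (function_algebra X)"
    if "k \<in> continuous_monotone_maps X Y" for k
    by (rule precomposition_hom[OF X Y that])
  fix Z :: "'u ordered_space" and k l assume obZ: "Z \<in> Ob KH_le"
  then have Z: "compact_ordered_space Z" "small (points Z)" by auto
  assume k: "k \<in> continuous_monotone_maps X Y" and l: "l \<in> continuous_monotone_maps Y Z"
  have kl: "compose (points X) l k \<in> continuous_monotone_maps X Z"
    using is_category_KH_le[where 'a = 'u] obX obY obZ k l
    unfolding is_category_def KH_le_simps(2-4) by blast
  show "precomposition X Z (compose (points X) l k) =
      compose (alg_carrier (function_algebra Z)) (precomposition X Y k) (precomposition Y Z l)"
  proof (rule extensionalityI)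
    show "precomposition X Z (compose (points X) l k) \<in> extensional (alg_carrier (function_algebra Z))"
      by (simp add: precomposition_def)
    show "compose (alg_carrier (function_algebra Z)) (precomposition X Y k) (precomposition Y Z l)
        \<in> extensional (alg_carrier (function_algebra Z))"
      by (rule compose_extensional)
    fix t assume t: "t \<in> alg_carrier (function_algebra Z)"
    note 1 = precomposition_apply[OF X Z kl t] and 2 = precomposition_apply[OF Y Z l t]
    note 3 = precomposition_apply[OF X Y k 2(1)]
    show "precomposition X Z (compose (points X) l k) t =
        compose (alg_carrier (function_algebra Z)) (precomposition X Y k) (precomposition Y Z l) t"
      unfolding compose_eq[OF t]
      by (rule function_algebra_eqI[OF X 1(1) 3(1)])
        (simp add: 1(2) 2(2) 3(2) compose_eq continuous_monotone_mapsD(4)[OF k])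
  qed
qed

lemma precomposition_faithful:
  assumes X: "compact_ordered_space (X :: 'u ordered_space)" "small (points X)"
    and Y: "compact_ordered_space (Y :: 'u ordered_space)" "small (points Y)"
    and k: "k \<in> continuous_monotone_maps X Y" and l: "l \<in> continuous_monotone_maps X Y"
    and eq: "precomposition X Y k = precomposition X Y l"
  shows "k = l"
proof (rule extensionalityI[OF continuous_monotone_mapsD(1)[OF k] continuous_monotone_mapsD(1)[OF l]])
  fix x assume x: "x \<in> points X"
  show "k x = l x"
  proof (rule monotone_functions_eqI[OF Y(1)])
    fix f assume f: "f \<in> monotone_functions Y"
    let ?t = "enc (points Y) f"
    have t: "?t \<in> alg_carrier (function_algebra Y)"
      using f by (simp add: function_algebra_carrier[OF universe Y])
    have "dec (points X) (precomposition X Y k ?t) x = dec (points X) (precomposition X Y l ?t) x"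
      by (simp add: eq)
    then show "f (k x) = f (l x)"
      using x by (simp add: precomposition_apply(2)[OF X Y k t] precomposition_apply(2)[OF X Y l t]
          dec_enc_function[OF universe Y f])
  qed (use x continuous_monotone_mapsD(4)[OF k] continuous_monotone_mapsD(4)[OF l] in auto)
qed

text \<open>For each point \<open>x\<close> of \<open>X\<close>, the map \<open>f \<mapsto> h f x\<close> is a homomorphism to \<open>[0,1]\<close>, hence the evaluation at some
  point of \<open>Y\<close>, which is taken as \<open>k x\<close>. Continuity and monotonicity of \<open>k\<close> follow from those of the
  functions \<open>h f\<close>, since continuous monotone functions determine both structures of \<open>Y\<close>.\<close>

lemma precomposition_full:
  assumes X: "compact_ordered_space (X :: 'u ordered_space)" "small (points X)"
    and Y: "compact_ordered_space (Y :: 'u ordered_space)" "small (points Y)"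
    and h: "h \<in> homomorphisms clone_signature (function_algebra Y) (function_algebra X)"
  obtains k where "k \<in> continuous_monotone_maps X Y" "precomposition X Y k = h"
proof -
  have h_ext: "h \<in> alg_carrier (function_algebra Y) \<rightarrow>\<^sub>E alg_carrier (function_algebra X)"
    and h_op: "\<And>g a. g \<in> clone \<Longrightarrow> (\<And>i. a i \<in> alg_carrier (function_algebra Y)) \<Longrightarrow>
      h (alg_op (function_algebra Y) g a) = alg_op (function_algebra X) g (\<lambda>i. h (a i))"
    using h unfolding homomorphisms_iff[OF universe is_algebra_function_algebra[OF universe Y]] by auto
  define H where "H f = dec (points X) (h (enc (points Y) f))" for f
  have encY: "enc (points Y) f \<in> alg_carrier (function_algebra Y)" if "f \<in> monotone_functions Y" for f
    using that by (simp add: function_algebra_carrier[OF universe Y])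
  have h_enc: "h (enc (points Y) f) \<in> alg_carrier (function_algebra X)" if "f \<in> monotone_functions Y" for f
    using h_ext encY[OF that] by (rule PiE_mem)
  have H_mem: "H f \<in> monotone_functions X" if "f \<in> monotone_functions Y" for f
    unfolding H_def by (intro dec_in_monotone_functions[OF universe X] h_enc that)
  have "\<exists>y. y \<in> points Y \<and> (\<forall>f \<in> monotone_functions Y. H f x = f y)" if x: "x \<in> points X" for x
  proof -
    obtain y where "y \<in> points Y" "\<And>f. f \<in> monotone_functions Y \<Longrightarrow> H f x = f y"
    proof (rule functional_is_evaluation[OF Y(1), of "\<lambda>f. H f x"])
      fix g and a :: "nat \<Rightarrow> 'u \<Rightarrow> real" assume g: "g \<in> clone" and a: "\<And>i. a i \<in> monotone_functions Y"
      have "alg_op (function_algebra Y) g (\<lambda>i. enc (points Y) (a i)) =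
          enc (points Y) (\<lambda>y \<in> points Y. g (\<lambda>i. a i y))"
        by (simp add: alg_op_function_algebra[OF universe Y g encY[OF a]] dec_enc_function[OF universe Y a])
      then have "H (\<lambda>y \<in> points Y. g (\<lambda>i. a i y)) =
          dec (points X) (alg_op (function_algebra X) g (\<lambda>i. h (enc (points Y) (a i))))"
        unfolding H_def using h_op[OF g, of "\<lambda>i. enc (points Y) (a i)", OF encY[OF a]] by simp
      then show "H (\<lambda>y \<in> points Y. g (\<lambda>i. a i y)) x = g (\<lambda>i. H (a i) x)"
        by (simp add: alg_op_function_algebra_apply(2)[OF X g h_enc[OF a] x] H_def)
    qed (rule that)
    then show ?thesis by blast
  qed
  then obtain k' where k': "\<And>x. x \<in> points X \<Longrightarrow> k' x \<in> points Y"
    "\<And>x f. x \<in> points X \<Longrightarrow> f \<in> monotone_functions Y \<Longrightarrow> H f x = f (k' x)"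
    by metis
  define k where "k = restrict k' (points X)"
  have k: "k x \<in> points Y" "\<And>f. f \<in> monotone_functions Y \<Longrightarrow> f (k x) = H f x" if "x \<in> points X" for x
    using k' that by (auto simp: k_def)
  have "continuous_map (space_top X) (space_top Y) k"
  proof (rule continuous_map_into_separated[OF compact_ordered_spaceD(1)[OF Y(1)] k(1), where F = "monotone_functions Y"])
    show "continuous_map (space_top X) euclideanreal (\<lambda>x. f (k x))" if "f \<in> monotone_functions Y" for f
      by (rule continuous_map_eq[OF monotone_functionsD(2)[OF H_mem[OF that]]]) (simp add: k(2) that)
    show "y = y'" if "y \<in> points Y" "y' \<in> points Y" "\<And>f. f \<in> monotone_functions Y \<Longrightarrow> f y = f y'" for y y'
      by (rule monotone_functions_eqI[OF Y(1) that])
  qed (auto dest: monotone_functionsD(2))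
  moreover have "(k x, k x') \<in> space_le Y" if xx: "(x, x') \<in> space_le X" for x x'
  proof (rule ccontr)
    have pts: "x \<in> points X" "x' \<in> points X"
      using compact_ordered_spaceD(6,7)[OF X(1) xx] by auto
    assume "(k x, k x') \<notin> space_le Y"
    then obtain f where f: "f \<in> monotone_functions Y" "f (k x') < f (k x)"
      using monotone_functions_separate[OF Y(1) k(1)[OF pts(1)] k(1)[OF pts(2)]] by blast
    then show False
      using monotone_functionsD(3)[OF H_mem[OF f(1)] xx] by (simp add: k(2) pts)
  qed
  moreover have "k \<in> extensional (points X)" by (simp add: k_def)
  ultimately have kk: "k \<in> continuous_monotone_maps X Y"
    unfolding continuous_monotone_maps_def by blast
  moreover have "precomposition X Y k = h"
  proof (rule extensionalityI)
    show "precomposition X Y k \<in> extensional (alg_carrier (function_algebra Y))"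
      by (simp add: precomposition_def)
    show "h \<in> extensional (alg_carrier (function_algebra Y))" using h_ext by (simp add: PiE_def)
    fix t assume t: "t \<in> alg_carrier (function_algebra Y)"
    note pre = precomposition_apply[OF X Y kk t]
    have f: "dec (points Y) t \<in> monotone_functions Y"
      by (rule dec_in_monotone_functions[OF universe Y t])
    show "precomposition X Y k t = h t"
    proof (rule function_algebra_eqI[OF X pre(1)])
      show "h t \<in> alg_carrier (function_algebra X)" using h_ext t by (rule PiE_mem)
      fix x assume x: "x \<in> points X"
      then show "dec (points X) (precomposition X Y k t) x = dec (points X) (h t) x"
        using k(2)[OF x f] by (simp add: pre(2) H_def enc_dec[OF universe Y t])
    qed
  qed
  ultimately show thesis by (rule that)
qed

lemma bijective_hom_is_iso:
  assumes M: "M \<in> Ob (clone_variety :: ('u algebra, 'u \<Rightarrow> 'u) category)"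
    and N: "N \<in> Ob (clone_variety :: ('u algebra, 'u \<Rightarrow> 'u) category)"
    and e: "e \<in> homomorphisms clone_signature M N" and bij: "bij_betw e (alg_carrier M) (alg_carrier N)"
  shows "is_iso (opposite clone_variety) N M e"
proof -
  have algM: "is_algebra clone_signature M" and algN: "is_algebra clone_signature N"
    using M N by (auto simp: model_category_def)
  have e_op: "e (alg_op M g a) = alg_op N g (\<lambda>i. e (a i))"
    if "g \<in> clone" "\<And>i. a i \<in> alg_carrier M" for g a
    using e that unfolding homomorphisms_iff[OF universe algM] by blast
  define d where "d = restrict (inv_into (alg_carrier M) e) (alg_carrier N)"
  have d_mem: "d b \<in> alg_carrier M" and ed: "e (d b) = b" if "b \<in> alg_carrier N" for b
    using that bij unfolding d_def by (auto simp: bij_betw_def inv_into_into f_inv_into_f)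
  have de: "d (e a) = a" if "a \<in> alg_carrier M" for a
    using that bij unfolding d_def by (auto simp: bij_betw_def)
  have e_mem: "e a \<in> alg_carrier N" if "a \<in> alg_carrier M" for a
    using that bij by (auto simp: bij_betw_def)
  have "d \<in> homomorphisms clone_signature N M"
    unfolding homomorphisms_iff[OF universe algN]
  proof (intro conjI ballI allI impI)
    show "d \<in> alg_carrier N \<rightarrow>\<^sub>E alg_carrier M" using d_mem by (auto simp: d_def)
    fix g and b :: "nat \<Rightarrow> 'u" assume g: "g \<in> clone" and "\<forall>i. b i \<in> alg_carrier N"
    then have b: "\<And>i. b i \<in> alg_carrier N" by blast
    have "alg_op N g b = e (alg_op M g (\<lambda>i. d (b i)))"
      by (simp add: e_op[OF g d_mem[OF b]] ed[OF b])
    then show "d (alg_op N g b) = alg_op M g (\<lambda>i. d (b i))"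
      using de[OF alg_op_closed[OF algM g d_mem[OF b]]] by simp
  qed
  moreover have "compose (alg_carrier N) e d = (\<lambda>b \<in> alg_carrier N. b)"
    unfolding compose_def by (rule restrict_ext) (rule ed)
  moreover have "compose (alg_carrier M) d e = (\<lambda>a \<in> alg_carrier M. a)"
    unfolding compose_def by (rule restrict_ext) (rule de)
  ultimately show ?thesis
    unfolding is_iso_def variety_simps using e by blast
qed

text \<open>The space is the set of homomorphisms to \<open>[0,1]\<close> with the topology and order of the cube,
  transported along the coding, and the isomorphism sends an element to its evaluation. Evaluations
  are injective since homomorphisms separate elements, and surjective by Stone--Weierstrass.\<close>

lemma every_model_is_a_function_algebra:
  assumes M: "M \<in> Ob (clone_variety :: ('u algebra, 'u \<Rightarrow> 'u) category)"
  obtains X :: "'u ordered_space" and e where "compact_ordered_space X" "small (points X)"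
    "is_iso (opposite clone_variety) (function_algebra X) M e"
proof -
  let ?A = "alg_carrier M"
  interpret clone_algebra ?A "alg_op M" by (rule model_is_clone_algebra[OF universe M])
  have alg: "is_algebra clone_signature M" and small_A: "small ?A"
    using M by (auto simp: model_category_def)
  let ?T = "subtopology cube homs"
  have homs_sub: "homs \<subseteq> ?A \<rightarrow>\<^sub>E {0..1}" unfolding homs_def by blast
  have topT: "topspace ?T = homs" using homs_cube by auto
  define P where "P = enc ?A ` homs"
  have dec_enc: "dec ?A (enc ?A \<phi>) = \<phi>" if "\<phi> \<in> homs" for \<phi>
    using homs_sub that by (intro dec_enc[OF universe small_A]) auto
  have dec_P: "dec ?A p \<in> homs" and enc_dec: "enc ?A (dec ?A p) = p" if "p \<in> P" for p
    using that unfolding P_def by (auto simp: dec_enc)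
  define X where "X = \<lparr>space_top = pullback_topology P (dec ?A) ?T,
    space_le = {(p, q) \<in> P \<times> P. \<forall>\<alpha> \<in> ?A. dec ?A p \<alpha> \<le> dec ?A q \<alpha>}\<rparr>"
  have points_X: "points X = P"
    using dec_P homs_cube by (auto simp: X_def topspace_pullback_topology)
  have small_X: "small (points X)"
    unfolding points_X P_def by (rule small_enc_image[OF universe small_A homs_sub])
  have cont_dec: "continuous_map (space_top X) ?T (dec ?A)"
    using continuous_map_pullback[OF continuous_map_id, of P "dec ?A" ?T] by (simp add: X_def)
  have cont_enc: "continuous_map ?T (space_top X) (enc ?A)"
    unfolding X_def ordered_space.simps
  proof (rule continuous_map_pullback')
    show "continuous_map ?T ?T (dec ?A \<circ> enc ?A)"
      by (rule continuous_map_eq[OF continuous_map_id]) (simp add: topT dec_enc)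
    show "topspace ?T \<subseteq> enc ?A -` P" unfolding topT P_def by blast
  qed
  have cont_ev: "continuous_map (space_top X) euclideanreal (\<lambda>p. dec ?A p \<alpha>)" if "\<alpha> \<in> ?A" for \<alpha>
    using continuous_map_compose[OF cont_dec continuous_map_from_subtopology[OF continuous_map_coordinate[OF that]]]
    by (simp add: o_def)
  have X: "compact_ordered_space X"
    unfolding compact_ordered_space_def
  proof (intro conjI)
    have "compactin (space_top X) (enc ?A ` topspace ?T)"
      using compact_homs cont_enc by (intro image_compactin) (auto simp: compact_space_def)
    then show "compact_space (space_top X)"
      unfolding topT P_def[symmetric] points_X[symmetric] by (simp add: compact_space_def)
    show "partial_order_on (points X) (space_le X)"
      unfolding points_X partial_order_on_def preorder_on_def
    proof (intro conjI)
      show "refl_on P (space_le X)" "space_le X \<subseteq> P \<times> P" by (auto simp: refl_on_def X_def)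
      show "trans (space_le X)" by (auto simp: trans_def X_def intro: order_trans)
      show "antisym (space_le X)"
      proof (rule antisymI)
        fix p q assume pq: "(p, q) \<in> space_le X" "(q, p) \<in> space_le X"
        then have P: "p \<in> P" "q \<in> P" by (auto simp: X_def)
        have "dec ?A p = dec ?A q"
          using pq by (intro cube_ext[OF homs_cube[OF dec_P[OF P(1)]] homs_cube[OF dec_P[OF P(2)]]])
            (auto simp: X_def intro: order.antisym)
        then have "enc ?A (dec ?A p) = enc ?A (dec ?A q)" by (rule arg_cong)
        then show "p = q" by (simp only: enc_dec[OF P(1)] enc_dec[OF P(2)])
      qed
    qed
    let ?P = "prod_topology (space_top X) (space_top X)"
    have "closedin ?P {z \<in> topspace ?P. \<forall>\<alpha> \<in> ?A. dec ?A (fst z) \<alpha> \<le> dec ?A (snd z) \<alpha>}"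
    proof (intro closedin_Collect_ball closedin_Collect_le)
      fix \<alpha> assume \<alpha>: "\<alpha> \<in> ?A"
      show "continuous_map ?P euclideanreal (\<lambda>z. dec ?A (fst z) \<alpha>)"
        using continuous_map_compose[OF continuous_map_fst cont_ev[OF \<alpha>]] by (simp add: o_def)
      show "continuous_map ?P euclideanreal (\<lambda>z. dec ?A (snd z) \<alpha>)"
        using continuous_map_compose[OF continuous_map_snd cont_ev[OF \<alpha>]] by (simp add: o_def)
    qed
    moreover have "{z \<in> topspace ?P. \<forall>\<alpha> \<in> ?A. dec ?A (fst z) \<alpha> \<le> dec ?A (snd z) \<alpha>} = space_le X"
      unfolding topspace_prod_topology points_X by (auto simp: X_def)
    ultimately show "closedin ?P (space_le X)" by simp
  qed
  define e where "e = (\<lambda>\<alpha> \<in> ?A. enc (points X) (\<lambda>p \<in> points X. dec ?A p \<alpha>))"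
  have ev: "(\<lambda>p \<in> points X. dec ?A p \<alpha>) \<in> monotone_functions X" if \<alpha>: "\<alpha> \<in> ?A" for \<alpha>
  proof (rule monotone_functionsI[OF X cont_ev[OF \<alpha>]])
    show "dec ?A p \<alpha> \<le> dec ?A q \<alpha>" if "(p, q) \<in> space_le X" for p q
      using that \<alpha> by (auto simp: X_def)
    show "dec ?A p \<alpha> \<in> {0..1}" if "p \<in> points X" for p
      using that by (intro cube_range homs_cube dec_P \<alpha>) (simp add: points_X)
  qed
  have e_mem: "e \<alpha> \<in> alg_carrier (function_algebra X)" if "\<alpha> \<in> ?A" for \<alpha>
    using ev[OF that] that by (simp add: e_def function_algebra_carrier[OF universe X small_X])
  have dec_e: "dec (points X) (e \<alpha>) p = dec ?A p \<alpha>" if "\<alpha> \<in> ?A" "p \<in> points X" for \<alpha> p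
    using that by (simp add: e_def dec_enc_function[OF universe X small_X ev])
  have hom: "e \<in> homomorphisms clone_signature M (function_algebra X)"
    unfolding homomorphisms_iff[OF universe alg]
  proof (intro conjI ballI allI impI)
    show "e \<in> ?A \<rightarrow>\<^sub>E alg_carrier (function_algebra X)" using e_mem by (auto simp: e_def)
    fix g and a :: "nat \<Rightarrow> 'u" assume g: "g \<in> clone" and "\<forall>i. a i \<in> ?A"
    then have a: "\<And>i. a i \<in> ?A" by blast
    note opX = alg_op_function_algebra_apply[OF X small_X g e_mem[OF a]]
    show "e (alg_op M g a) = alg_op (function_algebra X) g (\<lambda>i. e (a i))"
    proof (rule function_algebra_eqI[OF X small_X e_mem[OF oper_closed[OF g a]] opX(1)])
      fix p assume p: "p \<in> points X"
      show "dec (points X) (e (alg_op M g a)) p = dec (points X) (alg_op (function_algebra X) g (\<lambda>i. e (a i))) p"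
        unfolding opX(2)[OF p] dec_e[OF a p] dec_e[OF oper_closed[OF g a] p]
        using p by (intro homs_oper dec_P g a) (simp add: points_X)
    qed
  qed
  have "inj_on e ?A"
  proof (rule inj_onI)
    fix \<alpha> \<beta> assume \<alpha>\<beta>: "\<alpha> \<in> ?A" "\<beta> \<in> ?A" "e \<alpha> = e \<beta>"
    show "\<alpha> = \<beta>"
    proof (rule homs_eqI[OF \<alpha>\<beta>(1,2)])
      fix \<phi> assume \<phi>: "\<phi> \<in> homs"
      then have p: "enc ?A \<phi> \<in> points X" by (simp add: points_X P_def)
      show "\<phi> \<alpha> = \<phi> \<beta>"
        using dec_e[OF \<alpha>\<beta>(1) p] dec_e[OF \<alpha>\<beta>(2) p] \<alpha>\<beta>(3) by (simp add: dec_enc[OF \<phi>])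
    qed
  qed
  moreover have "t \<in> e ` ?A" if t: "t \<in> alg_carrier (function_algebra X)" for t
  proof -
    let ?f = "dec (points X) t"
    have f: "?f \<in> monotone_functions X" by (rule dec_in_monotone_functions[OF universe X small_X t])
    have enc_X: "enc ?A \<phi> \<in> points X" if "\<phi> \<in> homs" for \<phi>
      using that by (simp add: points_X P_def)
    obtain \<alpha> where \<alpha>: "\<alpha> \<in> ?A" and f\<alpha>: "\<And>\<phi>. \<phi> \<in> homs \<Longrightarrow> ?f (enc ?A \<phi>) = \<phi> \<alpha>"
    proof (rule monotone_functions_on_homs_are_evaluations[of "\<lambda>\<phi>. ?f (enc ?A \<phi>)"])
      show "continuous_map ?T euclideanreal (\<lambda>\<phi>. ?f (enc ?A \<phi>))"
        using continuous_map_compose[OF cont_enc monotone_functionsD(2)[OF f]] by (simp add: o_def)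
      show "?f (enc ?A \<phi>) \<in> {0..1}" if "\<phi> \<in> homs" for \<phi>
        by (rule monotone_functionsD(4)[OF f enc_X[OF that]])
      show "?f (enc ?A \<phi>) \<le> ?f (enc ?A \<psi>)"
        if "\<phi> \<in> homs" "\<psi> \<in> homs" "\<And>\<alpha>. \<alpha> \<in> ?A \<Longrightarrow> \<phi> \<alpha> \<le> \<psi> \<alpha>" for \<phi> \<psi>
        using that by (intro monotone_functionsD(3)[OF f]) (simp add: X_def P_def dec_enc)
    qed (rule that)
    have "e \<alpha> = t"
    proof (rule function_algebra_eqI[OF X small_X e_mem[OF \<alpha>] t])
      fix p assume p: "p \<in> points X"
      then have "p \<in> P" by (simp add: points_X)
      then show "dec (points X) (e \<alpha>) p = ?f p"
        using f\<alpha>[OF dec_P] by (simp add: dec_e[OF \<alpha> p] enc_dec)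
    qed
    then show ?thesis using \<alpha> by blast
  qed
  ultimately have "bij_betw e ?A (alg_carrier (function_algebra X))"
    using e_mem unfolding bij_betw_def by blast
  then have "is_iso (opposite clone_variety) (function_algebra X) M e"
    by (rule bijective_hom_is_iso[OF M function_algebra_in_variety[OF universe X small_X] hom])
  then show thesis by (rule that[OF X small_X])
qed

lemma variety_dually_equivalent:
  "dually_equivalent (KH_le :: ('u ordered_space, 'u \<Rightarrow> 'u) category)
     (clone_variety :: ('u algebra, 'u \<Rightarrow> 'u) category)"
  unfolding dually_equivalent_def
proof (rule equivalent_categories_if_fully_faithful)
  show "is_category (KH_le :: ('u ordered_space, 'u \<Rightarrow> 'u) category)"
    by (rule is_category_KH_le)
  show "is_category (opposite (clone_variety :: ('u algebra, 'u \<Rightarrow> 'u) category))"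
    by (intro is_category_opposite is_category_model_category)
  show "is_functor (KH_le :: ('u ordered_space, 'u \<Rightarrow> 'u) category) (opposite clone_variety)
      function_algebra precomposition"
    by (rule functor_function_algebra)
next
  fix X Y :: "'u ordered_space" and h
  assume "X \<in> Ob KH_le" "Y \<in> Ob KH_le"
    and "h \<in> Hom (opposite clone_variety) (function_algebra X) (function_algebra Y)"
  then show "\<exists>k \<in> Hom KH_le X Y. precomposition X Y k = h"
    using precomposition_full[of X Y h] by auto
next
  fix X Y :: "'u ordered_space" and k l
  assume "X \<in> Ob KH_le" "Y \<in> Ob KH_le" "k \<in> Hom KH_le X Y" "l \<in> Hom KH_le X Y"
    and "precomposition X Y k = precomposition X Y l"
  then show "k = l"
    using precomposition_faithful[of X Y k l] by auto
next
  fix M :: "'u algebra" assume "M \<in> Ob (opposite clone_variety)"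
  then show "\<exists>X \<in> Ob KH_le. \<exists>e. is_iso (opposite clone_variety) (function_algebra X) M e"
    using every_model_is_a_function_algebra[of M] by (metis KH_le_simps(1) variety_simps(4))
qed

end

theorem corollary9:
  assumes "is_universe TYPE('u)"
  shows "\<exists>\<V> :: ('u algebra, 'u \<Rightarrow> 'u) category.
           aleph1_ary_variety \<V> \<and>
           dually_equivalent (KH_le :: ('u ordered_space, 'u \<Rightarrow> 'u) category) \<V>"
proof (intro exI conjI)
  show "dually_equivalent (KH_le :: ('u ordered_space, 'u \<Rightarrow> 'u) category)
     (clone_variety :: ('u algebra, 'u \<Rightarrow> 'u) category)"
    by (rule variety_dually_equivalent[OF assms])
  have "small (symbols (clone_signature :: 'u signature))"
    using small_symbols[OF assms] by (simp add: clone_signature_def op_symbol_def)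
  moreover have "(clone_equations :: ('u trm \<times> 'u trm) set) \<subseteq> terms clone_signature \<times> terms clone_signature"
    by (auto simp: clone_equations_def)
  ultimately show "aleph1_ary_variety (clone_variety :: ('u algebra, 'u \<Rightarrow> 'u) category)"
    unfolding aleph1_ary_variety_def by blast
qed

end
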